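(* Let $(A,M,\rho,S)$ be a left symmetric algebroid and let $\mathrm r=\mathfrak a+\mathfrak s\in\Gamma(A\otimes A)$, where $\mathfrak a$ is the skew-symmetric part and $\mathfrak s$ the symmetric part of $\mathrm r$. Let $\rho_{\mathrm r}=\rho\circ\mathrm r_\#:A^*\to TM$ and let $T$ be the right-anchored product on $(A^*,M,\rho_{\mathrm r})$ defined by $$\prec T_\alpha\beta,X\succ=(S_X\mathrm r)(\alpha,\beta)+\prec S^*_{\mathrm r_\#(\alpha)}\beta,X\succ .$$ Then $(A^*,M,\rho_{\mathrm r},T)$ is a left symmetric algebroid and $(A,M,\rho,S)$ and $(A^*,M,\rho_{\mathrm r},T)$ are compatible if and only if, for all $\alpha,\beta\in\Gamma(A^* )$ and $X\in\Gamma(A)$, $$\rho\circ\Delta(\mathrm r)=0,\qquad S^2\mathfrak a=0,\qquad [X,\Delta(\mathrm r)(\alpha,\beta)]_S-\Delta(\mathrm r)(S_X^*\alpha,\beta)-\Delta(\mathrm r)(\alpha,S_X^*\beta)=0 ,$$ where $\Delta(\mathrm r)(\alpha,\beta)=\mathrm r_\#([\alpha,\beta]_T)-[\mathrm r_\#(\alpha),\mathrm r_\#(\beta)]_S\in\Gamma(A)$.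
   Context: All objects are smooth and real; $\prec\cdot,\cdot\succ$ is the pairing between a bundle and its dual. An anchored vector bundle $(A,M,\rho)$ is a vector bundle $A\to M$ with a bundle map $\rho:A\to TM$ over the identity. A right-anchored product on it is an $\mathbb R$-bilinear map $T:\Gamma(A)\times\Gamma(A)\to\Gamma(A)$, $(a,b)\mapsto T_ab$, with $T_{fa}b=fT_ab$ and $T_a(fb)=fT_ab+\rho(a)(f)b$. Its bracket is $[a,b]_T=T_ab-T_ba$ and its curvature is $R^T(a,b)c=T_aT_bc-T_bT_ac-T_{[a,b]_T}c$. $(A,M,\rho,T)$ is a left symmetric algebroid if $R^T=0$ identically. Dual: for a right-anchored product $S$ on $(A,M,\rho)$, $\prec S_X^*\beta,Y\succ=\rho(X).\prec\beta,Y\succ-\prec\beta,S_XY\succ$ for $X,Y\in\Gamma(A)$, $\beta\in\Gamma(A^* )$; for a right-anchored product $T$ on $(A^*,M,\rho_1)$, $\prec\beta,T_\alpha^*X\succ=\rho_1(\alpha).\prec\beta,X\succ-\prec T_\alpha\beta,X\succ$. Compatibility: let $(A,M,\rho,S)$ and $(A^*,M,\rho_1,T)$ be left symmetric algebroids, and let $\nabla$ be the right-anchored product on $(A\oplus A^*,M,\rho\oplus\rho_1)$ given by $\nabla_{X+\alpha}(Y+\beta)=S_XY+T_\alpha^*Y+S_X^*\beta+T_\alpha\beta$, with curvature $R^\nabla$. They are compatible if $R^\nabla(X,\alpha)Y=R^\nabla(Y,\alpha)X$ and $R^\nabla(\alpha,X)\beta=R^\nabla(\beta,X)\alpha$ for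 all $X,Y\in\Gamma(A)$, $\alpha,\beta\in\Gamma(A^* )$. For $\mathrm r\in\Gamma(A\otimes A)$, viewed as a bilinear form on $A^*$, $\mathrm r_\#:A^*\to A$ is given by $\beta(\mathrm r_\#(\alpha))=\mathrm r(\alpha,\beta)$, and $(S_X\mathrm r)(\alpha,\beta)=\rho(X).\mathrm r(\alpha,\beta)-\mathrm r(S_X^*\alpha,\beta)-\mathrm r(\alpha,S_X^*\beta)$. Also $S^2_{X,Y}\mathfrak a=S_X(S_Y\mathfrak a)-S_{S_XY}\mathfrak a$, and $S^2\mathfrak a=0$ means this vanishes for all $X,Y\in\Gamma(A)$. *)

theory Defs
  imports "HOL-Analysis.Analysis" "HOL-Library.Function_Algebras"
begin

section \<open>Functions as a real vector space\<close>

instantiation "fun" :: (type, real_vector) real_vector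
begin

definition scaleR_fun :: "real \<Rightarrow> ('a \<Rightarrow> 'b) \<Rightarrow> 'a \<Rightarrow> 'b"
  where "scaleR_fun c f = (\<lambda>x. c *\<^sub>R f x)"

instance
  by standard (auto simp: scaleR_fun_def fun_eq_iff scaleR_add_right scaleR_add_left)

end


section \<open>Smooth manifolds\<close>

text \<open>
  Model spaces (of charts and of bundle fibres) are finite-dimensional inner product spaces.
  The class euclidean_space is not used for them because it excludes dimension zero, that is,
  discrete base manifolds (such as a point) and bundles of rank zero.
\<close>

definition finite_dimensional :: "'e::real_vector itself \<Rightarrow> bool"
  where "finite_dimensional _ \<longleftrightarrow> (\<exists>B :: 'e set. finite B \<and> span B = UNIV)"

fun Ck_on :: "nat \<Rightarrow> 'e::real_normed_vector set \<Rightarrow> ('e \<Rightarrow> 'b::real_normed_vector) \<Rightarrow> bool" where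
  "Ck_on 0 W f \<longleftrightarrow> continuous_on W f"
| "Ck_on (Suc k) W f \<longleftrightarrow>
     (\<forall>x\<in>W. f differentiable (at x)) \<and> (\<forall>v. Ck_on k W (\<lambda>x. frechet_derivative f (at x) v))"

text \<open>Only used for open \<open>W\<close>.\<close>

definition smooth_on :: "'e::real_normed_vector set \<Rightarrow> ('e \<Rightarrow> 'b::real_normed_vector) \<Rightarrow> bool"
  where "smooth_on W f \<longleftrightarrow> (\<forall>k. Ck_on k W f)"

text \<open>
  A manifold is the whole type \<open>'m\<close> with a smooth atlas; a chart \<open>(U, \<phi>)\<close> is an open set \<open>U\<close>
  with a homeomorphism \<open>\<phi>\<close> of \<open>U\<close> onto an open subset of \<open>'e\<close>. The atlas need not be maximal.
\<close>

type_synonym ('m, 'e) atlas = "('m set \<times> ('m \<Rightarrow> 'e)) set"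

definition smooth_manifold ::
    "('m::{t2_space, second_countable_topology}, 'e::real_inner) atlas \<Rightarrow> bool"
  where "smooth_manifold M \<longleftrightarrow>
    finite_dimensional TYPE('e) \<and>
    (\<Union>(U, \<phi>)\<in>M. U) = UNIV \<and>
    (\<forall>(U, \<phi>)\<in>M. open U \<and> open (\<phi> ` U) \<and> homeomorphism U (\<phi> ` U) \<phi> (inv_into U \<phi>)) \<and>
    (\<forall>(U, \<phi>)\<in>M. \<forall>(V, \<psi>)\<in>M. smooth_on (\<psi> ` (U \<inter> V)) (\<lambda>y. \<phi> (inv_into V \<psi> y)))"

definition smooth_map_on ::
    "('m, 'e::real_inner) atlas \<Rightarrow> 'm set \<Rightarrow> ('m \<Rightarrow> 'b::real_normed_vector) \<Rightarrow> bool"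
  where "smooth_map_on M W g \<longleftrightarrow>
    (\<forall>(U, \<phi>)\<in>M. smooth_on (\<phi> ` (U \<inter> W)) (\<lambda>y. g (inv_into U \<phi> y)))"

definition smooth_functions :: "('m, 'e::real_inner) atlas \<Rightarrow> ('m \<Rightarrow> real) set"
  where "smooth_functions M = {f. smooth_map_on M UNIV f}"


section \<open>Vector bundles\<close>

text \<open>
  The fibre over \<open>x\<close> is the linear subspace \<open>fibre A x\<close> of a real vector space \<open>'v\<close> (which carries
  no topology). The smooth structure is given by a family of local trivializations \<open>(U, \<Psi>)\<close>:
  for \<open>x \<in> U\<close>, \<open>\<Psi> x\<close> is a linear isomorphism of the model fibre \<open>'f\<close> onto \<open>fibre A x\<close>, i.e.
  \<open>(x, v) \<mapsto> \<Psi> x v\<close> is the inverse of the usual map from the restriction of \<open>A\<close> to \<open>U \<times> 'f\<close>.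
\<close>

record ('m, 'v, 'f) vbundle =
  fibre :: "'m \<Rightarrow> 'v set"
  trivs :: "('m set \<times> ('m \<Rightarrow> 'f \<Rightarrow> 'v)) set"

definition vector_bundle ::
    "('m::topological_space, 'e::real_inner) atlas \<Rightarrow>
     ('m, 'v::real_vector, 'f::real_inner) vbundle \<Rightarrow> bool"
  where "vector_bundle M A \<longleftrightarrow>
    finite_dimensional TYPE('f) \<and>
    (\<forall>x. subspace (fibre A x)) \<and>
    (\<Union>(U, \<Psi>)\<in>trivs A. U) = UNIV \<and>
    (\<forall>(U, \<Psi>)\<in>trivs A. open U \<and>
       (\<forall>x\<in>U. linear (\<Psi> x) \<and> bij_betw (\<Psi> x) UNIV (fibre A x))) \<and>
    (\<forall>(U, \<Psi>)\<in>trivs A. \<forall>(V, \<Theta>)\<in>trivs A. \<forall>v.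
       smooth_map_on M (U \<inter> V) (\<lambda>x. inv (\<Theta> x) (\<Psi> x v)))"

definition sections ::
    "('m, 'e::real_inner) atlas \<Rightarrow> ('m, 'v, 'f::real_inner) vbundle \<Rightarrow> ('m \<Rightarrow> 'v) set"
  where "sections M A =
    {a. (\<forall>x. a x \<in> fibre A x) \<and>
        (\<forall>(U, \<Psi>)\<in>trivs A. smooth_map_on M U (\<lambda>x. inv (\<Psi> x) (a x)))}"

text \<open>Smooth bundle maps over the identity of the base.\<close>

definition bundle_map ::
    "('m, 'e::real_inner) atlas \<Rightarrow> ('m, 'v::real_vector, 'f::real_inner) vbundle \<Rightarrow>
     ('m, 'w::real_vector, 'g::real_inner) vbundle \<Rightarrow> ('m \<Rightarrow> 'v \<Rightarrow> 'w) \<Rightarrow> bool"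
  where "bundle_map M A B h \<longleftrightarrow>
    (\<forall>x. \<forall>u\<in>fibre A x. h x u \<in> fibre B x) \<and>
    (\<forall>x. \<forall>u\<in>fibre A x. \<forall>v\<in>fibre A x. h x (u + v) = h x u + h x v) \<and>
    (\<forall>x c. \<forall>u\<in>fibre A x. h x (c *\<^sub>R u) = c *\<^sub>R h x u) \<and>
    (\<forall>(U, \<Psi>)\<in>trivs A. \<forall>(V, \<Theta>)\<in>trivs B. \<forall>v.
       smooth_map_on M (U \<inter> V) (\<lambda>x. inv (\<Theta> x) (h x (\<Psi> x v))))"

text \<open>
  Tangent vectors are the directional derivatives in charts, as operators on smooth functions
  on \<open>M\<close>; they are set to zero on non-smooth functions so that equality of tangent vectors is
  equality of operators.
\<close>

definition chart_deriv ::
    "('m, 'e::real_inner) atlas \<Rightarrow> 'm set \<Rightarrow> ('m \<Rightarrow> 'e) \<Rightarrow> 'm \<Rightarrow> 'e \<Rightarrow> ('m \<Rightarrow> real) \<Rightarrow> real"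
  where "chart_deriv M U \<phi> x v f =
    (if f \<in> smooth_functions M
     then frechet_derivative (\<lambda>y. f (inv_into U \<phi> y)) (at (\<phi> x)) v else 0)"

definition tangent_bundle ::
    "('m, 'e::real_inner) atlas \<Rightarrow> ('m, ('m \<Rightarrow> real) \<Rightarrow> real, 'e) vbundle"
  where "tangent_bundle M =
    \<lparr> fibre = (\<lambda>x. {chart_deriv M U \<phi> x v | U \<phi> v. (U, \<phi>) \<in> M \<and> x \<in> U}),
      trivs = {(U, chart_deriv M U \<phi>) | U \<phi>. (U, \<phi>) \<in> M} \<rparr>"

text \<open>
  Elements of the dual fibre over \<open>x\<close> are linear functionals on \<open>fibre A x\<close>, extended by zero
  outside it. The dual of the model fibre \<open>'f\<close> is identified with \<open>'f\<close> by the inner product, so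
  the trivializations are the contragredient ones.
\<close>

definition dual_bundle ::
    "('m, 'v::real_vector, 'f::real_inner) vbundle \<Rightarrow> ('m, 'v \<Rightarrow> real, 'f) vbundle"
  where "dual_bundle A =
    \<lparr> fibre = (\<lambda>x. {\<beta>.
        (\<forall>u\<in>fibre A x. \<forall>v\<in>fibre A x. \<beta> (u + v) = \<beta> u + \<beta> v) \<and>
        (\<forall>c. \<forall>u\<in>fibre A x. \<beta> (c *\<^sub>R u) = c * \<beta> u) \<and>
        (\<forall>u. u \<notin> fibre A x \<longrightarrow> \<beta> u = 0)}),
      trivs = {(U, \<lambda>x w u. if u \<in> fibre A x then w \<bullet> inv (\<Psi> x) u else 0) | U \<Psi>.
        (U, \<Psi>) \<in> trivs A} \<rparr>"

abbreviation dual_sections ::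
    "('m, 'e::real_inner) atlas \<Rightarrow> ('m, 'v::real_vector, 'f::real_inner) vbundle \<Rightarrow>
     ('m \<Rightarrow> 'v \<Rightarrow> real) set"
  where "dual_sections M A \<equiv> sections M (dual_bundle A)"

definition pairing :: "('m \<Rightarrow> 'v \<Rightarrow> real) \<Rightarrow> ('m \<Rightarrow> 'v) \<Rightarrow> 'm \<Rightarrow> real"
  where "pairing \<beta> X = (\<lambda>x. \<beta> x (X x))"

text \<open>
  Sections of \<open>A \<otimes> A\<close>, viewed as fields of bilinear forms on the dual fibres whose components
  in local trivializations are smooth. The values of \<open>r x\<close> outside the dual fibre over \<open>x\<close> are
  irrelevant.
\<close>

definition tensor_sections ::
    "('m, 'e::real_inner) atlas \<Rightarrow> ('m, 'v::real_vector, 'f::real_inner) vbundle \<Rightarrow>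
     ('m \<Rightarrow> ('v \<Rightarrow> real) \<Rightarrow> ('v \<Rightarrow> real) \<Rightarrow> real) set"
  where "tensor_sections M A = {r.
    (\<forall>x. \<forall>\<alpha>\<in>fibre (dual_bundle A) x. \<forall>\<beta>\<in>fibre (dual_bundle A) x. \<forall>\<gamma>\<in>fibre (dual_bundle A) x.
       r x (\<alpha> + \<beta>) \<gamma> = r x \<alpha> \<gamma> + r x \<beta> \<gamma> \<and> r x \<gamma> (\<alpha> + \<beta>) = r x \<gamma> \<alpha> + r x \<gamma> \<beta>) \<and>
    (\<forall>x c. \<forall>\<alpha>\<in>fibre (dual_bundle A) x. \<forall>\<beta>\<in>fibre (dual_bundle A) x.
       r x (c *\<^sub>R \<alpha>) \<beta> = c * r x \<alpha> \<beta> \<and> r x \<alpha> (c *\<^sub>R \<beta>) = c * r x \<alpha> \<beta>) \<and>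
    (\<forall>(U, \<Psi>)\<in>trivs (dual_bundle A). \<forall>v w. smooth_map_on M U (\<lambda>x. r x (\<Psi> x v) (\<Psi> x w)))}"

definition skew_tensor ::
    "('m, 'v::real_vector, 'f::real_inner) vbundle \<Rightarrow>
     ('m \<Rightarrow> ('v \<Rightarrow> real) \<Rightarrow> ('v \<Rightarrow> real) \<Rightarrow> real) \<Rightarrow> bool"
  where "skew_tensor A r \<longleftrightarrow>
    (\<forall>x. \<forall>\<alpha>\<in>fibre (dual_bundle A) x. \<forall>\<beta>\<in>fibre (dual_bundle A) x. r x \<alpha> \<beta> = - r x \<beta> \<alpha>)"

definition symmetric_tensor ::
    "('m, 'v::real_vector, 'f::real_inner) vbundle \<Rightarrow>
     ('m \<Rightarrow> ('v \<Rightarrow> real) \<Rightarrow> ('v \<Rightarrow> real) \<Rightarrow> real) \<Rightarrow> bool"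
  where "symmetric_tensor A r \<longleftrightarrow>
    (\<forall>x. \<forall>\<alpha>\<in>fibre (dual_bundle A) x. \<forall>\<beta>\<in>fibre (dual_bundle A) x. r x \<alpha> \<beta> = r x \<beta> \<alpha>)"


section \<open>Left symmetric algebroids\<close>

definition anchored_vector_bundle ::
    "('m::{t2_space, second_countable_topology}, 'e::real_inner) atlas \<Rightarrow>
     ('m, 'v::real_vector, 'f::real_inner) vbundle \<Rightarrow>
     ('m \<Rightarrow> 'v \<Rightarrow> ('m \<Rightarrow> real) \<Rightarrow> real) \<Rightarrow> bool"
  where "anchored_vector_bundle M A \<rho> \<longleftrightarrow>
    smooth_manifold M \<and> vector_bundle M A \<and> bundle_map M A (tangent_bundle M) \<rho>"

text \<open>The derivative \<open>\<rho>(X)(f)\<close>.\<close>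

definition anchor_deriv ::
    "('m \<Rightarrow> 'v \<Rightarrow> ('m \<Rightarrow> real) \<Rightarrow> real) \<Rightarrow> ('m \<Rightarrow> 'v) \<Rightarrow> ('m \<Rightarrow> real) \<Rightarrow> 'm \<Rightarrow> real"
  where "anchor_deriv \<rho> X f = (\<lambda>x. \<rho> x (X x) f)"

text \<open>
  Products are functions on all maps \<open>'m \<Rightarrow> 'v\<close>; only their values on pairs of sections matter.
\<close>

definition right_anchored_product ::
    "('m, 'e::real_inner) atlas \<Rightarrow> ('m, 'v::real_vector, 'f::real_inner) vbundle \<Rightarrow>
     ('m \<Rightarrow> 'v \<Rightarrow> ('m \<Rightarrow> real) \<Rightarrow> real) \<Rightarrow>
     (('m \<Rightarrow> 'v) \<Rightarrow> ('m \<Rightarrow> 'v) \<Rightarrow> ('m \<Rightarrow> 'v)) \<Rightarrow> bool"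
  where "right_anchored_product M A \<rho> T \<longleftrightarrow>
    (\<forall>a\<in>sections M A. \<forall>b\<in>sections M A. T a b \<in> sections M A) \<and>
    (\<forall>a\<in>sections M A. \<forall>b\<in>sections M A. \<forall>c\<in>sections M A.
       T (a + b) c = T a c + T b c \<and> T c (a + b) = T c a + T c b) \<and>
    (\<forall>a\<in>sections M A. \<forall>b\<in>sections M A. \<forall>k::real.
       T (k *\<^sub>R a) b = k *\<^sub>R T a b \<and> T a (k *\<^sub>R b) = k *\<^sub>R T a b) \<and>
    (\<forall>a\<in>sections M A. \<forall>b\<in>sections M A. \<forall>f\<in>smooth_functions M.
       T (\<lambda>x. f x *\<^sub>R a x) b = (\<lambda>x. f x *\<^sub>R T a b x) \<and>
       T a (\<lambda>x. f x *\<^sub>R b x) = (\<lambda>x. f x *\<^sub>R T a b x + anchor_deriv \<rho> a f x *\<^sub>R b x))"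

definition bracket :: "('s \<Rightarrow> 's \<Rightarrow> 's::minus) \<Rightarrow> 's \<Rightarrow> 's \<Rightarrow> 's"
  where "bracket T a b = T a b - T b a"

definition curvature :: "('s \<Rightarrow> 's \<Rightarrow> 's::minus) \<Rightarrow> 's \<Rightarrow> 's \<Rightarrow> 's \<Rightarrow> 's"
  where "curvature T a b c = T a (T b c) - T b (T a c) - T (bracket T a b) c"

definition left_symmetric_algebroid ::
    "('m::{t2_space, second_countable_topology}, 'e::real_inner) atlas \<Rightarrow>
     ('m, 'v::real_vector, 'f::real_inner) vbundle \<Rightarrow>
     ('m \<Rightarrow> 'v \<Rightarrow> ('m \<Rightarrow> real) \<Rightarrow> real) \<Rightarrow>
     (('m \<Rightarrow> 'v) \<Rightarrow> ('m \<Rightarrow> 'v) \<Rightarrow> ('m \<Rightarrow> 'v)) \<Rightarrow> bool"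
  where "left_symmetric_algebroid M A \<rho> T \<longleftrightarrow>
    anchored_vector_bundle M A \<rho> \<and> right_anchored_product M A \<rho> T \<and>
    (\<forall>a\<in>sections M A. \<forall>b\<in>sections M A. \<forall>c\<in>sections M A. curvature T a b c = 0)"

text \<open>
  The dual products, \<open>S\<^sup>*\<^sub>X \<beta>\<close> for a product \<open>S\<close> on \<open>A\<close>, and \<open>T\<^sup>*\<^sub>\<alpha> X\<close> for a product \<open>T\<close> on the dual
  bundle (identifying the bidual of \<open>A\<close> with \<open>A\<close>).
\<close>

definition dual_product ::
    "('m, 'e::real_inner) atlas \<Rightarrow> ('m, 'v::real_vector, 'f::real_inner) vbundle \<Rightarrow>
     ('m \<Rightarrow> 'v \<Rightarrow> ('m \<Rightarrow> real) \<Rightarrow> real) \<Rightarrow>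
     (('m \<Rightarrow> 'v) \<Rightarrow> ('m \<Rightarrow> 'v) \<Rightarrow> ('m \<Rightarrow> 'v)) \<Rightarrow>
     ('m \<Rightarrow> 'v) \<Rightarrow> ('m \<Rightarrow> 'v \<Rightarrow> real) \<Rightarrow> ('m \<Rightarrow> 'v \<Rightarrow> real)"
  where "dual_product M A \<rho> S X \<beta> =
    (THE \<gamma>. \<gamma> \<in> dual_sections M A \<and>
       (\<forall>Y\<in>sections M A.
          pairing \<gamma> Y = anchor_deriv \<rho> X (pairing \<beta> Y) - pairing \<beta> (S X Y)))"

definition predual_product ::
    "('m, 'e::real_inner) atlas \<Rightarrow> ('m, 'v::real_vector, 'f::real_inner) vbundle \<Rightarrow>
     ('m \<Rightarrow> ('v \<Rightarrow> real) \<Rightarrow> ('m \<Rightarrow> real) \<Rightarrow> real) \<Rightarrow>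
     (('m \<Rightarrow> 'v \<Rightarrow> real) \<Rightarrow> ('m \<Rightarrow> 'v \<Rightarrow> real) \<Rightarrow> ('m \<Rightarrow> 'v \<Rightarrow> real)) \<Rightarrow>
     ('m \<Rightarrow> 'v \<Rightarrow> real) \<Rightarrow> ('m \<Rightarrow> 'v) \<Rightarrow> ('m \<Rightarrow> 'v)"
  where "predual_product M A \<rho>1 T \<alpha> X =
    (THE Z. Z \<in> sections M A \<and>
       (\<forall>\<beta>\<in>dual_sections M A.
          pairing \<beta> Z = anchor_deriv \<rho>1 \<alpha> (pairing \<beta> X) - pairing (T \<alpha> \<beta>) X))"

text \<open>
  Sections of the direct sum of \<open>A\<close> and its dual are maps \<open>x \<mapsto> (Y x, \<beta> x)\<close>; \<open>double_product\<close>
  is the product \<open>\<nabla>\<close> on them built from \<open>S\<close> and \<open>T\<close>.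
\<close>

definition sum_section :: "('m \<Rightarrow> 'v) \<Rightarrow> ('m \<Rightarrow> 'w) \<Rightarrow> 'm \<Rightarrow> 'v \<times> 'w"
  where "sum_section Y \<beta> = (\<lambda>x. (Y x, \<beta> x))"

definition double_product ::
    "('m, 'e::real_inner) atlas \<Rightarrow> ('m, 'v::real_vector, 'f::real_inner) vbundle \<Rightarrow>
     ('m \<Rightarrow> 'v \<Rightarrow> ('m \<Rightarrow> real) \<Rightarrow> real) \<Rightarrow>
     (('m \<Rightarrow> 'v) \<Rightarrow> ('m \<Rightarrow> 'v) \<Rightarrow> ('m \<Rightarrow> 'v)) \<Rightarrow>
     ('m \<Rightarrow> ('v \<Rightarrow> real) \<Rightarrow> ('m \<Rightarrow> real) \<Rightarrow> real) \<Rightarrow>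
     (('m \<Rightarrow> 'v \<Rightarrow> real) \<Rightarrow> ('m \<Rightarrow> 'v \<Rightarrow> real) \<Rightarrow> ('m \<Rightarrow> 'v \<Rightarrow> real)) \<Rightarrow>
     ('m \<Rightarrow> 'v \<times> ('v \<Rightarrow> real)) \<Rightarrow> ('m \<Rightarrow> 'v \<times> ('v \<Rightarrow> real)) \<Rightarrow> ('m \<Rightarrow> 'v \<times> ('v \<Rightarrow> real))"
  where "double_product M A \<rho> S \<rho>1 T u w =
    (let X = fst \<circ> u; \<alpha> = snd \<circ> u; Y = fst \<circ> w; \<beta> = snd \<circ> w in
     sum_section (S X Y + predual_product M A \<rho>1 T \<alpha> Y) (dual_product M A \<rho> S X \<beta> + T \<alpha> \<beta>))"

definition compatible ::
    "('m, 'e::real_inner) atlas \<Rightarrow> ('m, 'v::real_vector, 'f::real_inner) vbundle \<Rightarrow>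
     ('m \<Rightarrow> 'v \<Rightarrow> ('m \<Rightarrow> real) \<Rightarrow> real) \<Rightarrow>
     (('m \<Rightarrow> 'v) \<Rightarrow> ('m \<Rightarrow> 'v) \<Rightarrow> ('m \<Rightarrow> 'v)) \<Rightarrow>
     ('m \<Rightarrow> ('v \<Rightarrow> real) \<Rightarrow> ('m \<Rightarrow> real) \<Rightarrow> real) \<Rightarrow>
     (('m \<Rightarrow> 'v \<Rightarrow> real) \<Rightarrow> ('m \<Rightarrow> 'v \<Rightarrow> real) \<Rightarrow> ('m \<Rightarrow> 'v \<Rightarrow> real)) \<Rightarrow> bool"
  where "compatible M A \<rho> S \<rho>1 T \<longleftrightarrow>
    (let R = curvature (double_product M A \<rho> S \<rho>1 T);
         i = (\<lambda>X. sum_section X 0); j = (\<lambda>\<alpha>. sum_section 0 \<alpha>) in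
     (\<forall>X\<in>sections M A. \<forall>Y\<in>sections M A. \<forall>\<alpha>\<in>dual_sections M A.
        R (i X) (j \<alpha>) (i Y) = R (i Y) (j \<alpha>) (i X)) \<and>
     (\<forall>X\<in>sections M A. \<forall>\<alpha>\<in>dual_sections M A. \<forall>\<beta>\<in>dual_sections M A.
        R (j \<alpha>) (i X) (j \<beta>) = R (j \<beta>) (i X) (j \<alpha>)))"


section \<open>The product on the dual bundle defined by a 2-tensor\<close>

definition sharp ::
    "('m, 'v::real_vector, 'f::real_inner) vbundle \<Rightarrow>
     ('m \<Rightarrow> ('v \<Rightarrow> real) \<Rightarrow> ('v \<Rightarrow> real) \<Rightarrow> real) \<Rightarrow> 'm \<Rightarrow> ('v \<Rightarrow> real) \<Rightarrow> 'v"
  where "sharp A r x \<alpha> =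
    (THE v. v \<in> fibre A x \<and> (\<forall>\<beta>\<in>fibre (dual_bundle A) x. \<beta> v = r x \<alpha> \<beta>))"

definition sharp_section ::
    "('m, 'v::real_vector, 'f::real_inner) vbundle \<Rightarrow>
     ('m \<Rightarrow> ('v \<Rightarrow> real) \<Rightarrow> ('v \<Rightarrow> real) \<Rightarrow> real) \<Rightarrow> ('m \<Rightarrow> 'v \<Rightarrow> real) \<Rightarrow> 'm \<Rightarrow> 'v"
  where "sharp_section A r \<alpha> = (\<lambda>x. sharp A r x (\<alpha> x))"

definition tensor_anchor ::
    "('m, 'v::real_vector, 'f::real_inner) vbundle \<Rightarrow>
     ('m \<Rightarrow> 'v \<Rightarrow> ('m \<Rightarrow> real) \<Rightarrow> real) \<Rightarrow>
     ('m \<Rightarrow> ('v \<Rightarrow> real) \<Rightarrow> ('v \<Rightarrow> real) \<Rightarrow> real) \<Rightarrow>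
     'm \<Rightarrow> ('v \<Rightarrow> real) \<Rightarrow> ('m \<Rightarrow> real) \<Rightarrow> real"
  where "tensor_anchor A \<rho> r = (\<lambda>x \<alpha>. \<rho> x (sharp A r x \<alpha>))"

text \<open>
  \<open>S_tensor\<close> is \<open>(S\<^sub>X B)(\<alpha>, \<beta>)\<close>, where the tensors \<open>B\<close> and \<open>S\<^sub>X B\<close> are viewed as bilinear maps
  on sections of the dual bundle; \<open>on_sections\<close> passes from a section of \<open>A \<otimes> A\<close> to such a map.
\<close>

definition on_sections ::
    "('m \<Rightarrow> ('v \<Rightarrow> real) \<Rightarrow> ('v \<Rightarrow> real) \<Rightarrow> real) \<Rightarrow>
     ('m \<Rightarrow> 'v \<Rightarrow> real) \<Rightarrow> ('m \<Rightarrow> 'v \<Rightarrow> real) \<Rightarrow> 'm \<Rightarrow> real"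
  where "on_sections r \<alpha> \<beta> = (\<lambda>x. r x (\<alpha> x) (\<beta> x))"

definition S_tensor ::
    "('m, 'e::real_inner) atlas \<Rightarrow> ('m, 'v::real_vector, 'f::real_inner) vbundle \<Rightarrow>
     ('m \<Rightarrow> 'v \<Rightarrow> ('m \<Rightarrow> real) \<Rightarrow> real) \<Rightarrow>
     (('m \<Rightarrow> 'v) \<Rightarrow> ('m \<Rightarrow> 'v) \<Rightarrow> ('m \<Rightarrow> 'v)) \<Rightarrow> ('m \<Rightarrow> 'v) \<Rightarrow>
     (('m \<Rightarrow> 'v \<Rightarrow> real) \<Rightarrow> ('m \<Rightarrow> 'v \<Rightarrow> real) \<Rightarrow> 'm \<Rightarrow> real) \<Rightarrow>
     ('m \<Rightarrow> 'v \<Rightarrow> real) \<Rightarrow> ('m \<Rightarrow> 'v \<Rightarrow> real) \<Rightarrow> 'm \<Rightarrow> real"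
  where "S_tensor M A \<rho> S X B \<alpha> \<beta> =
    anchor_deriv \<rho> X (B \<alpha> \<beta>) - B (dual_product M A \<rho> S X \<alpha>) \<beta> - B \<alpha> (dual_product M A \<rho> S X \<beta>)"

definition S2_tensor ::
    "('m, 'e::real_inner) atlas \<Rightarrow> ('m, 'v::real_vector, 'f::real_inner) vbundle \<Rightarrow>
     ('m \<Rightarrow> 'v \<Rightarrow> ('m \<Rightarrow> real) \<Rightarrow> real) \<Rightarrow>
     (('m \<Rightarrow> 'v) \<Rightarrow> ('m \<Rightarrow> 'v) \<Rightarrow> ('m \<Rightarrow> 'v)) \<Rightarrow> ('m \<Rightarrow> 'v) \<Rightarrow> ('m \<Rightarrow> 'v) \<Rightarrow>
     (('m \<Rightarrow> 'v \<Rightarrow> real) \<Rightarrow> ('m \<Rightarrow> 'v \<Rightarrow> real) \<Rightarrow> 'm \<Rightarrow> real) \<Rightarrow>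
     ('m \<Rightarrow> 'v \<Rightarrow> real) \<Rightarrow> ('m \<Rightarrow> 'v \<Rightarrow> real) \<Rightarrow> 'm \<Rightarrow> real"
  where "S2_tensor M A \<rho> S X Y B \<alpha> \<beta> =
    S_tensor M A \<rho> S X (S_tensor M A \<rho> S Y B) \<alpha> \<beta> - S_tensor M A \<rho> S (S X Y) B \<alpha> \<beta>"

definition tensor_product ::
    "('m, 'e::real_inner) atlas \<Rightarrow> ('m, 'v::real_vector, 'f::real_inner) vbundle \<Rightarrow>
     ('m \<Rightarrow> 'v \<Rightarrow> ('m \<Rightarrow> real) \<Rightarrow> real) \<Rightarrow>
     (('m \<Rightarrow> 'v) \<Rightarrow> ('m \<Rightarrow> 'v) \<Rightarrow> ('m \<Rightarrow> 'v)) \<Rightarrow>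
     ('m \<Rightarrow> ('v \<Rightarrow> real) \<Rightarrow> ('v \<Rightarrow> real) \<Rightarrow> real) \<Rightarrow>
     ('m \<Rightarrow> 'v \<Rightarrow> real) \<Rightarrow> ('m \<Rightarrow> 'v \<Rightarrow> real) \<Rightarrow> ('m \<Rightarrow> 'v \<Rightarrow> real)"
  where "tensor_product M A \<rho> S r \<alpha> \<beta> =
    (THE \<gamma>. \<gamma> \<in> dual_sections M A \<and>
       (\<forall>X\<in>sections M A.
          pairing \<gamma> X = S_tensor M A \<rho> S X (on_sections r) \<alpha> \<beta>
            + pairing (dual_product M A \<rho> S (sharp_section A r \<alpha>) \<beta>) X))"

definition tensor_Delta ::
    "('m, 'e::real_inner) atlas \<Rightarrow> ('m, 'v::real_vector, 'f::real_inner) vbundle \<Rightarrow>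
     ('m \<Rightarrow> 'v \<Rightarrow> ('m \<Rightarrow> real) \<Rightarrow> real) \<Rightarrow>
     (('m \<Rightarrow> 'v) \<Rightarrow> ('m \<Rightarrow> 'v) \<Rightarrow> ('m \<Rightarrow> 'v)) \<Rightarrow>
     ('m \<Rightarrow> ('v \<Rightarrow> real) \<Rightarrow> ('v \<Rightarrow> real) \<Rightarrow> real) \<Rightarrow>
     ('m \<Rightarrow> 'v \<Rightarrow> real) \<Rightarrow> ('m \<Rightarrow> 'v \<Rightarrow> real) \<Rightarrow> 'm \<Rightarrow> 'v"
  where "tensor_Delta M A \<rho> S r \<alpha> \<beta> =
    sharp_section A r (bracket (tensor_product M A \<rho> S r) \<alpha> \<beta>)
      - bracket S (sharp_section A r \<alpha>) (sharp_section A r \<beta>)"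

end

theory Submission
  imports Defs
begin

text \<open>
  Writing \<open>r\<close> also for \<open>r\<^sub>#\<close>, the product dual to \<open>T\<close> is
  \<open>T\<^sup>*\<^sub>\<alpha> X = [r \<alpha>, X]\<^sub>S + r (S\<^sup>*\<^sub>X \<alpha>)\<close>. With this formula the first compatibility condition reduces to
  the Jacobi identity and the flatness of \<open>S\<^sup>*\<close>, hence always holds, and the defect \<open>K(\<alpha>, \<beta>, X)\<close> of
  the second one satisfies \<open>\<prec>K(\<alpha>, \<beta>, X), Y\<succ> = -2 (S\<^sup>2\<^sub>X\<^sub>,\<^sub>Y \<aa>)(\<alpha>, \<beta>)\<close>, so that compatibility means
  \<open>S\<^sup>2 \<aa> = 0\<close>. The curvature of \<open>T\<^sup>*\<close> is
  \<open>[X, \<Delta>(\<alpha>, \<beta>)] - \<Delta>(S\<^sup>*\<^sub>X \<alpha>, \<beta>) - \<Delta>(\<alpha>, S\<^sup>*\<^sub>X \<beta>) + r K(\<alpha>, \<beta>, X)\<close>, and it is, up to sign, dual to that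
  of \<open>T\<close> except for the derivative along \<open>\<rho> \<Delta>(\<alpha>, \<beta>)\<close>, which the Leibniz rule for \<open>T\<close> kills when
  \<open>T\<close> is flat. That all these products are well defined rests on the duality over the smooth functions
  between the sections of a bundle and those of its dual, obtained from cutoff functions.
\<close>


section \<open>Orthonormal bases\<close>

text \<open>The equivalence is not proved condition by condition. The curvature of \<open>T\<close>
  contains the defect of compatibility, so flatness is compared with the two conditions on \<Delta>
  only after that defect is known to vanish; since compatibility is equivalent to one conjunct of
  the right-hand side, the case where it fails is settled at once.

  Two obstacles shape the rest. Sections, functions and tangent vectors are global objects, while
  coordinates are local: a frame field or a coordinate function must be cut off before a product or
  a tangent vector may act on it. And the products are given by \<open>THE\<close>, so nothing can
  be said about them before unique existence is shown; afterwards they enter only through their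
  pairings.

  Fibres of dimension zero are allowed. Over such a point the Leibniz rule says nothing about the
  anchor, and the vanishing of all sections there takes its place. As the model spaces are only
  known to have a finite spanning set, their calculus and the compactness of their balls are derived
  from a chosen orthonormal basis.\<close>

definition onb :: "'e::real_inner set" where
  "onb = (SOME B. finite B \<and> span B = UNIV \<and> (\<forall>u\<in>B. \<forall>v\<in>B. u \<bullet> v = (if u = v then 1 else 0)))"

text \<open>Removing 0 from an orthogonal spanning set and normalising the rest does not change the
  span; in dimension zero the empty set results.\<close>

lemma onb_exists:
  assumes "finite_dimensional TYPE('e::real_inner)"
  shows "finite (onb :: 'e set) \<and> span (onb :: 'e set) = UNIV \<and>
    (\<forall>u\<in>(onb :: 'e set). \<forall>v\<in>onb. u \<bullet> v = (if u = v then 1 else 0))"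
  unfolding onb_def
proof (rule someI_ex)
  obtain B0 :: "'e set" where B0: "finite B0" "span B0 = UNIV"
    using assms unfolding finite_dimensional_def by auto
  obtain C :: "'e set" where C: "finite C" "span C = UNIV" "pairwise orthogonal C"
    using basis_orthogonal[OF B0(1)] unfolding B0(2) by blast
  define D where "D = (\<lambda>v. v /\<^sub>R norm v) ` (C - {0})"
  have "C \<subseteq> span D"
  proof
    fix v assume v: "v \<in> C"
    show "v \<in> span D"
    proof (cases "v = 0")
      case False
      then have "v /\<^sub>R norm v \<in> span D"
        using v by (intro span_base) (auto simp: D_def)
      then have "norm v *\<^sub>R (v /\<^sub>R norm v) \<in> span D" by (rule span_scale)
      then show ?thesis using False by simp
    qed (simp add: span_zero)
  qed
  then have "span D = UNIV" using C(2) by (metis span_minimal subspace_span top.extremum_uniqueI)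
  moreover have "u \<bullet> v = (if u = v then 1 else 0)" if u: "u \<in> D" and v: "v \<in> D" for u v
  proof -
    obtain a where a: "a \<in> C" "a \<noteq> 0" "u = a /\<^sub>R norm a"
      using u unfolding D_def by blast
    obtain b where b: "b \<in> C" "b \<noteq> 0" "v = b /\<^sub>R norm b"
      using v unfolding D_def by blast
    show ?thesis
    proof (cases "a = b")
      case True
      then show ?thesis using a b by (auto simp: dot_square_norm power2_eq_square)
    next
      case False
      then have ab: "a \<bullet> b = 0" using C(3) a b by (auto simp: pairwise_def orthogonal_def)
      then have "u \<bullet> v = 0" using a b by simp
      moreover have "v \<bullet> v \<noteq> 0" using b by simp
      ultimately show ?thesis by auto
    qed
  qed
  ultimately show "\<exists>D. finite D \<and> span D = UNIV \<and>
      (\<forall>u\<in>D. \<forall>v\<in>(D::'e set). u \<bullet> v = (if u = v then 1 else 0))"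
    using C(1) by (intro exI[of _ D]) (auto simp: D_def)
qed

lemma finite_onb: "finite_dimensional TYPE('e::real_inner) \<Longrightarrow> finite (onb :: 'e set)"
  using onb_exists by blast

lemma onb_expansion:
  assumes "finite_dimensional TYPE('e::real_inner)"
  shows "(\<Sum>b\<in>onb. (v \<bullet> b) *\<^sub>R b) = (v :: 'e)"
proof -
  note B = onb_exists[OF assms]
  have "v \<in> span onb" using B by simp
  then show ?thesis
  proof (induction rule: span_induct_alt)
    case base
    then show ?case by simp
  next
    case (step c x y)
    have "(\<Sum>b\<in>onb. (x \<bullet> b) *\<^sub>R b) = (\<Sum>b\<in>onb. if b = x then x else 0)"
      using B step(1) by (intro sum.cong) auto
    also have "\<dots> = x" using B step(1) by simp
    finally have "(\<Sum>b\<in>onb. (x \<bullet> b) *\<^sub>R b) = x" .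
    moreover have "(\<Sum>b\<in>onb. ((c *\<^sub>R x + y) \<bullet> b) *\<^sub>R b) =
        c *\<^sub>R (\<Sum>b\<in>onb. (x \<bullet> b) *\<^sub>R b) + (\<Sum>b\<in>onb. (y \<bullet> b) *\<^sub>R b)"
      by (simp add: inner_add_left scaleR_add_left sum.distrib scaleR_sum_right)
    ultimately show ?case using step(2) by simp
  qed
qed

lemma onb_eqI:
  assumes "finite_dimensional TYPE('e::real_inner)" "\<And>b. b \<in> onb \<Longrightarrow> v \<bullet> b = w \<bullet> b"
  shows "(v :: 'e) = w"
proof -
  have "v = (\<Sum>b\<in>onb. (v \<bullet> b) *\<^sub>R b)" using onb_expansion[OF assms(1), of v] by simp
  also have "\<dots> = (\<Sum>b\<in>onb. (w \<bullet> b) *\<^sub>R b)" using assms(2) by (intro sum.cong) auto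
  also have "\<dots> = w" using onb_expansion[OF assms(1), of w] by simp
  finally show ?thesis .
qed

text \<open>The recurring device for smoothness: a linear map that varies with a point becomes a
  finite sum over its values on fixed vectors.\<close>

lemma linear_onb_expansion:
  assumes "finite_dimensional TYPE('e::real_inner)" "linear h"
  shows "h v = (\<Sum>b\<in>onb. (v \<bullet> b) *\<^sub>R h (b :: 'e))"
proof -
  have "h v = h (\<Sum>b\<in>onb. (v \<bullet> b) *\<^sub>R b)" using onb_expansion[OF assms(1), of v] by simp
  also have "\<dots> = (\<Sum>b\<in>onb. (v \<bullet> b) *\<^sub>R h b)"
    by (simp add: linear_sum[OF assms(2)] linear_scale[OF assms(2)])
  finally show ?thesis .
qed

lemma finite_dimensional_real: "finite_dimensional TYPE(real)"
  unfolding finite_dimensional_def by (rule exI[of _ "{1}"]) (auto simp: span_singleton)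

text \<open>Coordinates with respect to \<open>onb\<close> are bounded on the ball, which is
  therefore a closed subset of a finite sum of segments; such a sum is compact by induction on the
  number of segments.\<close>

lemma compact_cball_finite_dimensional:
  assumes "finite_dimensional TYPE('e::real_inner)"
  shows "compact (cball (x :: 'e) e)"
proof -
  note B = onb_exists[OF assms]
  have comp: "compact {\<Sum>b\<in>C. k b *\<^sub>R b |k. \<forall>b :: 'e. \<bar>k b\<bar> \<le> R}" if "finite C" for C :: "'e set" and R :: real
    using that
  proof (induction C)
    case empty
    have "{\<Sum>b\<in>({} :: 'e set). k b *\<^sub>R b |k. \<forall>b :: 'e. \<bar>k b\<bar> \<le> R} \<subseteq> {0}" by auto
    then show ?case by (meson finite.emptyI finite_imp_compact finite_insert finite_subset)
  next
    case (insert a C)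
    let ?K = "{\<Sum>b\<in>C. k b *\<^sub>R b |k. \<forall>b :: 'e. \<bar>k b\<bar> \<le> R}"
    let ?L = "(\<lambda>t. t *\<^sub>R a) ` {-R..R}"
    have "compact ?L" by (intro compact_continuous_image continuous_intros) auto
    moreover have "{\<Sum>b\<in>insert a C. k b *\<^sub>R b |k. \<forall>b :: 'e. \<bar>k b\<bar> \<le> R} = {x + y |x y. x \<in> ?L \<and> y \<in> ?K}"
      (is "?A = ?B")
    proof (intro set_eqI iffI)
      fix z assume "z \<in> ?A"
      then obtain k :: "'e \<Rightarrow> real" where k: "z = (\<Sum>b\<in>insert a C. k b *\<^sub>R b)" "\<forall>b. \<bar>k b\<bar> \<le> R"
        by blast
      have "z = k a *\<^sub>R a + (\<Sum>b\<in>C. k b *\<^sub>R b)"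
        using insert.hyps k(1) by simp
      moreover have "k a *\<^sub>R a \<in> ?L"
        using k(2)[rule_format, of a] by (intro imageI) (auto simp: abs_le_iff)
      moreover have "(\<Sum>b\<in>C. k b *\<^sub>R b) \<in> ?K" using k(2) by blast
      ultimately show "z \<in> ?B" by blast
    next
      fix z assume "z \<in> ?B"
      then obtain t and k :: "'e \<Rightarrow> real" where tk: "t \<in> {-R..R}" "\<forall>b. \<bar>k b\<bar> \<le> R"
        "z = t *\<^sub>R a + (\<Sum>b\<in>C. k b *\<^sub>R b)"
        by blast
      have "(\<Sum>b\<in>C. k b *\<^sub>R b) = (\<Sum>b\<in>C. (k(a := t)) b *\<^sub>R b)"
        using insert.hyps by (intro sum.cong) auto
      then have "z = (\<Sum>b\<in>insert a C. (k(a := t)) b *\<^sub>R b)"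
        using insert.hyps tk(3) by simp
      moreover have "\<forall>b. \<bar>(k(a := t)) b\<bar> \<le> R" using tk(1,2) by (auto simp: abs_le_iff)
      ultimately show "z \<in> ?A" by blast
    qed
    ultimately show ?case using compact_sums[OF _ insert.IH, of ?L] by simp
  qed
  \<comment> \<open>This bounds the norm on the ball and, by Cauchy-Schwarz, each coordinate; the
    absolute value keeps it nonnegative whatever the sign of \<open>e\<close>.\<close>
  let ?R = "norm x + \<bar>e\<bar>"
  have "cball x e \<subseteq> {\<Sum>b\<in>onb. k b *\<^sub>R b |k. \<forall>b :: 'e. \<bar>k b\<bar> \<le> ?R}"
  proof
    fix y assume y: "y \<in> cball x e"
    have ny: "norm y \<le> ?R"
      using y norm_triangle_ineq4[of x "x - y"] by (simp add: dist_norm)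
    \<comment> \<open>In \<open>comp\<close> the coefficients are bounded at all vectors of the
      space, so they are set to 0 off the basis.\<close>
    define k where "k = (\<lambda>b. if b \<in> onb then y \<bullet> b else 0)"
    have "\<bar>k b\<bar> \<le> ?R" for b
    proof (cases "b \<in> onb")
      case True
      then have "norm b = 1" using B by (simp add: norm_eq_1)
      then have "\<bar>y \<bullet> b\<bar> \<le> norm y" using Cauchy_Schwarz_ineq2[of y b] by simp
      then show ?thesis using ny True by (simp add: k_def)
    qed (simp add: k_def add_nonneg_nonneg)
    moreover have "y = (\<Sum>b\<in>onb. k b *\<^sub>R b)"
      using onb_expansion[OF assms, of y] by (simp add: k_def)
    ultimately show "y \<in> {\<Sum>b\<in>onb. k b *\<^sub>R b |k. \<forall>b :: 'e. \<bar>k b\<bar> \<le> ?R}" by blast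
  qed
  then have "cball x e = cball x e \<inter> {\<Sum>b\<in>onb. k b *\<^sub>R b |k. \<forall>b :: 'e. \<bar>k b\<bar> \<le> ?R}"
    by (rule Int_absorb2[symmetric])
  also have "compact \<dots>" by (rule closed_Int_compact[OF closed_cball comp[OF finite_onb[OF assms]]])
  finally show ?thesis .
qed


section \<open>Calculus of smooth functions\<close>

text \<open>On an open set \<open>frechet_derivative\<close> depends only on the germ of the
  function, so agreement passes to all iterated derivatives.\<close>

lemma Ck_on_cong:
  assumes "open W" "\<And>x. x \<in> W \<Longrightarrow> f x = g x" "Ck_on k W f"
  shows "Ck_on k W g"
  using assms(2,3)
proof (induction k arbitrary: f g)
  case 0
  then show ?case by (metis Ck_on.simps(1) continuous_on_cong)
next
  case (Suc k)
  have g: "(g has_derivative frechet_derivative f (at x)) (at x)" if "x \<in> W" for x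
  proof -
    have "(f has_derivative frechet_derivative f (at x)) (at x)"
      using Suc.prems(2) that by (auto simp: frechet_derivative_works)
    then show ?thesis
      using has_derivative_transform_within_open[OF _ assms(1) that] Suc.prems(1) by blast
  qed
  have "frechet_derivative f (at x) = frechet_derivative g (at x)" if "x \<in> W" for x
    using frechet_derivative_at[OF g[OF that]] .
  then have "Ck_on k W (\<lambda>x. frechet_derivative g (at x) v)" for v
    using Suc.prems(2) by (rule_tac Suc.IH[of "\<lambda>x. frechet_derivative f (at x) v"]) auto
  then show ?case using g by (auto simp: differentiable_def)
qed

text \<open>Any explicit derivative may stand in for the one chosen by
  \<open>frechet_derivative\<close>; the closure rules below feed sum, product and chain rules
  through this form.\<close>

lemma Ck_on_Suc_has_derivative:
  assumes "open W" "\<And>x. x \<in> W \<Longrightarrow> (f has_derivative f' x) (at x)" "\<And>v. Ck_on k W (\<lambda>x. f' x v)"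
  shows "Ck_on (Suc k) W f"
proof -
  have "f' x = frechet_derivative f (at x)" if "x \<in> W" for x
    using frechet_derivative_at[OF assms(2)[OF that]] .
  then have "Ck_on k W (\<lambda>x. frechet_derivative f (at x) v)" for v
    by (rule_tac Ck_on_cong[OF assms(1) _ assms(3)[of v]]) simp
  then show ?thesis using assms(2) by (auto simp: differentiable_def)
qed

lemma Ck_on_Suc_derivative:
  assumes "Ck_on (Suc k) W f" "x \<in> W"
  shows "(f has_derivative frechet_derivative f (at x)) (at x)"
  using assms by (auto simp: frechet_derivative_works)

lemma Ck_on_SucD: "Ck_on (Suc k) W f \<Longrightarrow> Ck_on k W f"
proof (induction k arbitrary: f)
  case 0
  then show ?case
    by (auto intro!: continuous_at_imp_continuous_on differentiable_imp_continuous_within)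
next
  case (Suc k)
  have "Ck_on k W (\<lambda>x. frechet_derivative f (at x) v)" for v
    using Suc.prems by (intro Suc.IH) simp
  then show ?case using Suc.prems by simp
qed

lemma Ck_on_subset: "Ck_on k W f \<Longrightarrow> V \<subseteq> W \<Longrightarrow> Ck_on k V f"
  by (induction k arbitrary: f) (auto intro: continuous_on_subset)

lemma Ck_on_Union:
  assumes "\<And>N. N \<in> \<N> \<Longrightarrow> open N \<and> Ck_on k N f"
  shows "Ck_on k (\<Union>\<N>) f"
  using assms
proof (induction k arbitrary: f)
  case 0
  then show ?case by (auto intro: continuous_on_open_Union)
next
  case (Suc k)
  have "Ck_on k (\<Union>\<N>) (\<lambda>x. frechet_derivative f (at x) v)" for v
    using Suc.prems by (intro Suc.IH) auto
  moreover have "f differentiable at x" if "x \<in> \<Union>\<N>" for x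
    using Suc.prems that by auto
  ultimately show ?case by simp
qed

lemma Ck_on_const: "Ck_on k W (\<lambda>x. c)"
  by (induction k arbitrary: c) auto

lemma Ck_on_add:
  assumes "open W" "Ck_on k W f" "Ck_on k W g"
  shows "Ck_on k W (\<lambda>x. f x + g x)"
  using assms(2,3)
proof (induction k arbitrary: f g)
  case 0
  then show ?case by (auto intro: continuous_on_add)
next
  case (Suc k)
  show ?case
  proof (rule Ck_on_Suc_has_derivative[OF assms(1)])
    show "((\<lambda>x. f x + g x) has_derivative
        (\<lambda>v. frechet_derivative f (at x) v + frechet_derivative g (at x) v)) (at x)" if "x \<in> W" for x
      using Suc.prems that by (intro has_derivative_add Ck_on_Suc_derivative)
    show "Ck_on k W (\<lambda>x. frechet_derivative f (at x) v + frechet_derivative g (at x) v)" for v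
      using Suc.prems by (intro Suc.IH) auto
  qed
qed

text \<open>The derivative of a bilinear expression is a sum of two expressions of the same kind, so
  a single induction serves products, scalar multiples and inner products.\<close>

lemma Ck_on_bilinear:
  assumes "open W" "bounded_bilinear h" "Ck_on k W f" "Ck_on k W g"
  shows "Ck_on k W (\<lambda>x. h (f x) (g x))"
  using assms(3,4)
proof (induction k arbitrary: f g)
  case 0
  then show ?case by (auto intro: bounded_bilinear.continuous_on[OF assms(2)])
next
  case (Suc k)
  let ?f' = "\<lambda>x. frechet_derivative f (at x)" and ?g' = "\<lambda>x. frechet_derivative g (at x)"
  have fg: "Ck_on k W f" "Ck_on k W g"
    using Suc.prems Ck_on_SucD by blast+
  have f'g': "Ck_on k W (\<lambda>x. ?f' x v)" "Ck_on k W (\<lambda>x. ?g' x v)" for v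
    using Suc.prems by auto
  show ?case
  proof (rule Ck_on_Suc_has_derivative[OF assms(1)])
    show "((\<lambda>x. h (f x) (g x)) has_derivative (\<lambda>v. h (f x) (?g' x v) + h (?f' x v) (g x))) (at x)"
      if "x \<in> W" for x
      using Suc.prems that by (intro bounded_bilinear.FDERIV[OF assms(2)] Ck_on_Suc_derivative)
    show "Ck_on k W (\<lambda>x. h (f x) (?g' x v) + h (?f' x v) (g x))" for v
      by (intro Ck_on_add[OF assms(1)] Suc.IH fg f'g')
  qed
qed

lemmas Ck_on_mult = Ck_on_bilinear[OF _ bounded_bilinear_mult]
lemmas Ck_on_scaleR = Ck_on_bilinear[OF _ bounded_bilinear_scaleR]

lemma Ck_on_sum:
  assumes "open W" "\<And>i. i \<in> I \<Longrightarrow> Ck_on k W (f i)"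
  shows "Ck_on k W (\<lambda>x. \<Sum>i\<in>I. f i x)"
  using assms(2) by (induction I rule: infinite_finite_induct)
    (auto intro!: Ck_on_add[OF assms(1)] simp: Ck_on_const)

lemma Ck_on_linear:
  assumes "open W" "bounded_linear h" "Ck_on k W f"
  shows "Ck_on k W (\<lambda>x. h (f x))"
  using assms(3)
proof (induction k arbitrary: f)
  case 0
  then show ?case using bounded_linear.continuous_on[OF assms(2)] by auto
next
  case (Suc k)
  show ?case
  proof (rule Ck_on_Suc_has_derivative[OF assms(1)])
    show "((\<lambda>x. h (f x)) has_derivative (\<lambda>v. h (frechet_derivative f (at x) v))) (at x)"
      if "x \<in> W" for x
      using Suc.prems that by (intro bounded_linear.has_derivative[OF assms(2)] Ck_on_Suc_derivative)
    show "Ck_on k W (\<lambda>x. h (frechet_derivative f (at x) v))" for v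
      using Suc.prems by (intro Suc.IH) auto
  qed
qed

text \<open>The chain rule gives a linear map and an argument that both depend on \<open>x\<close>.
  Expanding the argument in \<open>onb\<close> leaves products of scalar functions with directional
  derivatives of \<open>g\<close> along fixed vectors, composed with \<open>f\<close>, to which the
  induction hypothesis applies. Hence the finite dimension of the middle space.\<close>

lemma Ck_on_compose:
  fixes f :: "'a::real_normed_vector \<Rightarrow> 'b::real_inner" and g :: "'b \<Rightarrow> 'c::real_normed_vector"
  assumes fd: "finite_dimensional TYPE('b)" and "open W" "open V" "f ` W \<subseteq> V"
    and "Ck_on k V g" "Ck_on k W f"
  shows "Ck_on k W (\<lambda>x. g (f x))"
  using assms(5,6)
proof (induction k arbitrary: g)
  case 0
  then show ?case using continuous_on_compose2[of V g W f] assms(4) by simp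
next
  case (Suc k)
  let ?f' = "\<lambda>x. frechet_derivative f (at x)" and ?g' = "\<lambda>y. frechet_derivative g (at y)"
  have g': "(g has_derivative ?g' (f x)) (at (f x))" if "x \<in> W" for x
    using Suc.prems that assms(4) by (intro Ck_on_Suc_derivative) auto
  show ?case
  proof (rule Ck_on_Suc_has_derivative[OF assms(2)])
    show "((\<lambda>x. g (f x)) has_derivative (\<lambda>v. \<Sum>b\<in>onb. (?f' x v \<bullet> b) *\<^sub>R ?g' (f x) b)) (at x)"
      if x: "x \<in> W" for x
    proof -
      have lin: "linear (?g' (f x))"
        using g'[OF x] has_derivative_linear by blast
      have "((\<lambda>x. g (f x)) has_derivative (\<lambda>v. ?g' (f x) (?f' x v))) (at x)"
        by (rule has_derivative_compose[OF Ck_on_Suc_derivative[OF Suc.prems(2) x] g'[OF x]])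
      moreover have "(\<lambda>v. ?g' (f x) (?f' x v)) = (\<lambda>v. \<Sum>b\<in>onb. (?f' x v \<bullet> b) *\<^sub>R ?g' (f x) b)"
        by (rule ext) (rule linear_onb_expansion[OF fd lin])
      ultimately show ?thesis by (rule subst[rotated])
    qed
    have inner: "Ck_on k W (\<lambda>x. ?f' x v \<bullet> b)" for v b
      using Suc.prems(2) by (intro Ck_on_linear[OF assms(2) bounded_linear_inner_left]) auto
    have outer: "Ck_on k W (\<lambda>x. ?g' (f x) b)" for b
      using Suc.prems(1) by (intro Suc.IH[OF _ Ck_on_SucD[OF Suc.prems(2)]]) auto
    show "Ck_on k W (\<lambda>x. \<Sum>b\<in>onb. (?f' x v \<bullet> b) *\<^sub>R ?g' (f x) b)" for v
      by (intro Ck_on_sum Ck_on_scaleR inner assms(2) outer)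
  qed
qed

lemma Ck_on_id: "open W \<Longrightarrow> Ck_on k W (\<lambda>x. x)"
  by (cases k) (auto intro!: Ck_on_const)

text \<open>The derivative is again a product of inverses and a constant, so the product rule closes
  the induction.\<close>

lemma Ck_on_inverse: "Ck_on k (- {0}) (\<lambda>x :: real. inverse x)"
proof (induction k)
  case 0
  then show ?case by (auto intro!: continuous_intros)
next
  case (Suc k)
  show ?case
  proof (rule Ck_on_Suc_has_derivative)
    show "((\<lambda>x :: real. inverse x) has_derivative (\<lambda>v. (inverse x * inverse x) * (- v))) (at x)"
      if "x \<in> - {0}" for x
      using that has_derivative_inverse'[of x UNIV] by (simp add: mult_ac)
    show "Ck_on k (- {0}) (\<lambda>x :: real. (inverse x * inverse x) * (- v))" for v
      by (intro Ck_on_mult Suc.IH Ck_on_const) auto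
  qed auto
qed

section \<open>Smooth functions as functions of class C^k for every k\<close>

lemma smooth_on_cong: "open W \<Longrightarrow> (\<And>x. x \<in> W \<Longrightarrow> f x = g x) \<Longrightarrow> smooth_on W f \<Longrightarrow> smooth_on W g"
  unfolding smooth_on_def using Ck_on_cong by blast

lemma smooth_on_subset: "smooth_on W f \<Longrightarrow> V \<subseteq> W \<Longrightarrow> smooth_on V f"
  unfolding smooth_on_def using Ck_on_subset by blast

lemma smooth_on_local:
  assumes "\<And>x. x \<in> W \<Longrightarrow> \<exists>N. open N \<and> x \<in> N \<and> smooth_on N f"
  shows "smooth_on W f"
  unfolding smooth_on_def
proof
  fix k
  have "Ck_on k (\<Union>{N. open N \<and> smooth_on N f}) f"
    by (intro Ck_on_Union) (auto simp: smooth_on_def)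
  then show "Ck_on k W f" by (rule Ck_on_subset) (use assms in blast)
qed

lemma smooth_on_const: "smooth_on W (\<lambda>x. c)"
  by (simp add: smooth_on_def Ck_on_const)

lemma smooth_on_id: "open W \<Longrightarrow> smooth_on W (\<lambda>x. x)"
  by (simp add: smooth_on_def Ck_on_id)

lemma smooth_on_bilinear:
  "open W \<Longrightarrow> bounded_bilinear h \<Longrightarrow> smooth_on W f \<Longrightarrow> smooth_on W g \<Longrightarrow> smooth_on W (\<lambda>x. h (f x) (g x))"
  by (simp add: smooth_on_def Ck_on_bilinear)

lemmas smooth_on_mult = smooth_on_bilinear[OF _ bounded_bilinear_mult]
lemmas smooth_on_inner = smooth_on_bilinear[OF _ bounded_bilinear_inner]

lemma smooth_on_add:
  "open W \<Longrightarrow> smooth_on W f \<Longrightarrow> smooth_on W g \<Longrightarrow> smooth_on W (\<lambda>x. f x + g x)"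
  by (simp add: smooth_on_def Ck_on_add)

lemma smooth_on_sum:
  "open W \<Longrightarrow> (\<And>i. i \<in> I \<Longrightarrow> smooth_on W (f i)) \<Longrightarrow> smooth_on W (\<lambda>x. \<Sum>i\<in>I. f i x)"
  by (simp add: smooth_on_def Ck_on_sum)

lemma smooth_on_linear:
  "open W \<Longrightarrow> bounded_linear h \<Longrightarrow> smooth_on W f \<Longrightarrow> smooth_on W (\<lambda>x. h (f x))"
  by (simp add: smooth_on_def Ck_on_linear)

lemmas smooth_on_minus = smooth_on_linear[OF _ bounded_linear_minus[OF bounded_linear_ident]]

lemma smooth_on_compose:
  fixes f :: "'a::real_normed_vector \<Rightarrow> 'b::real_inner" and g :: "'b \<Rightarrow> 'c::real_normed_vector"
  assumes "finite_dimensional TYPE('b)" and "open W" "open V" "f ` W \<subseteq> V"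
    and "smooth_on V g" "smooth_on W f"
  shows "smooth_on W (\<lambda>x. g (f x))"
  unfolding smooth_on_def using assms(5,6) Ck_on_compose[OF assms(1-4)] unfolding smooth_on_def by blast

lemma smooth_on_has_derivative:
  "smooth_on W f \<Longrightarrow> x \<in> W \<Longrightarrow> (f has_derivative frechet_derivative f (at x)) (at x)"
  unfolding smooth_on_def using Ck_on_Suc_derivative by blast

lemma smooth_on_frechet_derivative: "smooth_on W f \<Longrightarrow> smooth_on W (\<lambda>x. frechet_derivative f (at x) v)"
  unfolding smooth_on_def using Ck_on.simps(2) by blast


section \<open>Cutoff functions\<close>

text \<open>Cutoffs need only the case \<open>p = 1\<close>, the classical exp(-1/t) extended by 0.
  Polynomial factors in 1/t make the family closed under differentiation, which the induction on the
  order requires.\<close>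

definition flat_exp :: "real poly \<Rightarrow> real \<Rightarrow> real" where
  "flat_exp p t = (if t > 0 then poly p (1 / t) * exp (- (1 / t)) else 0)"

text \<open>In the variable u = 1/t, differentiation is -u^2 d/du; it turns p(u) exp(-u) into u^2 (p
  - p')(u) exp(-u). At 0 the exponential decay beats every polynomial.\<close>

lemma flat_exp_has_derivative:
  "(flat_exp p has_field_derivative flat_exp ([:0, 0, 1:] * (p - pderiv p)) t) (at t)"
proof -
  consider "t > 0" | "t < 0" | "t = 0" by linarith
  then show ?thesis
  proof cases
    case 1
    have "((\<lambda>t. poly p (1 / t) * exp (- (1 / t))) has_field_derivative
        flat_exp ([:0, 0, 1:] * (p - pderiv p)) t) (at t)"
      using 1 by (auto intro!: derivative_eq_intros simp: flat_exp_def field_simps power2_eq_square)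
    then show ?thesis
      by (rule has_field_derivative_transform_within_open[where S = "{0<..}"])
        (use 1 in \<open>auto simp: flat_exp_def\<close>)
  next
    case 2
    have "((\<lambda>t. 0) has_field_derivative flat_exp ([:0, 0, 1:] * (p - pderiv p)) t) (at t)"
      using 2 by (simp add: flat_exp_def)
    then show ?thesis
      by (rule has_field_derivative_transform_within_open[where S = "{..<0}"])
        (use 2 in \<open>auto simp: flat_exp_def\<close>)
  next
    case 3
    have lim: "((\<lambda>x. poly q x * exp (- x)) \<longlongrightarrow> 0) at_top" for q :: "real poly"
    proof -
      have "((\<lambda>x. \<Sum>i\<le>degree q. coeff q i * (x ^ i / exp x)) \<longlongrightarrow>
          (\<Sum>i\<le>degree q. coeff q i * 0)) at_top"
        by (intro tendsto_sum tendsto_mult tendsto_const tendsto_power_div_exp_0)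
      then show ?thesis
        by (simp add: poly_altdef sum_distrib_right exp_minus divide_inverse mult.assoc)
    qed
    have right: "((\<lambda>h. flat_exp p h / h) \<longlongrightarrow> 0) (at_right 0)"
    proof -
      \<comment> \<open>With u = 1/h the difference quotient at 0 is u p(u) exp(-u);
        \<open>pCons 0 p\<close> supplies the extra factor u.\<close>
      have "((\<lambda>x. poly (pCons 0 p) x * exp (- x)) \<longlongrightarrow> 0) at_top" by (rule lim)
      then have "((\<lambda>h. poly (pCons 0 p) (inverse h) * exp (- inverse h)) \<longlongrightarrow> 0) (at_right 0)"
        by (rule filterlim_compose[OF _ filterlim_inverse_at_top_right])
      then show ?thesis
        by (rule Lim_transform_eventually)
          (rule eventually_mono[OF eventually_at_right_less[of 0]], simp add: flat_exp_def divide_inverse)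
    qed
    have left: "((\<lambda>h. flat_exp p h / h) \<longlongrightarrow> 0) (at_left 0)"
      by (rule Lim_transform_eventually[OF tendsto_const])
        (rule eventually_mono[OF eventually_at_left_real[of "-1" 0]], simp_all add: flat_exp_def)
    have "((\<lambda>h. flat_exp p h / h) \<longlongrightarrow> 0) (at 0)"
      using left right filterlim_split_at by blast
    then show ?thesis using 3 by (simp add: DERIV_def flat_exp_def)
  qed
qed

lemma Ck_on_flat_exp: "Ck_on k UNIV (flat_exp p)"
proof (induction k arbitrary: p)
  case 0
  then show ?case
    by (auto intro!: continuous_at_imp_continuous_on DERIV_isCont flat_exp_has_derivative)
next
  case (Suc k)
  show ?case
  proof (rule Ck_on_Suc_has_derivative)
    show "(flat_exp p has_derivative (\<lambda>v. flat_exp ([:0, 0, 1:] * (p - pderiv p)) t * v)) (at t)" for t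
      using flat_exp_has_derivative[of p t] by (simp only: has_field_derivative_def)
    show "Ck_on k UNIV (\<lambda>x. flat_exp ([:0, 0, 1:] * (p - pderiv p)) x * v)" for v
      by (intro Ck_on_mult Suc.IH Ck_on_const) auto
  qed auto
qed

lemma smooth_on_compose_flat_exp:
  "open W \<Longrightarrow> smooth_on W f \<Longrightarrow> smooth_on W (\<lambda>x. flat_exp p (f x))"
  by (rule smooth_on_compose[OF finite_dimensional_real, where V = UNIV])
    (auto simp: smooth_on_def Ck_on_flat_exp)

text \<open>The quotient u / (u + w), where u is positive exactly inside radius 2r and w exactly
  outside the closed ball of radius r. These regions cover the space, so the denominator never
  vanishes. Squared distances are used because the norm is not smooth at the centre.\<close>

lemma smooth_cutoff_exists:
  fixes x0 :: "'e::real_inner"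
  assumes "0 < r"
  shows "\<exists>f :: 'e \<Rightarrow> real. smooth_on UNIV f \<and> (\<forall>x\<in>ball x0 r. f x = 1) \<and> (\<forall>x. x \<notin> ball x0 (2 * r) \<longrightarrow> f x = 0)"
proof -
  define q where "q = (\<lambda>x. (x - x0) \<bullet> (x - x0))"
  have q: "q x = (dist x0 x)\<^sup>2" for x
    by (simp add: q_def dist_norm norm_minus_commute[of x0] flip: power2_norm_eq_inner)
  define u where "u = (\<lambda>x. flat_exp 1 (4 * r\<^sup>2 - q x))"
  define w where "w = (\<lambda>x. flat_exp 1 (q x - r\<^sup>2))"
  have "smooth_on UNIV (\<lambda>x. x + - x0)"
    by (intro smooth_on_add smooth_on_id smooth_on_const open_UNIV)
  then have sub: "smooth_on UNIV (\<lambda>x. x - x0)" by simp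
  have sq: "smooth_on UNIV q"
    unfolding q_def by (intro smooth_on_inner sub open_UNIV)
  have "smooth_on UNIV (\<lambda>x. 4 * r\<^sup>2 + - q x)"
    by (intro smooth_on_add smooth_on_minus smooth_on_const open_UNIV sq)
  then have su: "smooth_on UNIV u"
    unfolding u_def by (intro smooth_on_compose_flat_exp open_UNIV) simp
  have "smooth_on UNIV (\<lambda>x. q x + - r\<^sup>2)"
    by (intro smooth_on_add smooth_on_const open_UNIV sq)
  then have sw: "smooth_on UNIV w"
    unfolding w_def by (intro smooth_on_compose_flat_exp open_UNIV) simp
  have nonneg: "u x \<ge> 0" "w x \<ge> 0" for x by (auto simp: u_def w_def flat_exp_def)
  have pos: "u x + w x \<noteq> 0" for x
  proof -
    have "4 * r\<^sup>2 - q x > 0 \<or> q x - r\<^sup>2 > 0" using assms zero_less_power[of r 2] by linarith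
    then have "u x > 0 \<or> w x > 0" by (auto simp: u_def w_def flat_exp_def)
    then show ?thesis using nonneg[of x] by linarith
  qed
  have "smooth_on UNIV (\<lambda>x. inverse (u x + w x))"
    by (rule smooth_on_compose[OF finite_dimensional_real, where V = "- {0}"])
      (auto simp: pos smooth_on_def[of "- {0}"] Ck_on_inverse intro!: smooth_on_add su sw)
  then have "smooth_on UNIV (\<lambda>x. u x * inverse (u x + w x))"
    by (intro smooth_on_mult su open_UNIV)
  moreover have "u x * inverse (u x + w x) = 1" if "x \<in> ball x0 r" for x
  proof -
    have "q x < r\<^sup>2" using that by (auto simp: q intro: power_strict_mono)
    then have "w x = 0" by (simp add: w_def flat_exp_def)
    then show ?thesis using pos[of x] by simp
  qed
  moreover have "u x * inverse (u x + w x) = 0" if "x \<notin> ball x0 (2 * r)" for x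
  proof -
    have "(2 * r)\<^sup>2 \<le> q x" using that assms unfolding q by (intro power_mono) auto
    then have "u x = 0" by (simp add: u_def flat_exp_def power_mult_distrib)
    then show ?thesis by simp
  qed
  ultimately show ?thesis by blast
qed


section \<open>Smooth maps on manifolds\<close>

locale manifold =
  fixes M :: "('m::{t2_space, second_countable_topology}, 'e::real_inner) atlas"
  assumes smooth_manifold: "smooth_manifold M"
begin

lemma finite_dimensional_model: "finite_dimensional TYPE('e)"
  using smooth_manifold by (simp add: smooth_manifold_def)

lemma chart_exists: "\<exists>U \<phi>. (U, \<phi>) \<in> M \<and> x \<in> U"
proof -
  have "x \<in> (\<Union>(U, \<phi>)\<in>M. U)" using smooth_manifold by (simp add: smooth_manifold_def)
  then show ?thesis by blast
qed

lemma
  assumes "(U, \<phi>) \<in> M"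
  shows open_chart: "open U" and open_chart_image: "open (\<phi> ` U)"
    and chart_homeomorphism: "homeomorphism U (\<phi> ` U) \<phi> (inv_into U \<phi>)"
  using smooth_manifold assms by (auto simp: smooth_manifold_def)

lemma smooth_on_transition:
  "(U, \<phi>) \<in> M \<Longrightarrow> (V, \<psi>) \<in> M \<Longrightarrow> smooth_on (\<psi> ` (U \<inter> V)) (\<lambda>y. \<phi> (inv_into V \<psi> y))"
  using smooth_manifold unfolding smooth_manifold_def by auto

lemma inv_chart: "(U, \<phi>) \<in> M \<Longrightarrow> x \<in> U \<Longrightarrow> inv_into U \<phi> (\<phi> x) = x"
  using chart_homeomorphism by (simp add: homeomorphism_def)

lemma open_chart_image_Int:
  assumes "(U, \<phi>) \<in> M" "open W"
  shows "open (\<phi> ` (U \<inter> W))"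
proof -
  have "openin (top_of_set (\<phi> ` U)) (\<phi> ` (U \<inter> W))"
    using assms by (intro homeomorphism_imp_open_map[OF chart_homeomorphism]) auto
  then show ?thesis
    using open_chart_image[OF assms(1)] openin_open_trans by blast
qed

lemma smooth_map_on_cong:
  assumes "open W" "\<And>x. x \<in> W \<Longrightarrow> f x = g x" "smooth_map_on M W f"
  shows "smooth_map_on M W g"
  unfolding smooth_map_on_def
proof (clarify)
  fix U \<phi> assume U: "(U, \<phi>) \<in> M"
  show "smooth_on (\<phi> ` (U \<inter> W)) (\<lambda>y. g (inv_into U \<phi> y))"
  proof (rule smooth_on_cong[OF open_chart_image_Int[OF U assms(1)]])
    show "smooth_on (\<phi> ` (U \<inter> W)) (\<lambda>y. f (inv_into U \<phi> y))"
      using assms(3) U by (auto simp: smooth_map_on_def)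
    show "f (inv_into U \<phi> y) = g (inv_into U \<phi> y)" if "y \<in> \<phi> ` (U \<inter> W)" for y
      using that inv_chart[OF U] assms(2) by auto
  qed
qed

lemma smooth_map_on_subset:
  assumes "smooth_map_on M W f" "V \<subseteq> W"
  shows "smooth_map_on M V f"
  unfolding smooth_map_on_def
proof (clarify)
  fix U \<phi> assume U: "(U, \<phi>) \<in> M"
  have "smooth_on (\<phi> ` (U \<inter> W)) (\<lambda>y. f (inv_into U \<phi> y))"
    using assms(1) U by (auto simp: smooth_map_on_def)
  then show "smooth_on (\<phi> ` (U \<inter> V)) (\<lambda>y. f (inv_into U \<phi> y))"
    by (rule smooth_on_subset) (use assms(2) in auto)
qed

lemma smooth_map_on_local:
  assumes "\<And>x. x \<in> W \<Longrightarrow> \<exists>N. open N \<and> x \<in> N \<and> smooth_map_on M N f"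
  shows "smooth_map_on M W f"
  unfolding smooth_map_on_def
proof (clarify)
  fix U \<phi> assume U: "(U, \<phi>) \<in> M"
  show "smooth_on (\<phi> ` (U \<inter> W)) (\<lambda>y. f (inv_into U \<phi> y))"
  proof (rule smooth_on_local)
    fix y assume "y \<in> \<phi> ` (U \<inter> W)"
    then obtain x where x: "x \<in> U" "x \<in> W" "y = \<phi> x" by blast
    then obtain N where N: "open N" "x \<in> N" "smooth_map_on M N f" using assms by blast
    then have "smooth_on (\<phi> ` (U \<inter> N)) (\<lambda>y. f (inv_into U \<phi> y))"
      using U by (auto simp: smooth_map_on_def)
    then show "\<exists>N. open N \<and> y \<in> N \<and> smooth_on N (\<lambda>y. f (inv_into U \<phi> y))"
      using open_chart_image_Int[OF U N(1)] x N(2) by blast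
  qed
qed

text \<open>One chart containing \<open>N\<close> is enough: every other representative is obtained
  by composing with a chart transition.\<close>

lemma smooth_map_onI_chart:
  assumes V: "(V, \<psi>) \<in> M" and N: "open N" "N \<subseteq> V"
    and f: "smooth_on (\<psi> ` N) (\<lambda>y. f (inv_into V \<psi> y))"
  shows "smooth_map_on M N f"
  unfolding smooth_map_on_def
proof (clarify)
  fix U \<phi> assume U: "(U, \<phi>) \<in> M"
  have op: "open (\<phi> ` (U \<inter> N))" "open (\<psi> ` N)"
    using open_chart_image_Int[OF U N(1)] open_chart_image_Int[OF V N(1)] N(2)
    by (auto simp: Int_absorb1)
  have "smooth_on (\<phi> ` (U \<inter> N)) (\<lambda>y. f (inv_into V \<psi> (\<psi> (inv_into U \<phi> y))))"
  proof (rule smooth_on_compose[OF finite_dimensional_model op _ f])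
    show "(\<lambda>y. \<psi> (inv_into U \<phi> y)) ` \<phi> ` (U \<inter> N) \<subseteq> \<psi> ` N"
      using inv_chart[OF U] by auto
    show "smooth_on (\<phi> ` (U \<inter> N)) (\<lambda>y. \<psi> (inv_into U \<phi> y))"
      by (rule smooth_on_subset[OF smooth_on_transition[OF V U]]) (use N(2) in auto)
  qed
  then show "smooth_on (\<phi> ` (U \<inter> N)) (\<lambda>y. f (inv_into U \<phi> y))"
    by (rule smooth_on_cong[OF op(1), rotated]) (use N(2) inv_chart[OF U] inv_chart[OF V] in auto)
qed

lemma smooth_map_on_chart_rep:
  "smooth_map_on M W f \<Longrightarrow> (U, \<phi>) \<in> M \<Longrightarrow> smooth_on (\<phi> ` (U \<inter> W)) (\<lambda>y. f (inv_into U \<phi> y))"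
  unfolding smooth_map_on_def by blast

lemma smooth_map_on_chart: "(U, \<phi>) \<in> M \<Longrightarrow> smooth_map_on M U \<phi>"
  unfolding smooth_map_on_def using smooth_on_transition[of U \<phi>] by (auto simp: Int_commute[of _ U])

lemma smooth_map_on_const: "smooth_map_on M W (\<lambda>x. c)"
  by (auto simp: smooth_map_on_def smooth_on_const)

lemma smooth_map_on_add:
  "open W \<Longrightarrow> smooth_map_on M W f \<Longrightarrow> smooth_map_on M W g \<Longrightarrow> smooth_map_on M W (\<lambda>x. f x + g x)"
  by (auto simp: smooth_map_on_def intro!: smooth_on_add open_chart_image_Int)

lemma smooth_map_on_sum:
  "open W \<Longrightarrow> (\<And>i. i \<in> I \<Longrightarrow> smooth_map_on M W (f i)) \<Longrightarrow> smooth_map_on M W (\<lambda>x. \<Sum>i\<in>I. f i x)"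
  unfolding smooth_map_on_def by (clarify, rule smooth_on_sum) (auto intro: open_chart_image_Int)

lemma smooth_map_on_bilinear:
  assumes "bounded_bilinear h" "open W" "smooth_map_on M W f" "smooth_map_on M W g"
  shows "smooth_map_on M W (\<lambda>x. h (f x) (g x))"
  unfolding smooth_map_on_def
proof (clarify)
  fix U \<phi> assume U: "(U, \<phi>) \<in> M"
  show "smooth_on (\<phi> ` (U \<inter> W)) (\<lambda>y. h (f (inv_into U \<phi> y)) (g (inv_into U \<phi> y)))"
    using assms U by (intro smooth_on_bilinear[OF _ assms(1)] open_chart_image_Int smooth_map_on_chart_rep)
qed

lemmas smooth_map_on_mult = smooth_map_on_bilinear[OF bounded_bilinear_mult]
lemmas smooth_map_on_scaleR = smooth_map_on_bilinear[OF bounded_bilinear_scaleR]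
lemmas smooth_map_on_inner = smooth_map_on_bilinear[OF bounded_bilinear_inner]

section \<open>Global smooth functions and cutoffs on the manifold\<close>

lemma smooth_functions_const: "(\<lambda>x. c) \<in> smooth_functions M"
  by (simp add: smooth_functions_def smooth_map_on_const)

lemma smooth_functions_add:
  "f \<in> smooth_functions M \<Longrightarrow> g \<in> smooth_functions M \<Longrightarrow> (\<lambda>x. f x + g x) \<in> smooth_functions M"
  by (simp add: smooth_functions_def smooth_map_on_add)

lemma smooth_functions_mult:
  "f \<in> smooth_functions M \<Longrightarrow> g \<in> smooth_functions M \<Longrightarrow> (\<lambda>x. f x * g x) \<in> smooth_functions M"
  by (simp add: smooth_functions_def smooth_map_on_mult)

text \<open>The product is smooth on \<open>W\<close>, and it is zero on the complement of
  \<open>K\<close>; because \<open>K\<close> is closed and lies in \<open>W\<close>, these are two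
  open sets covering the manifold. The values of \<open>g\<close> off \<open>W\<close> may be
  arbitrary.\<close>

lemma cutoff_extend:
  assumes "f \<in> smooth_functions M" "closed K" "K \<subseteq> W" "open W" "\<And>x. x \<notin> K \<Longrightarrow> f x = 0"
    and "smooth_map_on M W g"
  shows "smooth_map_on M UNIV (\<lambda>x. f x *\<^sub>R g x)"
proof (rule smooth_map_on_local)
  fix x
  show "\<exists>N. open N \<and> x \<in> N \<and> smooth_map_on M N (\<lambda>x. f x *\<^sub>R g x)"
  proof (cases "x \<in> W")
    case True
    have "smooth_map_on M W f"
      using assms(1) smooth_map_on_subset by (auto simp: smooth_functions_def)
    then show ?thesis using assms(4,6) True by (intro exI[of _ W]) (auto intro: smooth_map_on_scaleR)
  next
    case False
    have "open (- K)" using assms(2) by auto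
    then have "smooth_map_on M (- K) (\<lambda>x. f x *\<^sub>R g x)"
      by (rule smooth_map_on_cong[OF _ _ smooth_map_on_const[of _ 0]]) (use assms(5) in auto)
    then show ?thesis using \<open>open (- K)\<close> False assms(3) by blast
  qed
qed

text \<open>A cutoff of the model space is transported by a chart. The closed set \<open>K\<close>
  containing the support is kept in the statement because that is what extension by zero
  needs.\<close>

lemma cutoff_function_exists:
  assumes "open W" "x0 \<in> W"
  shows "\<exists>f N K. f \<in> smooth_functions M \<and> open N \<and> x0 \<in> N \<and> (\<forall>x\<in>N. f x = 1) \<and>
    closed K \<and> K \<subseteq> W \<and> (\<forall>x. x \<notin> K \<longrightarrow> f x = (0 :: real))"
proof -
  obtain U \<phi> where U: "(U, \<phi>) \<in> M" "x0 \<in> U" using chart_exists by blast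
  have "open (\<phi> ` (U \<inter> W))" "\<phi> x0 \<in> \<phi> ` (U \<inter> W)"
    using open_chart_image_Int[OF U(1) assms(1)] U assms by auto
  then obtain e where e: "e > 0" "cball (\<phi> x0) e \<subseteq> \<phi> ` (U \<inter> W)"
    using open_contains_cball by blast
  \<comment> \<open>Radius e/2 makes \<open>b\<close> vanish off the ball of radius e, hence off the
    closed ball that still lies in the image of the chart.\<close>
  obtain b :: "'e \<Rightarrow> real" where b: "smooth_on UNIV b" "\<And>x. x \<in> ball (\<phi> x0) (e/2) \<Longrightarrow> b x = 1"
    "\<And>x. x \<notin> ball (\<phi> x0) (2 * (e/2)) \<Longrightarrow> b x = 0"
    using smooth_cutoff_exists[of "e/2" "\<phi> x0"] e(1) by auto
  define f where "f = (\<lambda>x. if x \<in> U then b (\<phi> x) else 0)"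
  define K where "K = inv_into U \<phi> ` cball (\<phi> x0) e"
  define N where "N = U \<inter> \<phi> -` ball (\<phi> x0) (e/2)"
  have hom: "continuous_on U \<phi>" "continuous_on (\<phi> ` U) (inv_into U \<phi>)"
    using chart_homeomorphism[OF U(1)] by (auto simp: homeomorphism_def)
  \<comment> \<open>A closed subset of a chart domain need not be closed in the manifold;
    compactness in a Hausdorff space gives closedness.\<close>
  have "compact K"
    unfolding K_def
    by (intro compact_continuous_image compact_cball_finite_dimensional finite_dimensional_model
        continuous_on_subset[OF hom(2)]) (use e(2) in auto)
  then have K: "closed K" by (rule compact_imp_closed)
  have KW: "K \<subseteq> U \<inter> W"
    using e(2) inv_chart[OF U(1)] unfolding K_def by force
  have f0: "f x = 0" if "x \<notin> K" for x
  proof (cases "x \<in> U")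
    case True
    have "\<phi> x \<notin> cball (\<phi> x0) e"
    proof
      assume "\<phi> x \<in> cball (\<phi> x0) e"
      then have "inv_into U \<phi> (\<phi> x) \<in> K" unfolding K_def by (rule imageI)
      then show False using that inv_chart[OF U(1) True] by simp
    qed
    then have "b (\<phi> x) = 0" by (intro b(3)) auto
    then show ?thesis by (simp add: f_def)
  qed (simp add: f_def)
  have "open N"
    unfolding N_def by (intro continuous_open_preimage hom open_chart[OF U(1)]) auto
  moreover have "x0 \<in> N" using U e by (auto simp: N_def)
  moreover have "f x = 1" if "x \<in> N" for x
    using that b(2) by (auto simp: f_def N_def)
  moreover have "smooth_map_on M UNIV f"
  proof (rule smooth_map_on_local)
    fix x
    show "\<exists>N. open N \<and> x \<in> N \<and> smooth_map_on M N f"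
    proof (cases "x \<in> U")
      case True
      have "smooth_on (\<phi> ` U) b" using b(1) by (rule smooth_on_subset) simp
      then have "smooth_on (\<phi> ` U) (\<lambda>y. f (inv_into U \<phi> y))"
        by (rule smooth_on_cong[OF open_chart_image[OF U(1)], rotated])
          (use inv_chart[OF U(1)] in \<open>auto simp: f_def\<close>)
      then have "smooth_map_on M U f"
        by (rule smooth_map_onI_chart[OF U(1) open_chart[OF U(1)] subset_refl])
      then show ?thesis using True open_chart[OF U(1)] by blast
    next
      case False
      have "open (- K)" using K by auto
      then have "smooth_map_on M (- K) f"
        by (rule smooth_map_on_cong[OF _ _ smooth_map_on_const[of _ 0]]) (use f0 in auto)
      then show ?thesis using \<open>open (- K)\<close> False KW by blast
    qed
  qed
  ultimately show ?thesis
    using K KW f0 unfolding smooth_functions_def by blast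
qed

end


section \<open>Sections of vector bundles\<close>

lemma sum_fun_apply: "(\<Sum>i\<in>I. F i) x = (\<Sum>i\<in>I. F i x)"
  by (induction I rule: infinite_finite_induct) auto

locale vbundle = manifold M
  for M :: "('m::{t2_space, second_countable_topology}, 'e::real_inner) atlas" +
  fixes A :: "('m, 'v::real_vector, 'f::real_inner) vbundle"
  assumes vector_bundle: "vector_bundle M A"
begin

lemma finite_dimensional_fibre: "finite_dimensional TYPE('f)"
  using vector_bundle by (simp add: vector_bundle_def)

lemma subspace_fibre: "subspace (fibre A x)"
  using vector_bundle by (simp add: vector_bundle_def)

lemma triv_exists: "\<exists>U \<Psi>. (U, \<Psi>) \<in> trivs A \<and> x \<in> U"
proof -
  have "x \<in> (\<Union>(U, \<Psi>)\<in>trivs A. U)" using vector_bundle by (simp add: vector_bundle_def)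
  then show ?thesis by blast
qed

lemma open_triv: "(U, \<Psi>) \<in> trivs A \<Longrightarrow> open U"
  using vector_bundle by (auto simp: vector_bundle_def)

lemma
  assumes "(U, \<Psi>) \<in> trivs A" "x \<in> U"
  shows linear_triv: "linear (\<Psi> x)" and bij_triv: "bij_betw (\<Psi> x) UNIV (fibre A x)"
  using vector_bundle assms by (auto simp: vector_bundle_def)

lemma smooth_triv_transition:
  "(U, \<Psi>) \<in> trivs A \<Longrightarrow> (V, \<Theta>) \<in> trivs A \<Longrightarrow> smooth_map_on M (U \<inter> V) (\<lambda>x. inv (\<Theta> x) (\<Psi> x v))"
  using vector_bundle unfolding vector_bundle_def by fastforce

context
  fixes U \<Psi> x
  assumes U: "(U, \<Psi>) \<in> trivs A" "x \<in> U"
begin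

lemma triv_in_fibre: "\<Psi> x v \<in> fibre A x"
  using bij_triv[OF U] by (auto simp: bij_betw_def)

lemma inv_triv_triv: "inv (\<Psi> x) (\<Psi> x v) = v"
  using bij_triv[OF U] by (simp add: bij_betw_def)

lemma triv_inv_triv: "u \<in> fibre A x \<Longrightarrow> \<Psi> x (inv (\<Psi> x) u) = u"
  using bij_triv[OF U] by (auto simp: bij_betw_def f_inv_into_f)

lemma inv_triv_add:
  assumes "u \<in> fibre A x" "w \<in> fibre A x"
  shows "inv (\<Psi> x) (u + w) = inv (\<Psi> x) u + inv (\<Psi> x) w"
proof -
  have "u + w = \<Psi> x (inv (\<Psi> x) u + inv (\<Psi> x) w)"
    using assms by (simp add: linear_add[OF linear_triv[OF U]] triv_inv_triv)
  then show ?thesis by (simp add: inv_triv_triv)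
qed

lemma inv_triv_scaleR:
  assumes "u \<in> fibre A x"
  shows "inv (\<Psi> x) (c *\<^sub>R u) = c *\<^sub>R inv (\<Psi> x) u"
proof -
  have "c *\<^sub>R u = \<Psi> x (c *\<^sub>R inv (\<Psi> x) u)"
    using assms by (simp add: linear_scale[OF linear_triv[OF U]] triv_inv_triv)
  then show ?thesis by (simp add: inv_triv_triv)
qed

lemma inv_triv_0: "inv (\<Psi> x) 0 = 0"
  using inv_triv_scaleR[of 0 0] subspace_0[OF subspace_fibre] by simp

lemma inv_triv_sum:
  assumes "\<And>i. i \<in> I \<Longrightarrow> u i \<in> fibre A x"
  shows "inv (\<Psi> x) (\<Sum>i\<in>I. u i) = (\<Sum>i\<in>I. inv (\<Psi> x) (u i))"
  using assms
  by (induction I rule: infinite_finite_induct)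
    (auto simp: inv_triv_0 inv_triv_add subspace_sum[OF subspace_fibre])

lemma triv_expansion:
  assumes "u \<in> fibre A x"
  shows "u = (\<Sum>b\<in>onb. (inv (\<Psi> x) u \<bullet> b) *\<^sub>R \<Psi> x b)"
  using linear_onb_expansion[OF finite_dimensional_fibre linear_triv[OF U], of "inv (\<Psi> x) u"]
    triv_inv_triv[OF assms] by simp

end

section \<open>Smooth sections and their module structure over the smooth functions\<close>

lemma section_fibre: "X \<in> sections M A \<Longrightarrow> X x \<in> fibre A x"
  by (simp add: sections_def)

lemma smooth_section_coords:
  "X \<in> sections M A \<Longrightarrow> (U, \<Psi>) \<in> trivs A \<Longrightarrow> smooth_map_on M U (\<lambda>x. inv (\<Psi> x) (X x))"
  by (auto simp: sections_def)

text \<open>Near each point a single trivialization suffices: coordinates in another one are the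
  given coordinates multiplied by the smooth transition functions.\<close>

lemma sections_local:
  assumes fib: "\<And>x. X x \<in> fibre A x"
    and loc: "\<And>x. \<exists>U \<Psi> N. (U, \<Psi>) \<in> trivs A \<and> open N \<and> x \<in> N \<and> N \<subseteq> U \<and>
      smooth_map_on M N (\<lambda>x. inv (\<Psi> x) (X x))"
  shows "X \<in> sections M A"
proof -
  have "smooth_map_on M V (\<lambda>x. inv (\<Theta> x) (X x))" if V: "(V, \<Theta>) \<in> trivs A" for V \<Theta>
  proof (rule smooth_map_on_local)
    fix x assume x: "x \<in> V"
    obtain U \<Psi> N where U: "(U, \<Psi>) \<in> trivs A" "open N" "x \<in> N" "N \<subseteq> U"
      "smooth_map_on M N (\<lambda>x. inv (\<Psi> x) (X x))"
      using loc by blast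
    have op: "open (N \<inter> V)" using U(2) open_triv[OF V] by auto
    have "smooth_map_on M (N \<inter> V) (\<lambda>x. \<Sum>b\<in>onb. (inv (\<Psi> x) (X x) \<bullet> b) *\<^sub>R inv (\<Theta> x) (\<Psi> x b))"
      by (intro smooth_map_on_sum smooth_map_on_scaleR smooth_map_on_inner op smooth_map_on_const
          smooth_map_on_subset[OF U(5)] smooth_map_on_subset[OF smooth_triv_transition[OF U(1) V]])
        (use U(4) in auto)
    then have "smooth_map_on M (N \<inter> V) (\<lambda>x. inv (\<Theta> x) (X x))"
    proof (rule smooth_map_on_cong[OF op, rotated])
      fix y assume "y \<in> N \<inter> V"
      then have y: "y \<in> U" "y \<in> V" using U by auto
      have "inv (\<Theta> y) (X y) = inv (\<Theta> y) (\<Sum>b\<in>onb. (inv (\<Psi> y) (X y) \<bullet> b) *\<^sub>R \<Psi> y b)"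
        using triv_expansion[OF U(1) y(1) fib] by simp
      also have "\<dots> = (\<Sum>b\<in>onb. (inv (\<Psi> y) (X y) \<bullet> b) *\<^sub>R inv (\<Theta> y) (\<Psi> y b))"
        by (simp add: inv_triv_sum[OF V y(2)] inv_triv_scaleR[OF V y(2)] triv_in_fibre[OF U(1) y(1)]
            subspace_scale[OF subspace_fibre])
      finally show "(\<Sum>b\<in>onb. (inv (\<Psi> y) (X y) \<bullet> b) *\<^sub>R inv (\<Theta> y) (\<Psi> y b)) = inv (\<Theta> y) (X y)" ..
    qed
    then show "\<exists>N. open N \<and> x \<in> N \<and> smooth_map_on M N (\<lambda>x. inv (\<Theta> x) (X x))"
      using op x U(3) by blast
  qed
  then show ?thesis using fib by (auto simp: sections_def)
qed

lemma sectionsI: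
  assumes "\<And>x. X x \<in> fibre A x"
    and "\<And>U \<Psi>. (U, \<Psi>) \<in> trivs A \<Longrightarrow> smooth_map_on M U (\<lambda>x. inv (\<Psi> x) (X x))"
  shows "X \<in> sections M A"
  using assms by (auto simp: sections_def)

lemma sections_0: "0 \<in> sections M A"
proof (rule sectionsI)
  fix U \<Psi> assume U: "(U, \<Psi>) \<in> trivs A"
  show "smooth_map_on M U (\<lambda>x. inv (\<Psi> x) (0 x))"
    by (rule smooth_map_on_cong[OF open_triv[OF U] _ smooth_map_on_const[of _ 0]])
      (simp add: inv_triv_0[OF U])
qed (simp add: subspace_0[OF subspace_fibre])

lemma sections_add:
  assumes "X \<in> sections M A" "Y \<in> sections M A"
  shows "X + Y \<in> sections M A"
proof (rule sectionsI)
  fix U \<Psi> assume U: "(U, \<Psi>) \<in> trivs A"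
  show "smooth_map_on M U (\<lambda>x. inv (\<Psi> x) ((X + Y) x))"
    by (rule smooth_map_on_cong[OF open_triv[OF U] _ smooth_map_on_add[OF open_triv[OF U]
            smooth_section_coords[OF assms(1) U] smooth_section_coords[OF assms(2) U]]])
      (simp add: inv_triv_add[OF U] section_fibre assms)
qed (simp add: subspace_add[OF subspace_fibre] section_fibre assms)

lemma sections_smooth_scaleR:
  assumes "f \<in> smooth_functions M" "X \<in> sections M A"
  shows "(\<lambda>x. f x *\<^sub>R X x) \<in> sections M A"
proof (rule sectionsI)
  fix U \<Psi> assume U: "(U, \<Psi>) \<in> trivs A"
  have f: "smooth_map_on M U f"
    using assms(1) smooth_map_on_subset by (auto simp: smooth_functions_def)
  show "smooth_map_on M U (\<lambda>x. inv (\<Psi> x) (f x *\<^sub>R X x))"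
    by (rule smooth_map_on_cong[OF open_triv[OF U] _ smooth_map_on_scaleR[OF open_triv[OF U]
            f smooth_section_coords[OF assms(2) U]]])
      (simp add: inv_triv_scaleR[OF U] section_fibre assms)
qed (simp add: subspace_scale[OF subspace_fibre] section_fibre assms)

lemma sections_scaleR:
  assumes "X \<in> sections M A"
  shows "c *\<^sub>R X \<in> sections M A"
  using sections_smooth_scaleR[OF smooth_functions_const assms, of c] by (simp add: scaleR_fun_def)

lemma sections_uminus: "X \<in> sections M A \<Longrightarrow> - X \<in> sections M A"
  using sections_scaleR[of X "-1"] by simp

lemma sections_diff: "X \<in> sections M A \<Longrightarrow> Y \<in> sections M A \<Longrightarrow> X - Y \<in> sections M A"
  using sections_add[of X "- Y"] sections_uminus by simp

lemma sections_sum: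
  "(\<And>i. i \<in> I \<Longrightarrow> X i \<in> sections M A) \<Longrightarrow> (\<Sum>i\<in>I. X i) \<in> sections M A"
  by (induction I rule: infinite_finite_induct) (auto simp: sections_0 sections_add)

text \<open>The same cutoff serves both for frame fields and for coefficient functions, so a local
  expansion of a section, multiplied by the square of \<open>f\<close>, becomes a combination of
  global sections with global coefficients.\<close>

lemma local_frame:
  assumes U: "(U, \<Psi>) \<in> trivs A" "x0 \<in> U"
  shows "\<exists>f N. f \<in> smooth_functions M \<and> open N \<and> x0 \<in> N \<and> N \<subseteq> U \<and> (\<forall>x\<in>N. f x = 1) \<and>
    (\<forall>x. x \<notin> U \<longrightarrow> f x = 0) \<and> (\<forall>v. (\<lambda>x. f x *\<^sub>R \<Psi> x v) \<in> sections M A) \<and>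
    (\<forall>h. smooth_map_on M U h \<longrightarrow> (\<lambda>x. f x * h x) \<in> smooth_functions M)"
proof -
  obtain f N K where f: "f \<in> smooth_functions M" "open N" "x0 \<in> N" "\<And>x. x \<in> N \<Longrightarrow> f x = 1"
    and K: "closed K" "K \<subseteq> U" "\<And>x. x \<notin> K \<Longrightarrow> f x = 0"
    using cutoff_function_exists[OF open_triv[OF U(1)] U(2)] by blast
  show ?thesis
  proof (intro exI[of _ f] exI[of _ N] conjI allI impI ballI f(1,2,3))
    show "N \<subseteq> U" using f(4) K(2,3) by fastforce
    show "f x = 0" if "x \<notin> U" for x using that K by blast
    show "(\<lambda>x. f x * h x) \<in> smooth_functions M" if "smooth_map_on M U h" for h
      using cutoff_extend[OF f(1) K(1,2) open_triv[OF U(1)] K(3) that]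
      by (simp add: smooth_functions_def)
    show "(\<lambda>x. f x *\<^sub>R \<Psi> x v) \<in> sections M A" for v
    proof (rule sections_local)
      fix x
      show "f x *\<^sub>R \<Psi> x v \<in> fibre A x"
        using subspace_0[OF subspace_fibre] subspace_scale[OF subspace_fibre] triv_in_fibre[OF U(1)]
          K(3)[of x] K(2)
        by (cases "x \<in> K") auto
      show "\<exists>V \<Theta> N. (V, \<Theta>) \<in> trivs A \<and> open N \<and> x \<in> N \<and> N \<subseteq> V \<and>
          smooth_map_on M N (\<lambda>x. inv (\<Theta> x) (f x *\<^sub>R \<Psi> x v))"
      proof (cases "x \<in> U")
        case True
        have "smooth_map_on M U f"
          using f(1) smooth_map_on_subset by (auto simp: smooth_functions_def)
        then have "smooth_map_on M U (\<lambda>x. f x *\<^sub>R v)"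
          by (intro smooth_map_on_scaleR open_triv[OF U(1)] smooth_map_on_const)
        then have "smooth_map_on M U (\<lambda>x. inv (\<Psi> x) (f x *\<^sub>R \<Psi> x v))"
          by (rule smooth_map_on_cong[OF open_triv[OF U(1)], rotated])
            (simp add: inv_triv_scaleR[OF U(1)] inv_triv_triv[OF U(1)] triv_in_fibre[OF U(1)])
        then show ?thesis using True U(1) open_triv[OF U(1)] by blast
      next
        case False
        obtain V \<Theta> where V: "(V, \<Theta>) \<in> trivs A" "x \<in> V" using triv_exists by blast
        have op: "open (V \<inter> - K)" using open_triv[OF V(1)] K(1) by auto
        have "smooth_map_on M (V \<inter> - K) (\<lambda>x. inv (\<Theta> x) (f x *\<^sub>R \<Psi> x v))"
          by (rule smooth_map_on_cong[OF op _ smooth_map_on_const[of _ 0]])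
            (simp add: K(3) inv_triv_0[OF V(1)])
        then show ?thesis
          using V op False K(2) by (intro exI[of _ V] exI[of _ \<Theta>] exI[of _ "V \<inter> - K"]) auto
      qed
    qed
  qed (use f(4) in auto)
qed

lemma section_through:
  assumes "u \<in> fibre A x"
  obtains X where "X \<in> sections M A" "X x = u"
proof -
  obtain U \<Psi> where U: "(U, \<Psi>) \<in> trivs A" "x \<in> U" using triv_exists by blast
  obtain f N where f: "f \<in> smooth_functions M" "open N" "x \<in> N" "N \<subseteq> U" "\<And>x. x \<in> N \<Longrightarrow> f x = 1"
    "\<And>x. x \<notin> U \<Longrightarrow> f x = 0" "\<And>v. (\<lambda>x. f x *\<^sub>R \<Psi> x v) \<in> sections M A"
    "\<And>h. smooth_map_on M U h \<Longrightarrow> (\<lambda>x. f x * h x) \<in> smooth_functions M"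
    using local_frame[OF U] by blast
  show thesis
    by (rule that[OF f(7)[of "inv (\<Psi> x) u"]]) (simp add: f(3,5) triv_inv_triv[OF U assms])
qed

text \<open>
  Near \<open>x0\<close> a section is a combination of a frame; multiplying by the square of a cutoff function
  turns this into an identity of global sections, to which a linear map over the smooth functions
  may be applied.
\<close>

lemma tensorial_vanishing:
  fixes l :: "('m \<Rightarrow> 'v) \<Rightarrow> 'z::real_vector"
  assumes add: "\<And>X Y. X \<in> sections M A \<Longrightarrow> Y \<in> sections M A \<Longrightarrow> l (X + Y) = l X + l Y"
    and scale: "\<And>f X. f \<in> smooth_functions M \<Longrightarrow> X \<in> sections M A \<Longrightarrow>
      l (\<lambda>x. f x *\<^sub>R X x) = f x0 *\<^sub>R l X"
    and X: "X \<in> sections M A" "X x0 = 0"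
  shows "l X = 0"
proof -
  obtain U \<Psi> where U: "(U, \<Psi>) \<in> trivs A" "x0 \<in> U" using triv_exists by blast
  obtain f N where f: "f \<in> smooth_functions M" "open N" "x0 \<in> N" "N \<subseteq> U" "\<And>x. x \<in> N \<Longrightarrow> f x = 1"
    "\<And>x. x \<notin> U \<Longrightarrow> f x = 0" "\<And>v. (\<lambda>x. f x *\<^sub>R \<Psi> x v) \<in> sections M A"
    "\<And>h. smooth_map_on M U h \<Longrightarrow> (\<lambda>x. f x * h x) \<in> smooth_functions M"
    using local_frame[OF U] by blast
  have l0: "l 0 = 0" using add[OF sections_0 sections_0] by simp
  have lsum: "l (\<Sum>b\<in>I. E b) = (\<Sum>b\<in>I. l (E b))" if "\<And>b. E b \<in> sections M A" for E and I :: "'f set"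
    by (induction I rule: infinite_finite_induct)
      (auto simp: l0 add that sections_sum simp del: plus_fun_apply zero_fun_apply)
  let ?c = "\<lambda>b x. f x * (inv (\<Psi> x) (X x) \<bullet> b)"
  let ?E = "\<lambda>b x. f x *\<^sub>R \<Psi> x b"
  have c: "?c b \<in> smooth_functions M" for b
    by (intro f(8) smooth_map_on_inner open_triv[OF U(1)] smooth_section_coords[OF X(1) U(1)]
        smooth_map_on_const)
  have "(\<lambda>x. (f x * f x) *\<^sub>R X x) = (\<Sum>b\<in>onb. (\<lambda>x. ?c b x *\<^sub>R ?E b x))"
  proof
    fix x
    show "(f x * f x) *\<^sub>R X x = (\<Sum>b\<in>onb. (\<lambda>x. ?c b x *\<^sub>R ?E b x)) x"
    proof (cases "x \<in> U")
      case True
      have "(f x * f x) *\<^sub>R X x =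
          (f x * f x) *\<^sub>R (\<Sum>b\<in>onb. (inv (\<Psi> x) (X x) \<bullet> b) *\<^sub>R \<Psi> x b)"
        using triv_expansion[OF U(1) True section_fibre[OF X(1)]] by simp
      then show ?thesis by (simp add: sum_fun_apply scaleR_sum_right mult_ac)
    qed (simp add: f(6) sum_fun_apply)
  qed
  then have "l (\<lambda>x. (f x * f x) *\<^sub>R X x) = (\<Sum>b\<in>onb. l (\<lambda>x. ?c b x *\<^sub>R ?E b x))"
    using lsum[of "\<lambda>b x. ?c b x *\<^sub>R ?E b x"] sections_smooth_scaleR[OF c f(7)] by simp
  also have "\<dots> = (\<Sum>b\<in>onb. ?c b x0 *\<^sub>R l (?E b))"
    by (intro sum.cong scale c f(7) refl)
  also have "\<dots> = 0" by (simp add: X(2) inv_triv_0[OF U])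
  finally show ?thesis
    using scale[OF smooth_functions_mult[OF f(1) f(1)] X(1)] f(3,5) by simp
qed

end


section \<open>The dual bundle\<close>

definition dual_triv ::
    "('m, 'v::real_vector, 'f::real_inner) vbundle \<Rightarrow> ('m \<Rightarrow> 'f \<Rightarrow> 'v) \<Rightarrow> 'm \<Rightarrow> 'f \<Rightarrow> 'v \<Rightarrow> real"
  where "dual_triv A \<Psi> = (\<lambda>x w u. if u \<in> fibre A x then w \<bullet> inv (\<Psi> x) u else 0)"

lemma trivs_dual_bundle: "trivs (dual_bundle A) = {(U, dual_triv A \<Psi>) | U \<Psi>. (U, \<Psi>) \<in> trivs A}"
  by (simp add: dual_bundle_def dual_triv_def)

lemma dual_trivI: "(U, \<Psi>) \<in> trivs A \<Longrightarrow> (U, dual_triv A \<Psi>) \<in> trivs (dual_bundle A)"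
  by (auto simp: trivs_dual_bundle)

lemma dual_fibre_iff: "\<beta> \<in> fibre (dual_bundle A) x \<longleftrightarrow>
    (\<forall>u\<in>fibre A x. \<forall>v\<in>fibre A x. \<beta> (u + v) = \<beta> u + \<beta> v) \<and>
    (\<forall>c. \<forall>u\<in>fibre A x. \<beta> (c *\<^sub>R u) = c * \<beta> u) \<and>
    (\<forall>u. u \<notin> fibre A x \<longrightarrow> \<beta> u = 0)"
  by (simp add: dual_bundle_def)

context vbundle
begin

lemma
  assumes "\<beta> \<in> fibre (dual_bundle A) x"
  shows dual_fibre_add: "u \<in> fibre A x \<Longrightarrow> v \<in> fibre A x \<Longrightarrow> \<beta> (u + v) = \<beta> u + \<beta> v"
    and dual_fibre_scaleR: "u \<in> fibre A x \<Longrightarrow> \<beta> (c *\<^sub>R u) = c * \<beta> u"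
    and dual_fibre_outside: "u \<notin> fibre A x \<Longrightarrow> \<beta> u = 0"
  using assms by (auto simp: dual_fibre_iff)

lemma dual_fibre_zero: "\<beta> \<in> fibre (dual_bundle A) x \<Longrightarrow> \<beta> 0 = 0"
  using dual_fibre_scaleR[of \<beta> x 0 0] subspace_0[OF subspace_fibre] by simp

lemma dual_fibre_sum:
  assumes "\<beta> \<in> fibre (dual_bundle A) x" "\<And>i. i \<in> I \<Longrightarrow> u i \<in> fibre A x"
  shows "\<beta> (\<Sum>i\<in>I. u i) = (\<Sum>i\<in>I. \<beta> (u i))"
  using assms(2)
  by (induction I rule: infinite_finite_induct)
    (auto simp: dual_fibre_zero[OF assms(1)] dual_fibre_add[OF assms(1)] subspace_sum[OF subspace_fibre])

lemma subspace_dual_fibre: "subspace (fibre (dual_bundle A) x)"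
  unfolding subspace_def
proof (intro conjI ballI allI)
  fix \<beta> \<gamma> c assume \<beta>: "\<beta> \<in> fibre (dual_bundle A) x"
  show "c *\<^sub>R \<beta> \<in> fibre (dual_bundle A) x"
    using \<beta> unfolding dual_fibre_iff by (simp add: scaleR_fun_def algebra_simps)
  assume \<gamma>: "\<gamma> \<in> fibre (dual_bundle A) x"
  show "\<beta> + \<gamma> \<in> fibre (dual_bundle A) x"
    using \<beta> \<gamma> unfolding dual_fibre_iff by (simp add: algebra_simps)
qed (simp add: dual_fibre_iff)

context
  fixes U \<Psi> x
  assumes U: "(U, \<Psi>) \<in> trivs A" "x \<in> U"
begin

lemma dual_triv_triv: "dual_triv A \<Psi> x w (\<Psi> x v) = w \<bullet> v"
  by (simp add: dual_triv_def triv_in_fibre[OF U] inv_triv_triv[OF U])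

lemma dual_triv_in_fibre: "dual_triv A \<Psi> x w \<in> fibre (dual_bundle A) x"
  by (auto simp: dual_fibre_iff dual_triv_def inv_triv_add[OF U] inv_triv_scaleR[OF U]
      subspace_add[OF subspace_fibre] subspace_scale[OF subspace_fibre] inner_add_right)

lemma dual_expansion:
  assumes \<beta>: "\<beta> \<in> fibre (dual_bundle A) x"
  shows "\<beta> = dual_triv A \<Psi> x (\<Sum>b\<in>onb. \<beta> (\<Psi> x b) *\<^sub>R b)"
proof
  fix u
  show "\<beta> u = dual_triv A \<Psi> x (\<Sum>b\<in>onb. \<beta> (\<Psi> x b) *\<^sub>R b) u"
  proof (cases "u \<in> fibre A x")
    case True
    have "\<beta> u = \<beta> (\<Sum>b\<in>onb. (inv (\<Psi> x) u \<bullet> b) *\<^sub>R \<Psi> x b)"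
      using triv_expansion[OF U True] by simp
    also have "\<dots> = (\<Sum>b\<in>onb. (inv (\<Psi> x) u \<bullet> b) * \<beta> (\<Psi> x b))"
      by (simp add: dual_fibre_sum[OF \<beta>] dual_fibre_scaleR[OF \<beta>] triv_in_fibre[OF U]
          subspace_scale[OF subspace_fibre])
    also have "\<dots> = (\<Sum>b\<in>onb. \<beta> (\<Psi> x b) *\<^sub>R b) \<bullet> inv (\<Psi> x) u"
      unfolding inner_sum_left by (simp add: inner_commute[of "inv (\<Psi> x) u"] mult.commute)
    finally show ?thesis
      using True by (simp add: dual_triv_def)
  qed (simp add: dual_triv_def dual_fibre_outside[OF \<beta>])
qed

lemma inj_dual_triv: "inj (dual_triv A \<Psi> x)"
proof
  fix w w' assume "dual_triv A \<Psi> x w = dual_triv A \<Psi> x w'"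
  then have "w \<bullet> v = w' \<bullet> v" for v
    by (metis dual_triv_triv)
  then show "w = w'" by (intro onb_eqI[OF finite_dimensional_fibre])
qed

lemma bij_dual_triv: "bij_betw (dual_triv A \<Psi> x) UNIV (fibre (dual_bundle A) x)"
  unfolding bij_betw_def using inj_dual_triv dual_expansion dual_triv_in_fibre by blast

lemma linear_dual_triv: "linear (dual_triv A \<Psi> x)"
  by (rule linearI) (auto simp: dual_triv_def scaleR_fun_def inner_add_left)

lemma inv_dual_triv:
  assumes "\<beta> \<in> fibre (dual_bundle A) x"
  shows "inv (dual_triv A \<Psi> x) \<beta> = (\<Sum>b\<in>onb. \<beta> (\<Psi> x b) *\<^sub>R b)"
  using inv_f_f[OF inj_dual_triv, of "\<Sum>b\<in>onb. \<beta> (\<Psi> x b) *\<^sub>R b"] dual_expansion[OF assms] by simp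

end

text \<open>Dual coordinates of a covector are its values on the frame, so smoothness of a covector
  field is tested on frame fields.\<close>

lemma smooth_inv_dual_triv:
  assumes U: "(U, \<Psi>) \<in> trivs A" and N: "open N" "N \<subseteq> U"
    and \<gamma>: "\<And>x. x \<in> N \<Longrightarrow> \<gamma> x \<in> fibre (dual_bundle A) x"
    and sm: "\<And>b. smooth_map_on M N (\<lambda>x. \<gamma> x (\<Psi> x b))"
  shows "smooth_map_on M N (\<lambda>x. inv (dual_triv A \<Psi> x) (\<gamma> x))"
proof (rule smooth_map_on_cong[OF N(1)])
  show "smooth_map_on M N (\<lambda>x. \<Sum>b\<in>onb. \<gamma> x (\<Psi> x b) *\<^sub>R b)"
    by (intro smooth_map_on_sum smooth_map_on_scaleR N sm smooth_map_on_const)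
  show "(\<Sum>b\<in>onb. \<gamma> x (\<Psi> x b) *\<^sub>R b) = inv (dual_triv A \<Psi> x) (\<gamma> x)" if "x \<in> N" for x
    using inv_dual_triv[OF U] \<gamma> N that by (auto simp: subset_iff)
qed

lemma vector_bundle_dual: "vector_bundle M (dual_bundle A)"
proof -
  have "smooth_map_on M (U \<inter> V) (\<lambda>x. inv (dual_triv A \<Theta> x) (dual_triv A \<Psi> x v))"
    if U: "(U, \<Psi>) \<in> trivs A" and V: "(V, \<Theta>) \<in> trivs A" for U \<Psi> V \<Theta> v
  proof (rule smooth_inv_dual_triv[OF V])
    show op: "open (U \<inter> V)" using open_triv U V by blast
    show "smooth_map_on M (U \<inter> V) (\<lambda>x. dual_triv A \<Psi> x v (\<Theta> x b))" for b
    proof (rule smooth_map_on_cong[OF op])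
      show "smooth_map_on M (U \<inter> V) (\<lambda>x. v \<bullet> inv (\<Psi> x) (\<Theta> x b))"
        by (intro smooth_map_on_inner op smooth_map_on_const
            smooth_map_on_subset[OF smooth_triv_transition[OF V U]]) auto
      show "v \<bullet> inv (\<Psi> x) (\<Theta> x b) = dual_triv A \<Psi> x v (\<Theta> x b)" if "x \<in> U \<inter> V" for x
        using triv_in_fibre[OF V] that by (simp add: dual_triv_def)
    qed
  qed (use dual_triv_in_fibre[OF U] in auto)
  moreover have "(\<Union>(U, \<Psi>)\<in>trivs (dual_bundle A). U) = UNIV"
  proof (intro set_eqI iffI UNIV_I)
    fix x
    obtain U \<Psi> where U: "(U, \<Psi>) \<in> trivs A" "x \<in> U" using triv_exists by blast
    show "x \<in> (\<Union>(U, \<Psi>)\<in>trivs (dual_bundle A). U)"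
      by (rule UN_I[OF dual_trivI[OF U(1)]]) (simp add: U(2))
  qed
  ultimately show ?thesis
    unfolding vector_bundle_def
    by (auto simp: trivs_dual_bundle finite_dimensional_fibre subspace_dual_fibre open_triv
        linear_dual_triv bij_dual_triv)
qed

lemma vbundle_dual: "vbundle M (dual_bundle A)"
  by unfold_locales (rule vector_bundle_dual)

lemma dual_section_fibre: "\<beta> \<in> dual_sections M A \<Longrightarrow> \<beta> x \<in> fibre (dual_bundle A) x"
  by (simp add: sections_def)

lemma smooth_dual_section_triv:
  assumes "\<beta> \<in> dual_sections M A" "(U, \<Psi>) \<in> trivs A"
  shows "smooth_map_on M U (\<lambda>x. \<beta> x (\<Psi> x v))"
proof -
  interpret dual: vbundle M "dual_bundle A" by (rule vbundle_dual)
  have op: "open U" using assms open_triv by blast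
  have "smooth_map_on M U (\<lambda>x. inv (dual_triv A \<Psi> x) (\<beta> x) \<bullet> v)"
    by (intro smooth_map_on_inner op smooth_map_on_const
        dual.smooth_section_coords[OF assms(1) dual_trivI[OF assms(2)]])
  then show ?thesis
  proof (rule smooth_map_on_cong[OF op, rotated])
    fix x assume x: "x \<in> U"
    have "\<beta> x = dual_triv A \<Psi> x (inv (dual_triv A \<Psi> x) (\<beta> x))"
      using dual_expansion[OF assms(2) x dual_section_fibre[OF assms(1)]]
        inv_dual_triv[OF assms(2) x dual_section_fibre[OF assms(1)]] by simp
    then show "inv (dual_triv A \<Psi> x) (\<beta> x) \<bullet> v = \<beta> x (\<Psi> x v)"
      using dual_triv_triv[OF assms(2) x] by metis
  qed
qed

section \<open>The pairing of sections with dual sections\<close>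

lemma pairing_smooth:
  assumes \<beta>: "\<beta> \<in> dual_sections M A" and X: "X \<in> sections M A"
  shows "pairing \<beta> X \<in> smooth_functions M"
  unfolding smooth_functions_def mem_Collect_eq
proof (rule smooth_map_on_local)
  fix x
  obtain U \<Psi> where U: "(U, \<Psi>) \<in> trivs A" "x \<in> U" using triv_exists by blast
  note op = open_triv[OF U(1)]
  have "smooth_map_on M U (\<lambda>x. \<Sum>b\<in>onb. (inv (\<Psi> x) (X x) \<bullet> b) * \<beta> x (\<Psi> x b))"
    by (intro smooth_map_on_sum smooth_map_on_mult smooth_map_on_inner op smooth_map_on_const
        smooth_section_coords[OF X U(1)] smooth_dual_section_triv[OF \<beta> U(1)])
  then have "smooth_map_on M U (pairing \<beta> X)"
  proof (rule smooth_map_on_cong[OF op, rotated])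
    fix y assume y: "y \<in> U"
    note \<beta>y = dual_section_fibre[OF \<beta>, of y]
    have "pairing \<beta> X y = \<beta> y (\<Sum>b\<in>onb. (inv (\<Psi> y) (X y) \<bullet> b) *\<^sub>R \<Psi> y b)"
      using triv_expansion[OF U(1) y section_fibre[OF X]] by (simp add: pairing_def)
    then show "(\<Sum>b\<in>onb. (inv (\<Psi> y) (X y) \<bullet> b) * \<beta> y (\<Psi> y b)) = pairing \<beta> X y"
      by (simp add: dual_fibre_sum[OF \<beta>y] dual_fibre_scaleR[OF \<beta>y] triv_in_fibre[OF U(1) y]
          subspace_scale[OF subspace_fibre])
  qed
  then show "\<exists>N. open N \<and> x \<in> N \<and> smooth_map_on M N (pairing \<beta> X)" using U op by blast
qed

lemma dual_fibre_separates:
  assumes "u \<in> fibre A x" "v \<in> fibre A x" "\<And>\<beta>. \<beta> \<in> fibre (dual_bundle A) x \<Longrightarrow> \<beta> u = \<beta> v"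
  shows "u = v"
proof -
  obtain U \<Psi> where U: "(U, \<Psi>) \<in> trivs A" "x \<in> U" using triv_exists by blast
  have "inv (\<Psi> x) u = inv (\<Psi> x) v"
  proof (rule onb_eqI[OF finite_dimensional_fibre])
    fix b :: 'f
    show "inv (\<Psi> x) u \<bullet> b = inv (\<Psi> x) v \<bullet> b"
      using assms(3)[OF dual_triv_in_fibre[OF U], of b] assms(1,2)
      by (simp add: dual_triv_def inner_commute)
  qed
  then show ?thesis using triv_inv_triv[OF U] assms(1,2) by metis
qed

text \<open>Every covector at a point is the value of a global dual section, so global pairings
  separate sections fibre by fibre.\<close>

lemma section_eqI:
  assumes X: "X \<in> sections M A" "Y \<in> sections M A"
    and eq: "\<And>\<beta>. \<beta> \<in> dual_sections M A \<Longrightarrow> pairing \<beta> X = pairing \<beta> Y"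
  shows "X = Y"
proof
  fix x
  interpret dual: vbundle M "dual_bundle A" by (rule vbundle_dual)
  show "X x = Y x"
  proof (rule dual_fibre_separates)
    fix \<beta> assume "\<beta> \<in> fibre (dual_bundle A) x"
    then obtain \<gamma> where "\<gamma> \<in> dual_sections M A" "\<gamma> x = \<beta>" by (rule dual.section_through)
    then show "\<beta> (X x) = \<beta> (Y x)" using fun_cong[OF eq, of \<gamma> x] by (simp add: pairing_def)
  qed (use X section_fibre in auto)
qed

lemma dual_section_eqI:
  assumes \<beta>: "\<beta> \<in> dual_sections M A" "\<gamma> \<in> dual_sections M A"
    and eq: "\<And>X. X \<in> sections M A \<Longrightarrow> pairing \<beta> X = pairing \<gamma> X"
  shows "\<beta> = \<gamma>"
proof (intro ext)
  fix x u
  show "\<beta> x u = \<gamma> x u"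
  proof (cases "u \<in> fibre A x")
    case True
    then obtain X where "X \<in> sections M A" "X x = u" by (rule section_through)
    then show ?thesis using fun_cong[OF eq, of X x] by (simp add: pairing_def)
  next
    case False
    \<comment> \<open>Off the fibre both functionals are zero by the convention of
      \<open>dual_bundle\<close>; without it equality would hold on the fibres only.\<close>
    then show ?thesis using dual_fibre_outside[OF dual_section_fibre] \<beta> by metis
  qed
qed

text \<open>Linearity over the smooth functions makes the value of \<open>L X\<close> at
  \<open>x\<close> depend on \<open>X x\<close> alone, by \<open>tensorial_vanishing\<close>, so
  \<open>L\<close> descends to a functional on each fibre. This is the source of existence for both
  \<open>dual_product\<close> and \<open>tensor_product\<close>.\<close>

lemma dual_representation:
  assumes smooth: "\<And>X. X \<in> sections M A \<Longrightarrow> L X \<in> smooth_functions M"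
    and add: "\<And>X Y x. X \<in> sections M A \<Longrightarrow> Y \<in> sections M A \<Longrightarrow> L (X + Y) x = L X x + L Y x"
    and scale: "\<And>f X x. f \<in> smooth_functions M \<Longrightarrow> X \<in> sections M A \<Longrightarrow>
      L (\<lambda>x. f x *\<^sub>R X x) x = f x * L X x"
  shows "\<exists>!\<gamma>. \<gamma> \<in> dual_sections M A \<and> (\<forall>X\<in>sections M A. pairing \<gamma> X = L X)"
proof -
  interpret dual: vbundle M "dual_bundle A" by (rule vbundle_dual)
  have local: "L X x = L Y x" if "X \<in> sections M A" "Y \<in> sections M A" "X x = Y x" for X Y x
  proof -
    have Z: "X - Y \<in> sections M A" using that sections_diff by blast
    have "L (X - Y) x = 0"
      by (rule tensorial_vanishing[of "\<lambda>X. L X x" x]) (use add scale Z that(3) in auto)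
    then show ?thesis using add[OF Z that(2), of x] by simp
  qed
  \<comment> \<open>Any section through \<open>u\<close> gives the same number, by
    \<open>local\<close>; sections through \<open>u\<close> exist by
    \<open>section_through\<close>.\<close>
  define \<gamma> where "\<gamma> = (\<lambda>x u. if u \<in> fibre A x then L (SOME X. X \<in> sections M A \<and> X x = u) x else 0)"
  have \<gamma>: "\<gamma> x (X x) = L X x" if X: "X \<in> sections M A" for X x
  proof -
    have "(SOME Y. Y \<in> sections M A \<and> Y x = X x) \<in> sections M A \<and>
        (SOME Y. Y \<in> sections M A \<and> Y x = X x) x = X x"
      by (rule someI[of _ X]) (simp add: X)
    then have "L (SOME Y. Y \<in> sections M A \<and> Y x = X x) x = L X x"
      using X by (intro local) auto
    then show ?thesis using section_fibre[OF X] by (simp add: \<gamma>_def)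
  qed
  have \<gamma>_fibre: "\<gamma> x \<in> fibre (dual_bundle A) x" for x
    unfolding dual_fibre_iff
  proof (intro conjI ballI allI impI)
    fix u v assume "u \<in> fibre A x" "v \<in> fibre A x"
    then obtain X Y where X: "X \<in> sections M A" "X x = u" and Y: "Y \<in> sections M A" "Y x = v"
      by (meson section_through)
    then show "\<gamma> x (u + v) = \<gamma> x u + \<gamma> x v"
      using \<gamma>[OF sections_add[OF X(1) Y(1)], of x] \<gamma>[OF X(1), of x] \<gamma>[OF Y(1), of x] add[OF X(1) Y(1)]
      by simp
  next
    fix c u assume "u \<in> fibre A x"
    then obtain X where X: "X \<in> sections M A" "X x = u"
      by (meson section_through)
    then show "\<gamma> x (c *\<^sub>R u) = c * \<gamma> x u"
      using \<gamma>[OF sections_smooth_scaleR[OF smooth_functions_const[of c] X(1)], of x] \<gamma>[OF X(1), of x]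
        scale[OF smooth_functions_const[of c] X(1), of x]
      by simp
  qed (simp add: \<gamma>_def)
  have "\<gamma> \<in> dual_sections M A"
  proof (rule dual.sections_local[OF \<gamma>_fibre])
    fix x
    obtain U \<Psi> where U: "(U, \<Psi>) \<in> trivs A" "x \<in> U" using triv_exists by blast
    obtain f N where f: "f \<in> smooth_functions M" "open N" "x \<in> N" "N \<subseteq> U" "\<And>x. x \<in> N \<Longrightarrow> f x = 1"
      "\<And>v. (\<lambda>x. f x *\<^sub>R \<Psi> x v) \<in> sections M A"
      using local_frame[OF U] by blast
    have "smooth_map_on M N (\<lambda>y. inv (dual_triv A \<Psi> y) (\<gamma> y))"
    proof (rule smooth_inv_dual_triv[OF U(1) f(2,4) \<gamma>_fibre])
      fix b
      have "smooth_map_on M N (L (\<lambda>x. f x *\<^sub>R \<Psi> x b))"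
        using smooth[OF f(6)[of b]] smooth_map_on_subset by (auto simp: smooth_functions_def)
      then show "smooth_map_on M N (\<lambda>y. \<gamma> y (\<Psi> y b))"
      proof (rule smooth_map_on_cong[OF f(2), rotated])
        fix y assume "y \<in> N"
        then show "L (\<lambda>x. f x *\<^sub>R \<Psi> x b) y = \<gamma> y (\<Psi> y b)"
          using \<gamma>[OF f(6)[of b], of y] f(5)[of y] by simp
      qed
    qed
    then show "\<exists>V \<Theta> N. (V, \<Theta>) \<in> trivs (dual_bundle A) \<and> open N \<and> x \<in> N \<and> N \<subseteq> V \<and>
        smooth_map_on M N (\<lambda>y. inv (\<Theta> y) (\<gamma> y))"
      using f(2,3,4) dual_trivI[OF U(1)] by blast
  qed
  moreover have "pairing \<gamma> X = L X" if "X \<in> sections M A" for X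
    using \<gamma>[OF that] by (auto simp: pairing_def)
  ultimately show ?thesis
    by (intro ex1I[of _ \<gamma>]) (auto intro: dual_section_eqI)
qed

subsection \<open>The map defined by a tensor\<close>

context
  fixes r
  assumes r: "r \<in> tensor_sections M A"
begin

context
  fixes x \<alpha> \<beta>
  assumes \<alpha>: "\<alpha> \<in> fibre (dual_bundle A) x" and \<beta>: "\<beta> \<in> fibre (dual_bundle A) x"
begin

lemma tensor_add_left: "\<gamma> \<in> fibre (dual_bundle A) x \<Longrightarrow> r x (\<alpha> + \<beta>) \<gamma> = r x \<alpha> \<gamma> + r x \<beta> \<gamma>"
  and tensor_add_right: "\<gamma> \<in> fibre (dual_bundle A) x \<Longrightarrow> r x \<gamma> (\<alpha> + \<beta>) = r x \<gamma> \<alpha> + r x \<gamma> \<beta>"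
  and tensor_scale_left: "r x (c *\<^sub>R \<alpha>) \<beta> = c * r x \<alpha> \<beta>"
  and tensor_scale_right: "r x \<alpha> (c *\<^sub>R \<beta>) = c * r x \<alpha> \<beta>"
  using r \<alpha> \<beta> unfolding tensor_sections_def by blast+

end

lemma tensor_sum_right:
  assumes "\<alpha> \<in> fibre (dual_bundle A) x" "\<And>i. i \<in> I \<Longrightarrow> \<beta> i \<in> fibre (dual_bundle A) x"
  shows "r x \<alpha> (\<Sum>i\<in>I. \<beta> i) = (\<Sum>i\<in>I. r x \<alpha> (\<beta> i))"
proof -
  have "r x \<alpha> 0 = 0"
    using tensor_scale_right[OF assms(1) subspace_0[OF subspace_dual_fibre], of 0] by simp
  with assms(2) show ?thesis
    by (induction I rule: infinite_finite_induct)
      (auto simp: tensor_add_right[OF _ _ assms(1)] subspace_sum[OF subspace_dual_fibre]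
        simp del: plus_fun_apply zero_fun_apply)
qed

lemma tensor_sum_left:
  assumes "\<alpha> \<in> fibre (dual_bundle A) x" "\<And>i. i \<in> I \<Longrightarrow> \<beta> i \<in> fibre (dual_bundle A) x"
  shows "r x (\<Sum>i\<in>I. \<beta> i) \<alpha> = (\<Sum>i\<in>I. r x (\<beta> i) \<alpha>)"
proof -
  have "r x 0 \<alpha> = 0"
    using tensor_scale_left[OF subspace_0[OF subspace_dual_fibre] assms(1), of 0] by simp
  with assms(2) show ?thesis
    by (induction I rule: infinite_finite_induct)
      (auto simp: tensor_add_left[OF _ _ assms(1)] subspace_sum[OF subspace_dual_fibre]
        simp del: plus_fun_apply zero_fun_apply)
qed

lemma smooth_tensor_triv:
  "(U, \<Psi>) \<in> trivs A \<Longrightarrow> smooth_map_on M U (\<lambda>x. r x (dual_triv A \<Psi> x v) (dual_triv A \<Psi> x w))"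
  using r dual_trivI unfolding tensor_sections_def by fastforce

lemma dual_basis_expansion:
  assumes U: "(U, \<Psi>) \<in> trivs A" "x \<in> U" and \<beta>: "\<beta> \<in> fibre (dual_bundle A) x"
  shows "\<beta> = (\<Sum>b\<in>onb. \<beta> (\<Psi> x b) *\<^sub>R dual_triv A \<Psi> x b)"
  using dual_expansion[OF U \<beta>]
  by (simp add: linear_sum[OF linear_dual_triv[OF U]] linear_scale[OF linear_dual_triv[OF U]])

lemma tensor_dual_expansion:
  assumes U: "(U, \<Psi>) \<in> trivs A" "x \<in> U"
    and \<alpha>: "\<alpha> \<in> fibre (dual_bundle A) x" and \<beta>: "\<beta> \<in> fibre (dual_bundle A) x"
  shows "r x \<alpha> \<beta> = (\<Sum>b\<in>onb. \<beta> (\<Psi> x b) * r x \<alpha> (dual_triv A \<Psi> x b))"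
    and "r x \<beta> \<alpha> = (\<Sum>b\<in>onb. \<beta> (\<Psi> x b) * r x (dual_triv A \<Psi> x b) \<alpha>)"
proof -
  note in_fibre = dual_triv_in_fibre[OF U] subspace_scale[OF subspace_dual_fibre dual_triv_in_fibre[OF U]]
  have "r x \<alpha> \<beta> = r x \<alpha> (\<Sum>b\<in>onb. \<beta> (\<Psi> x b) *\<^sub>R dual_triv A \<Psi> x b)"
    using dual_basis_expansion[OF U \<beta>] by simp
  then show "r x \<alpha> \<beta> = (\<Sum>b\<in>onb. \<beta> (\<Psi> x b) * r x \<alpha> (dual_triv A \<Psi> x b))"
    by (simp add: tensor_sum_right[OF \<alpha>] tensor_scale_right[OF \<alpha>] in_fibre)
  have "r x \<beta> \<alpha> = r x (\<Sum>b\<in>onb. \<beta> (\<Psi> x b) *\<^sub>R dual_triv A \<Psi> x b) \<alpha>"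
    using dual_basis_expansion[OF U \<beta>] by simp
  then show "r x \<beta> \<alpha> = (\<Sum>b\<in>onb. \<beta> (\<Psi> x b) * r x (dual_triv A \<Psi> x b) \<alpha>)"
    by (simp add: tensor_sum_left[OF \<alpha>] tensor_scale_left[OF _ \<alpha>] in_fibre)
qed

text \<open>The vector whose coordinates are the values of \<open>r x \<alpha>\<close> on the dual
  frame has the required pairings, and covectors separate vectors, so \<open>THE\<close> picks it.
  The explicit sum later yields smoothness of r_# and of the tensor anchor.\<close>

lemma sharp_eq:
  assumes U: "(U, \<Psi>) \<in> trivs A" "x \<in> U" and \<alpha>: "\<alpha> \<in> fibre (dual_bundle A) x"
  shows "sharp A r x \<alpha> = (\<Sum>b\<in>onb. r x \<alpha> (dual_triv A \<Psi> x b) *\<^sub>R \<Psi> x b)"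
    and "sharp A r x \<alpha> \<in> fibre A x"
    and "\<beta> \<in> fibre (dual_bundle A) x \<Longrightarrow> \<beta> (sharp A r x \<alpha>) = r x \<alpha> \<beta>"
proof -
  let ?v = "\<Sum>b\<in>onb. r x \<alpha> (dual_triv A \<Psi> x b) *\<^sub>R \<Psi> x b"
  have v: "?v \<in> fibre A x"
    by (intro subspace_sum[OF subspace_fibre] subspace_scale[OF subspace_fibre] triv_in_fibre[OF U])
  have \<beta>v: "\<beta> ?v = r x \<alpha> \<beta>" if \<beta>: "\<beta> \<in> fibre (dual_bundle A) x" for \<beta>
    by (simp add: tensor_dual_expansion(1)[OF U \<alpha> \<beta>] dual_fibre_sum[OF \<beta>] dual_fibre_scaleR[OF \<beta>]
        triv_in_fibre[OF U] subspace_scale[OF subspace_fibre] mult.commute)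
  show eq: "sharp A r x \<alpha> = ?v"
    unfolding sharp_def
    by (rule the_equality) (use v \<beta>v in \<open>auto intro!: dual_fibre_separates\<close>)
  show "sharp A r x \<alpha> \<in> fibre A x" unfolding eq by (rule v)
  show "\<beta> (sharp A r x \<alpha>) = r x \<alpha> \<beta>" if "\<beta> \<in> fibre (dual_bundle A) x"
    unfolding eq by (rule \<beta>v[OF that])
qed

lemma sharp_in_fibre: "\<alpha> \<in> fibre (dual_bundle A) x \<Longrightarrow> sharp A r x \<alpha> \<in> fibre A x"
  using sharp_eq(2) triv_exists by blast

lemma dual_sharp:
  "\<alpha> \<in> fibre (dual_bundle A) x \<Longrightarrow> \<beta> \<in> fibre (dual_bundle A) x \<Longrightarrow> \<beta> (sharp A r x \<alpha>) = r x \<alpha> \<beta>"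
  using sharp_eq(3) triv_exists by blast

lemma sharp_add:
  assumes "\<alpha> \<in> fibre (dual_bundle A) x" "\<beta> \<in> fibre (dual_bundle A) x"
  shows "sharp A r x (\<alpha> + \<beta>) = sharp A r x \<alpha> + sharp A r x \<beta>"
proof (rule dual_fibre_separates)
  note sum = subspace_add[OF subspace_dual_fibre assms]
  show "sharp A r x (\<alpha> + \<beta>) \<in> fibre A x" by (rule sharp_in_fibre[OF sum])
  show "sharp A r x \<alpha> + sharp A r x \<beta> \<in> fibre A x"
    by (intro subspace_add[OF subspace_fibre] sharp_in_fibre assms)
  fix \<gamma> assume \<gamma>: "\<gamma> \<in> fibre (dual_bundle A) x"
  show "\<gamma> (sharp A r x (\<alpha> + \<beta>)) = \<gamma> (sharp A r x \<alpha> + sharp A r x \<beta>)"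
    using dual_sharp[OF sum \<gamma>] tensor_add_left[OF assms \<gamma>] dual_sharp[OF assms(1) \<gamma>]
      dual_sharp[OF assms(2) \<gamma>] dual_fibre_add[OF \<gamma>] sharp_in_fibre[OF assms(1)]
      sharp_in_fibre[OF assms(2)] by metis
qed

lemma sharp_scaleR:
  assumes "\<alpha> \<in> fibre (dual_bundle A) x"
  shows "sharp A r x (c *\<^sub>R \<alpha>) = c *\<^sub>R sharp A r x \<alpha>"
proof (rule dual_fibre_separates)
  note scaled = subspace_scale[OF subspace_dual_fibre assms, of c]
  show "sharp A r x (c *\<^sub>R \<alpha>) \<in> fibre A x" by (rule sharp_in_fibre[OF scaled])
  show "c *\<^sub>R sharp A r x \<alpha> \<in> fibre A x"
    by (intro subspace_scale[OF subspace_fibre] sharp_in_fibre assms)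
  fix \<gamma> assume \<gamma>: "\<gamma> \<in> fibre (dual_bundle A) x"
  show "\<gamma> (sharp A r x (c *\<^sub>R \<alpha>)) = \<gamma> (c *\<^sub>R sharp A r x \<alpha>)"
    using dual_sharp[OF scaled \<gamma>] tensor_scale_left[OF assms \<gamma>] dual_sharp[OF assms \<gamma>]
      dual_fibre_scaleR[OF \<gamma> sharp_in_fibre[OF assms]] by metis
qed

lemma smooth_tensor_coords:
  assumes U: "(U, \<Psi>) \<in> trivs A" and \<alpha>: "\<alpha> \<in> dual_sections M A"
  shows "smooth_map_on M U (\<lambda>x. r x (\<alpha> x) (dual_triv A \<Psi> x b))"
proof -
  note op = open_triv[OF U]
  have "smooth_map_on M U (\<lambda>x. \<Sum>c\<in>onb. \<alpha> x (\<Psi> x c) * r x (dual_triv A \<Psi> x c) (dual_triv A \<Psi> x b))"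
    by (intro smooth_map_on_sum smooth_map_on_mult op smooth_dual_section_triv[OF \<alpha> U]
        smooth_tensor_triv[OF U])
  then show ?thesis
    by (rule smooth_map_on_cong[OF op, rotated])
      (simp add: tensor_dual_expansion(2)[OF U _ dual_triv_in_fibre[OF U] dual_section_fibre[OF \<alpha>]])
qed

lemma sharp_section:
  assumes \<alpha>: "\<alpha> \<in> dual_sections M A"
  shows "sharp_section A r \<alpha> \<in> sections M A"
proof (rule sectionsI)
  fix x show "sharp_section A r \<alpha> x \<in> fibre A x"
    by (simp add: sharp_section_def sharp_in_fibre dual_section_fibre[OF \<alpha>])
next
  fix U \<Psi> assume U: "(U, \<Psi>) \<in> trivs A"
  note op = open_triv[OF U]
  have "smooth_map_on M U (\<lambda>x. \<Sum>b\<in>onb. r x (\<alpha> x) (dual_triv A \<Psi> x b) *\<^sub>R b)"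
    by (intro smooth_map_on_sum smooth_map_on_scaleR op smooth_map_on_const smooth_tensor_coords[OF U \<alpha>])
  then show "smooth_map_on M U (\<lambda>x. inv (\<Psi> x) (sharp_section A r \<alpha> x))"
    by (rule smooth_map_on_cong[OF op, rotated])
      (simp add: sharp_section_def sharp_eq(1)[OF U _ dual_section_fibre[OF \<alpha>]] inv_triv_sum[OF U]
        inv_triv_scaleR[OF U] inv_triv_triv[OF U] triv_in_fibre[OF U] subspace_scale[OF subspace_fibre])
qed

lemma pairing_sharp_section:
  assumes "\<alpha> \<in> dual_sections M A" "\<beta> \<in> dual_sections M A"
  shows "pairing \<beta> (sharp_section A r \<alpha>) = on_sections r \<alpha> \<beta>"
  using assms by (auto simp: pairing_def sharp_section_def on_sections_def dual_sharp dual_section_fibre)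

lemma on_sections_smooth:
  assumes "\<alpha> \<in> dual_sections M A" "\<beta> \<in> dual_sections M A"
  shows "on_sections r \<alpha> \<beta> \<in> smooth_functions M"
  using pairing_smooth[OF assms(2) sharp_section[OF assms(1)]] pairing_sharp_section[OF assms] by simp

end

end


section \<open>The tangent bundle\<close>

context manifold
begin

lemma smooth_on_function_chart:
  "f \<in> smooth_functions M \<Longrightarrow> (U, \<phi>) \<in> M \<Longrightarrow> smooth_on (\<phi> ` U) (\<lambda>y. f (inv_into U \<phi> y))"
  using smooth_map_on_chart_rep[of UNIV f U \<phi>] by (simp add: smooth_functions_def)

context
  fixes U \<phi> x
  assumes U: "(U, \<phi>) \<in> M" "x \<in> U"
begin

lemma function_has_derivative:
  assumes "f \<in> smooth_functions M"
  shows "((\<lambda>y. f (inv_into U \<phi> y)) has_derivative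
    frechet_derivative (\<lambda>y. f (inv_into U \<phi> y)) (at (\<phi> x))) (at (\<phi> x))"
  by (rule smooth_on_has_derivative[OF smooth_on_function_chart[OF assms U(1)]]) (use U(2) in auto)

lemma linear_chart_deriv: "linear (chart_deriv M U \<phi> x)"
proof (rule linearI; rule ext)
  fix v w c f
  show "chart_deriv M U \<phi> x (v + w) f = (chart_deriv M U \<phi> x v + chart_deriv M U \<phi> x w) f"
    using has_derivative_linear[OF function_has_derivative[of f]]
    by (simp add: chart_deriv_def linear_add)
  show "chart_deriv M U \<phi> x (c *\<^sub>R v) f = (c *\<^sub>R chart_deriv M U \<phi> x v) f"
    using has_derivative_linear[OF function_has_derivative[of f]]
    by (simp add: chart_deriv_def linear_scale scaleR_fun_def)
qed

lemma chart_deriv_add: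
  assumes f: "f \<in> smooth_functions M" and g: "g \<in> smooth_functions M"
  shows "chart_deriv M U \<phi> x v (\<lambda>x. f x + g x) = chart_deriv M U \<phi> x v f + chart_deriv M U \<phi> x v g"
  using frechet_derivative_at[OF has_derivative_add[OF function_has_derivative[OF f]
        function_has_derivative[OF g]], symmetric]
  by (simp add: chart_deriv_def f g smooth_functions_add)

lemma chart_deriv_mult:
  assumes f: "f \<in> smooth_functions M" and g: "g \<in> smooth_functions M"
  shows "chart_deriv M U \<phi> x v (\<lambda>x. f x * g x) =
    f x * chart_deriv M U \<phi> x v g + chart_deriv M U \<phi> x v f * g x"
  using frechet_derivative_at[OF has_derivative_mult[OF function_has_derivative[OF f]
        function_has_derivative[OF g]], symmetric] inv_chart[OF U]
  by (simp add: chart_deriv_def f g smooth_functions_mult)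

text \<open>Tangent vectors act on global functions only, so the components of \<open>v\<close> are
  recovered from coordinate functions multiplied by a cutoff that is 1 near
  \<open>x\<close>.\<close>

lemma inj_chart_deriv: "inj (chart_deriv M U \<phi> x)"
proof
  fix v w assume eq: "chart_deriv M U \<phi> x v = chart_deriv M U \<phi> x w"
  show "v = w"
  proof (rule onb_eqI[OF finite_dimensional_model])
    fix b :: 'e
    obtain f N K where f: "f \<in> smooth_functions M" "open N" "x \<in> N" "\<And>y. y \<in> N \<Longrightarrow> f y = (1 :: real)"
      and K: "closed K" "K \<subseteq> U" "\<And>y. y \<notin> K \<Longrightarrow> f y = 0"
      using cutoff_function_exists[OF open_chart[OF U(1)] U(2)] by blast
    define g where "g = (\<lambda>y. f y *\<^sub>R (\<phi> y \<bullet> b))"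
    have "smooth_map_on M U (\<lambda>y. \<phi> y \<bullet> b)"
      by (intro smooth_map_on_inner open_chart[OF U(1)] smooth_map_on_chart[OF U(1)] smooth_map_on_const)
    then have g: "g \<in> smooth_functions M"
      unfolding g_def smooth_functions_def mem_Collect_eq
      by (intro cutoff_extend[OF f(1) K(1,2) open_chart[OF U(1)] K(3)])
    have "((\<lambda>y. g (inv_into U \<phi> y)) has_derivative (\<lambda>v. v \<bullet> b)) (at (\<phi> x))"
    proof (rule has_derivative_transform_within_open[of "\<lambda>y. y \<bullet> b"])
      show "((\<lambda>y. y \<bullet> b) has_derivative (\<lambda>v. v \<bullet> b)) (at (\<phi> x))"
        by (auto intro!: derivative_eq_intros)
      show "open (\<phi> ` (U \<inter> N))" by (rule open_chart_image_Int[OF U(1) f(2)])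
      show "\<phi> x \<in> \<phi> ` (U \<inter> N)" using U f by auto
      show "y \<bullet> b = g (inv_into U \<phi> y)" if "y \<in> \<phi> ` (U \<inter> N)" for y
        using that f(4) inv_chart[OF U(1)] by (auto simp: g_def)
    qed
    from frechet_derivative_at[OF this, symmetric] have "chart_deriv M U \<phi> x v g = v \<bullet> b" for v
      by (simp add: chart_deriv_def g)
    then show "v \<bullet> b = w \<bullet> b" using eq by metis
  qed
qed

text \<open>The chain rule for a chart transition: its Jacobian changes the components. It makes any
  single chart at \<open>x\<close> parametrize the whole tangent fibre, and its smooth entries are
  the transition functions of the tangent bundle.\<close>

lemma chart_deriv_change:
  assumes V: "(V, \<psi>) \<in> M" "x \<in> V"
  shows "chart_deriv M U \<phi> x v =
    chart_deriv M V \<psi> x (frechet_derivative (\<lambda>y. \<psi> (inv_into U \<phi> y)) (at (\<phi> x)) v)"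
proof
  fix f
  show "chart_deriv M U \<phi> x v f =
    chart_deriv M V \<psi> x (frechet_derivative (\<lambda>y. \<psi> (inv_into U \<phi> y)) (at (\<phi> x)) v) f"
  proof (cases "f \<in> smooth_functions M")
    case True
    let ?D = "frechet_derivative (\<lambda>y. \<psi> (inv_into U \<phi> y)) (at (\<phi> x))"
    have inv: "inv_into U \<phi> (\<phi> x) = x" using inv_chart[OF U] .
    have "((\<lambda>y. \<psi> (inv_into U \<phi> y)) has_derivative ?D) (at (\<phi> x))"
      by (rule smooth_on_has_derivative[OF smooth_on_transition[OF V(1) U(1)]]) (use U V in auto)
    moreover have "((\<lambda>z. f (inv_into V \<psi> z)) has_derivative
        frechet_derivative (\<lambda>z. f (inv_into V \<psi> z)) (at (\<psi> x))) (at (\<psi> (inv_into U \<phi> (\<phi> x))))"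
      unfolding inv
      by (rule smooth_on_has_derivative[OF smooth_on_function_chart[OF True V(1)]]) (use V in auto)
    ultimately have "((\<lambda>y. f (inv_into V \<psi> (\<psi> (inv_into U \<phi> y)))) has_derivative
        (\<lambda>v. frechet_derivative (\<lambda>z. f (inv_into V \<psi> z)) (at (\<psi> x)) (?D v))) (at (\<phi> x))"
      by (rule has_derivative_compose)
    then have "((\<lambda>y. f (inv_into U \<phi> y)) has_derivative
        (\<lambda>v. frechet_derivative (\<lambda>z. f (inv_into V \<psi> z)) (at (\<psi> x)) (?D v))) (at (\<phi> x))"
    proof (rule has_derivative_transform_within_open)
      show "open (\<phi> ` (U \<inter> V))" by (rule open_chart_image_Int[OF U(1) open_chart[OF V(1)]])
    qed (use U V inv_chart[OF U(1)] inv_chart[OF V(1)] in auto)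
    from frechet_derivative_at[OF this, symmetric] show ?thesis
      by (simp add: chart_deriv_def True)
  qed (simp add: chart_deriv_def)
qed

end

lemma tangent_fibre:
  assumes U: "(U, \<phi>) \<in> M" "x \<in> U"
  shows "fibre (tangent_bundle M) x = range (chart_deriv M U \<phi> x)"
proof (intro set_eqI iffI)
  fix t assume "t \<in> fibre (tangent_bundle M) x"
  then obtain V \<psi> v where V: "(V, \<psi>) \<in> M" "x \<in> V" "t = chart_deriv M V \<psi> x v"
    by (auto simp: tangent_bundle_def)
  then show "t \<in> range (chart_deriv M U \<phi> x)"
    using chart_deriv_change[OF V(1,2) U] by blast
qed (use U in \<open>auto simp: tangent_bundle_def\<close>)

lemma bij_chart_deriv:
  "(U, \<phi>) \<in> M \<Longrightarrow> x \<in> U \<Longrightarrow> bij_betw (chart_deriv M U \<phi> x) UNIV (fibre (tangent_bundle M) x)"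
  by (simp add: bij_betw_def inj_chart_deriv tangent_fibre)

lemma trivs_tangent_bundle: "trivs (tangent_bundle M) = {(U, chart_deriv M U \<phi>) | U \<phi>. (U, \<phi>) \<in> M}"
  by (simp add: tangent_bundle_def)

lemma vector_bundle_tangent: "vector_bundle M (tangent_bundle M)"
proof -
  have "smooth_map_on M (U \<inter> V) (\<lambda>x. inv (chart_deriv M V \<psi> x) (chart_deriv M U \<phi> x v))"
    if U: "(U, \<phi>) \<in> M" and V: "(V, \<psi>) \<in> M" for U \<phi> V \<psi> v
  proof (rule smooth_map_onI_chart[OF U])
    show "open (U \<inter> V)" using open_chart U V by blast
    have op: "open (\<phi> ` (U \<inter> V))" by (rule open_chart_image_Int[OF U open_chart[OF V]])
    have "smooth_on (\<phi> ` (U \<inter> V)) (\<lambda>y. frechet_derivative (\<lambda>y. \<psi> (inv_into U \<phi> y)) (at y) v)"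
      using smooth_on_frechet_derivative[OF smooth_on_transition[OF V U]] by (simp add: Int_commute)
    then show "smooth_on (\<phi> ` (U \<inter> V)) (\<lambda>y. inv (chart_deriv M V \<psi> (inv_into U \<phi> y))
        (chart_deriv M U \<phi> (inv_into U \<phi> y) v))"
    proof (rule smooth_on_cong[OF op, rotated])
      fix y assume "y \<in> \<phi> ` (U \<inter> V)"
      then obtain x where x: "x \<in> U" "x \<in> V" "y = \<phi> x" by blast
      show "frechet_derivative (\<lambda>y. \<psi> (inv_into U \<phi> y)) (at y) v =
          inv (chart_deriv M V \<psi> (inv_into U \<phi> y)) (chart_deriv M U \<phi> (inv_into U \<phi> y) v)"
        unfolding x(3) inv_chart[OF U x(1)] chart_deriv_change[OF U x(1) V x(2), of v]
        by (rule inv_f_f[OF inj_chart_deriv[OF V x(2)], symmetric])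
    qed
  qed simp
  moreover have "subspace (fibre (tangent_bundle M) x)" for x
  proof -
    obtain U \<phi> where U: "(U, \<phi>) \<in> M" "x \<in> U" using chart_exists by blast
    show ?thesis
      unfolding tangent_fibre[OF U] by (rule linear_subspace_image[OF linear_chart_deriv[OF U] subspace_UNIV])
  qed
  moreover have "(\<Union>(U, \<Psi>)\<in>trivs (tangent_bundle M). U) = UNIV"
  proof (intro set_eqI iffI UNIV_I)
    fix x
    obtain U \<phi> where U: "(U, \<phi>) \<in> M" "x \<in> U" using chart_exists by blast
    have "(U, chart_deriv M U \<phi>) \<in> trivs (tangent_bundle M)" using U by (auto simp: trivs_tangent_bundle)
    then show "x \<in> (\<Union>(U, \<Psi>)\<in>trivs (tangent_bundle M). U)"
      by (rule UN_I) (simp add: U(2))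
  qed
  ultimately show ?thesis
    unfolding vector_bundle_def
    by (auto simp: trivs_tangent_bundle finite_dimensional_model open_chart
        linear_chart_deriv bij_chart_deriv)
qed

lemma tangent_outside: "t \<in> fibre (tangent_bundle M) x \<Longrightarrow> f \<notin> smooth_functions M \<Longrightarrow> t f = 0"
  by (auto simp: tangent_bundle_def chart_deriv_def)

lemma
  assumes "t \<in> fibre (tangent_bundle M) x" "f \<in> smooth_functions M" "g \<in> smooth_functions M"
  shows tangent_add: "t (\<lambda>x. f x + g x) = t f + t g"
    and tangent_mult: "t (\<lambda>x. f x * g x) = f x * t g + t f * g x"
  using assms by (auto simp: tangent_bundle_def chart_deriv_add chart_deriv_mult)

lemma tangent_const: "t \<in> fibre (tangent_bundle M) x \<Longrightarrow> t (\<lambda>x. c) = 0"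
  by (auto simp: tangent_bundle_def chart_deriv_def)

end


section \<open>Anchored vector bundles\<close>

locale anchored = vbundle M A
  for M :: "('m::{t2_space, second_countable_topology}, 'e::real_inner) atlas"
    and A :: "('m, 'v::real_vector, 'f::real_inner) vbundle" +
  fixes \<rho> :: "'m \<Rightarrow> 'v \<Rightarrow> ('m \<Rightarrow> real) \<Rightarrow> real"
  assumes bundle_map_anchor: "bundle_map M A (tangent_bundle M) \<rho>"
begin

lemma anchor_tangent: "u \<in> fibre A x \<Longrightarrow> \<rho> x u \<in> fibre (tangent_bundle M) x"
  using bundle_map_anchor by (simp add: bundle_map_def)

lemma anchor_plus: "u \<in> fibre A x \<Longrightarrow> v \<in> fibre A x \<Longrightarrow> \<rho> x (u + v) = \<rho> x u + \<rho> x v"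
  using bundle_map_anchor by (simp add: bundle_map_def)

lemma anchor_scaleR: "u \<in> fibre A x \<Longrightarrow> \<rho> x (c *\<^sub>R u) = c *\<^sub>R \<rho> x u"
  using bundle_map_anchor by (simp add: bundle_map_def)

lemma anchor_zero: "\<rho> x 0 = 0"
  using anchor_scaleR[of 0 x 0] subspace_0[OF subspace_fibre] by simp

lemma anchor_sum:
  assumes "\<And>i. i \<in> I \<Longrightarrow> u i \<in> fibre A x"
  shows "\<rho> x (\<Sum>i\<in>I. u i) = (\<Sum>i\<in>I. \<rho> x (u i))"
  using assms
  by (induction I rule: infinite_finite_induct)
    (auto simp: anchor_zero anchor_plus subspace_sum[OF subspace_fibre]
      simp del: plus_fun_apply zero_fun_apply)

lemma smooth_anchor_triv:
  assumes "(U, \<Psi>) \<in> trivs A" "(V, \<phi>) \<in> M"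
  shows "smooth_map_on M (U \<inter> V) (\<lambda>x. inv (chart_deriv M V \<phi> x) (\<rho> x (\<Psi> x v)))"
proof -
  have "(V, chart_deriv M V \<phi>) \<in> trivs (tangent_bundle M)"
    using assms(2) by (auto simp: trivs_tangent_bundle)
  with assms(1) bundle_map_anchor show ?thesis unfolding bundle_map_def by fastforce
qed

text \<open>Locally the derivative is a sum of products of coordinates of \<open>X\<close>,
  components of the anchor on the frame, and partial derivatives of \<open>f\<close>, all of them
  smooth.\<close>

lemma smooth_anchor_deriv:
  assumes X: "X \<in> sections M A" and f: "f \<in> smooth_functions M"
  shows "anchor_deriv \<rho> X f \<in> smooth_functions M"
  unfolding smooth_functions_def mem_Collect_eq
proof (rule smooth_map_on_local)
  fix x
  obtain U \<Psi> where U: "(U, \<Psi>) \<in> trivs A" "x \<in> U" using triv_exists by blast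
  obtain V \<phi> where V: "(V, \<phi>) \<in> M" "x \<in> V" using chart_exists by blast
  have op: "open (U \<inter> V)" using open_triv[OF U(1)] open_chart[OF V(1)] by blast
  let ?D = "\<lambda>x. frechet_derivative (\<lambda>y. f (inv_into V \<phi> y)) (at (\<phi> x))"
  let ?w = "\<lambda>b x. inv (chart_deriv M V \<phi> x) (\<rho> x (\<Psi> x b))"
  have D: "smooth_map_on M V (\<lambda>x. ?D x v)" for v
  proof (rule smooth_map_onI_chart[OF V(1) open_chart[OF V(1)] subset_refl])
    show "smooth_on (\<phi> ` V) (\<lambda>y. ?D (inv_into V \<phi> y) v)"
      by (rule smooth_on_cong[OF open_chart_image[OF V(1)] _
            smooth_on_frechet_derivative[OF smooth_on_function_chart[OF f V(1)]]])
        (use inv_chart[OF V(1)] in auto)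
  qed
  have "smooth_map_on M (U \<inter> V)
      (\<lambda>x. \<Sum>b\<in>onb. (inv (\<Psi> x) (X x) \<bullet> b) * (\<Sum>c\<in>onb. (?w b x \<bullet> c) * ?D x c))"
    by (intro smooth_map_on_sum smooth_map_on_mult smooth_map_on_inner op smooth_map_on_const
        smooth_anchor_triv[OF U(1) V(1)] smooth_map_on_subset[OF smooth_section_coords[OF X U(1)]]
        smooth_map_on_subset[OF D]) auto
  then have "smooth_map_on M (U \<inter> V) (anchor_deriv \<rho> X f)"
  proof (rule smooth_map_on_cong[OF op, rotated])
    fix y assume "y \<in> U \<inter> V"
    then have y: "y \<in> U" "y \<in> V" by auto
    have b: "\<rho> y (\<Psi> y b) f = (\<Sum>c\<in>onb. (?w b y \<bullet> c) * ?D y c)" for b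
    proof -
      have w: "\<rho> y (\<Psi> y b) = chart_deriv M V \<phi> y (?w b y)"
        using anchor_tangent[OF triv_in_fibre[OF U(1) y(1)], of b]
          bij_betw_imp_surj_on[OF bij_chart_deriv[OF V(1) y(2)]] by (auto simp: f_inv_into_f)
      have "\<rho> y (\<Psi> y b) f = ?D y (?w b y)"
        using fun_cong[OF w, of f] f by (simp add: chart_deriv_def)
      also have "\<dots> = (\<Sum>c\<in>onb. (?w b y \<bullet> c) *\<^sub>R ?D y c)"
        by (rule linear_onb_expansion[OF finite_dimensional_model
              has_derivative_linear[OF function_has_derivative[OF V(1) y(2) f]]])
      finally show ?thesis by simp
    qed
    have "\<rho> y (X y) = \<rho> y (\<Sum>b\<in>onb. (inv (\<Psi> y) (X y) \<bullet> b) *\<^sub>R \<Psi> y b)"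
      using triv_expansion[OF U(1) y(1) section_fibre[OF X]] by simp
    also have "\<dots> = (\<Sum>b\<in>onb. (inv (\<Psi> y) (X y) \<bullet> b) *\<^sub>R \<rho> y (\<Psi> y b))"
      by (simp add: anchor_sum anchor_scaleR triv_in_fibre[OF U(1) y(1)] subspace_scale[OF subspace_fibre])
    finally show "(\<Sum>b\<in>onb. (inv (\<Psi> y) (X y) \<bullet> b) * (\<Sum>c\<in>onb. (?w b y \<bullet> c) * ?D y c)) =
        anchor_deriv \<rho> X f y"
      by (simp add: anchor_deriv_def sum_fun_apply scaleR_fun_def b)
  qed
  then show "\<exists>N. open N \<and> x \<in> N \<and> smooth_map_on M N (anchor_deriv \<rho> X f)"
    using op U V by blast
qed

lemma bundle_map_tensor_anchor:
  assumes r: "r \<in> tensor_sections M A"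
  shows "bundle_map M (dual_bundle A) (tangent_bundle M) (tensor_anchor A \<rho> r)"
proof -
  interpret tangent: vbundle M "tangent_bundle M"
    by unfold_locales (rule vector_bundle_tangent)
  have "smooth_map_on M (U \<inter> V)
      (\<lambda>x. inv (chart_deriv M V \<phi> x) (tensor_anchor A \<rho> r x (dual_triv A \<Psi> x v)))"
    if U: "(U, \<Psi>) \<in> trivs A" and V: "(V, \<phi>) \<in> M" for U \<Psi> V \<phi> v
  proof (rule smooth_map_on_cong)
    show op: "open (U \<inter> V)" using open_triv[OF U] open_chart[OF V] by blast
    show "smooth_map_on M (U \<inter> V) (\<lambda>x. \<Sum>b\<in>onb. r x (dual_triv A \<Psi> x v) (dual_triv A \<Psi> x b) *\<^sub>R
        inv (chart_deriv M V \<phi> x) (\<rho> x (\<Psi> x b)))"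
      by (intro smooth_map_on_sum smooth_map_on_scaleR op smooth_anchor_triv[OF U V]
          smooth_map_on_subset[OF smooth_tensor_triv[OF r U]]) auto
    fix x assume "x \<in> U \<inter> V"
    then have x: "x \<in> U" "x \<in> V" by auto
    have T: "(V, chart_deriv M V \<phi>) \<in> trivs (tangent_bundle M)"
      using V by (auto simp: trivs_tangent_bundle)
    note fib = triv_in_fibre[OF U x(1)] subspace_scale[OF subspace_fibre triv_in_fibre[OF U x(1)]]
    have "tensor_anchor A \<rho> r x (dual_triv A \<Psi> x v) =
        (\<Sum>b\<in>onb. r x (dual_triv A \<Psi> x v) (dual_triv A \<Psi> x b) *\<^sub>R \<rho> x (\<Psi> x b))"
      by (simp add: tensor_anchor_def sharp_eq(1)[OF r U x(1) dual_triv_in_fibre[OF U x(1)]]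
          anchor_sum anchor_scaleR fib)
    then show "(\<Sum>b\<in>onb. r x (dual_triv A \<Psi> x v) (dual_triv A \<Psi> x b) *\<^sub>R
        inv (chart_deriv M V \<phi> x) (\<rho> x (\<Psi> x b))) =
        inv (chart_deriv M V \<phi> x) (tensor_anchor A \<rho> r x (dual_triv A \<Psi> x v))"
      by (simp add: tangent.inv_triv_sum[OF T x(2)] tangent.inv_triv_scaleR[OF T x(2)]
          anchor_tangent fib subspace_scale[OF tangent.subspace_fibre])
  qed
  then show ?thesis
    unfolding bundle_map_def
    by (auto simp: trivs_dual_bundle trivs_tangent_bundle tensor_anchor_def
        sharp_add[OF r] sharp_scaleR[OF r] sharp_in_fibre[OF r] anchor_tangent anchor_plus anchor_scaleR
        simp del: plus_fun_apply)
qed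

end


section \<open>Calculus on a left symmetric algebroid\<close>

lemmas [simp del] = plus_fun_apply zero_fun_apply minus_apply uminus_apply

text \<open>A name for the module action allows Leibniz rules to be stated between whole sections.
  For the same reason the evaluation rules for function arithmetic have left the simpset: identities
  are rearranged as identities of functions and evaluated at points only through
  \<open>fun_apply_simps\<close>.\<close>

definition smul :: "('m \<Rightarrow> real) \<Rightarrow> ('m \<Rightarrow> 'v::real_vector) \<Rightarrow> 'm \<Rightarrow> 'v"
  where "smul f X = (\<lambda>x. f x *\<^sub>R X x)"

lemmas fun_apply_simps = plus_fun_apply zero_fun_apply minus_apply uminus_apply times_fun_apply smul_def

context manifold
begin

lemma smooth_functions_plus: "f \<in> smooth_functions M \<Longrightarrow> g \<in> smooth_functions M \<Longrightarrow> f + g \<in> smooth_functions M"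
  by (simp add: plus_fun_def smooth_functions_add)

lemma smooth_functions_times: "f \<in> smooth_functions M \<Longrightarrow> g \<in> smooth_functions M \<Longrightarrow> f * g \<in> smooth_functions M"
  by (simp add: times_fun_def smooth_functions_mult)

lemma smooth_functions_minus:
  assumes "f \<in> smooth_functions M" "g \<in> smooth_functions M"
  shows "f - g \<in> smooth_functions M"
proof -
  have "f - g = (\<lambda>x. f x + -1 * g x)" by (auto simp: fun_apply_simps)
  then show ?thesis
    using smooth_functions_add[OF assms(1) smooth_functions_mult[OF smooth_functions_const[of "-1"] assms(2)]]
    by simp
qed

end

context vbundle
begin

lemma sections_smul: "f \<in> smooth_functions M \<Longrightarrow> X \<in> sections M A \<Longrightarrow> smul f X \<in> sections M A"
  unfolding smul_def by (rule sections_smooth_scaleR)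

end

section \<open>Derivations along sections, and the pairing as a bilinear map over functions\<close>

context anchored
begin

abbreviation (input) "C \<equiv> smooth_functions M"
abbreviation (input) "\<Gamma> \<equiv> sections M A"
abbreviation (input) "\<Gamma>d \<equiv> dual_sections M A"
abbreviation (input) "D \<equiv> anchor_deriv \<rho>"

context
  fixes X assumes X: "X \<in> \<Gamma>"
begin

lemma D_plus: "f \<in> C \<Longrightarrow> g \<in> C \<Longrightarrow> D X (f + g) = D X f + D X g"
  using tangent_add[OF anchor_tangent[OF section_fibre[OF X]]]
  by (auto simp: anchor_deriv_def plus_fun_def)

lemma D_times: "f \<in> C \<Longrightarrow> g \<in> C \<Longrightarrow> D X (f * g) = f * D X g + D X f * g"
  using tangent_mult[OF anchor_tangent[OF section_fibre[OF X]]]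
  by (auto simp: anchor_deriv_def plus_fun_def times_fun_def)

lemma D_minus:
  assumes "f \<in> C" "g \<in> C"
  shows "D X (f - g) = D X f - D X g"
  using D_plus[OF smooth_functions_minus[OF assms] assms(2)] by (simp add: algebra_simps)

end

lemma D_plus_left: "X \<in> \<Gamma> \<Longrightarrow> Y \<in> \<Gamma> \<Longrightarrow> D (X + Y) f = D X f + D Y f"
  by (auto simp: anchor_deriv_def fun_apply_simps anchor_plus section_fibre)

lemma D_minus_left: "X \<in> \<Gamma> \<Longrightarrow> Y \<in> \<Gamma> \<Longrightarrow> D (X - Y) f = D X f - D Y f"
  using D_plus_left[of "X - Y" Y f] sections_diff[of X Y] by (simp add: algebra_simps)

lemma D_smul_left: "X \<in> \<Gamma> \<Longrightarrow> D (smul f X) g = f * D X g"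
  by (auto simp: anchor_deriv_def smul_def times_fun_def anchor_scaleR section_fibre scaleR_fun_def)

context
  fixes \<beta> assumes \<beta>: "\<beta> \<in> \<Gamma>d"
begin

lemma pairing_plus: "X \<in> \<Gamma> \<Longrightarrow> Y \<in> \<Gamma> \<Longrightarrow> pairing \<beta> (X + Y) = pairing \<beta> X + pairing \<beta> Y"
  by (auto simp: pairing_def fun_apply_simps dual_fibre_add[OF dual_section_fibre[OF \<beta>]] section_fibre)

lemma pairing_minus:
  assumes "X \<in> \<Gamma>" "Y \<in> \<Gamma>"
  shows "pairing \<beta> (X - Y) = pairing \<beta> X - pairing \<beta> Y"
  using pairing_plus[OF sections_diff[OF assms] assms(2)] by (simp add: algebra_simps)

lemma pairing_smul: "X \<in> \<Gamma> \<Longrightarrow> pairing \<beta> (smul f X) = f * pairing \<beta> X"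
  by (auto simp: pairing_def smul_def times_fun_def dual_fibre_scaleR[OF dual_section_fibre[OF \<beta>]] section_fibre)

lemma pairing_0: "pairing \<beta> 0 = 0"
  by (auto simp: pairing_def fun_apply_simps dual_fibre_zero[OF dual_section_fibre[OF \<beta>]])

end

lemma pairing_plus_left: "pairing (\<beta> + \<gamma>) X = pairing \<beta> X + pairing \<gamma> X"
  and pairing_minus_left: "pairing (\<beta> - \<gamma>) X = pairing \<beta> X - pairing \<gamma> X"
  and pairing_0_left: "pairing 0 X = 0"
  and pairing_smul_left: "pairing (smul f \<beta>) X = f * pairing \<beta> X"
  by (auto simp: pairing_def fun_apply_simps scaleR_fun_def)

end

locale lsa =
  fixes M :: "('m::{t2_space, second_countable_topology}, 'e::real_inner) atlas"
    and A :: "('m, 'v::real_vector, 'f::real_inner) vbundle"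
    and \<rho> :: "'m \<Rightarrow> 'v \<Rightarrow> ('m \<Rightarrow> real) \<Rightarrow> real"
    and S :: "('m \<Rightarrow> 'v) \<Rightarrow> ('m \<Rightarrow> 'v) \<Rightarrow> ('m \<Rightarrow> 'v)"
  assumes left_symmetric: "left_symmetric_algebroid M A \<rho> S"

sublocale lsa \<subseteq> anchored M A \<rho>
  using left_symmetric
  by unfold_locales (auto simp: left_symmetric_algebroid_def anchored_vector_bundle_def)

sublocale lsa \<subseteq> dual: vbundle M "dual_bundle A"
  by (rule vbundle_dual)

section \<open>Commutator bracket and dual product of a flat product\<close>

context lsa
begin

abbreviation (input) "Sd \<equiv> dual_product M A \<rho> S"
abbreviation (input) "Br \<equiv> bracket S"

lemma right_anchored: "right_anchored_product M A \<rho> S"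
  using left_symmetric by (simp add: left_symmetric_algebroid_def)

lemma S_closed: "X \<in> \<Gamma> \<Longrightarrow> Y \<in> \<Gamma> \<Longrightarrow> S X Y \<in> \<Gamma>"
  and S_plus_left: "X \<in> \<Gamma> \<Longrightarrow> Y \<in> \<Gamma> \<Longrightarrow> Z \<in> \<Gamma> \<Longrightarrow> S (X + Y) Z = S X Z + S Y Z"
  and S_plus_right: "X \<in> \<Gamma> \<Longrightarrow> Y \<in> \<Gamma> \<Longrightarrow> Z \<in> \<Gamma> \<Longrightarrow> S X (Y + Z) = S X Y + S X Z"
  using right_anchored unfolding right_anchored_product_def by blast+

lemma S_smul_left: "f \<in> C \<Longrightarrow> X \<in> \<Gamma> \<Longrightarrow> Y \<in> \<Gamma> \<Longrightarrow> S (smul f X) Y = smul f (S X Y)"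
  using right_anchored unfolding right_anchored_product_def smul_def by blast

lemma S_smul_right:
  assumes "f \<in> C" "X \<in> \<Gamma>" "Y \<in> \<Gamma>"
  shows "S X (smul f Y) = smul f (S X Y) + smul (D X f) Y"
proof -
  have "S X (smul f Y) = (\<lambda>x. f x *\<^sub>R S X Y x + D X f x *\<^sub>R Y x)"
    using right_anchored assms unfolding right_anchored_product_def smul_def by blast
  then show ?thesis by (simp add: smul_def plus_fun_def)
qed

lemma S_minus_left: "X \<in> \<Gamma> \<Longrightarrow> Y \<in> \<Gamma> \<Longrightarrow> Z \<in> \<Gamma> \<Longrightarrow> S (X - Y) Z = S X Z - S Y Z"
  using S_plus_left[of "X - Y" Y Z] sections_diff[of X Y] by (simp add: algebra_simps)

lemma S_minus_right: "X \<in> \<Gamma> \<Longrightarrow> Y \<in> \<Gamma> \<Longrightarrow> Z \<in> \<Gamma> \<Longrightarrow> S X (Y - Z) = S X Y - S X Z"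
  using S_plus_right[of X "Y - Z" Z] sections_diff[of Y Z] by (simp add: algebra_simps)

lemma S_0_left: "X \<in> \<Gamma> \<Longrightarrow> S 0 X = 0"
  using S_plus_left[of 0 0 X] sections_0 by simp

lemma S_0_right: "X \<in> \<Gamma> \<Longrightarrow> S X 0 = 0"
  using S_plus_right[of X 0 0] sections_0 by simp

lemma S_uminus_left: "X \<in> \<Gamma> \<Longrightarrow> Y \<in> \<Gamma> \<Longrightarrow> S (- X) Y = - S X Y"
  using S_minus_left[of 0 X Y] sections_0 by (simp add: S_0_left)

lemma Br_closed: "X \<in> \<Gamma> \<Longrightarrow> Y \<in> \<Gamma> \<Longrightarrow> Br X Y \<in> \<Gamma>"
  unfolding bracket_def by (intro sections_diff S_closed)

lemma S_flat: "X \<in> \<Gamma> \<Longrightarrow> Y \<in> \<Gamma> \<Longrightarrow> Z \<in> \<Gamma> \<Longrightarrow> S X (S Y Z) - S Y (S X Z) = S (Br X Y) Z"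
  using left_symmetric unfolding left_symmetric_algebroid_def curvature_def by auto

lemmas closed = S_closed Br_closed sections_add sections_diff sections_0 sections_uminus sections_smul
  smooth_anchor_deriv pairing_smooth smooth_functions_plus smooth_functions_minus smooth_functions_times
  dual.sections_add dual.sections_diff dual.sections_0 dual.sections_uminus dual.sections_smul

lemma Br_plus_left: "X \<in> \<Gamma> \<Longrightarrow> Y \<in> \<Gamma> \<Longrightarrow> Z \<in> \<Gamma> \<Longrightarrow> Br (X + Y) Z = Br X Z + Br Y Z"
  and Br_plus_right: "X \<in> \<Gamma> \<Longrightarrow> Y \<in> \<Gamma> \<Longrightarrow> Z \<in> \<Gamma> \<Longrightarrow> Br X (Y + Z) = Br X Y + Br X Z"
  and Br_minus_left: "X \<in> \<Gamma> \<Longrightarrow> Y \<in> \<Gamma> \<Longrightarrow> Z \<in> \<Gamma> \<Longrightarrow> Br (X - Y) Z = Br X Z - Br Y Z"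
  by (simp_all add: bracket_def S_plus_left S_plus_right S_minus_left S_minus_right algebra_simps)

lemma Br_skew: "Br X Y = - Br Y X"
  by (simp add: bracket_def)

text \<open>This is the first Bianchi identity: the bracket is the commutator of \<open>S\<close>,
  and flatness rewrites each \<open>S\<close> along a bracket as a commutator, after which all terms
  cancel.\<close>

lemma Jacobi:
  assumes "X \<in> \<Gamma>" "Y \<in> \<Gamma>" "Z \<in> \<Gamma>"
  shows "Br X (Br Y Z) - Br Y (Br X Z) = Br (Br X Y) Z"
proof -
  have 1: "Br X (Br Y Z) = S X (S Y Z) - S X (S Z Y) - S (Br Y Z) X"
    using assms by (simp add: bracket_def[of S X] S_minus_right closed) (simp add: bracket_def S_minus_right closed)
  have 2: "Br Y (Br X Z) = S Y (S X Z) - S Y (S Z X) - S (Br X Z) Y"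
    using assms by (simp add: bracket_def[of S Y] S_minus_right closed) (simp add: bracket_def S_minus_right closed)
  have 3: "Br (Br X Y) Z = S (Br X Y) Z - (S Z (S X Y) - S Z (S Y X))"
    using assms by (simp add: bracket_def[of S "Br X Y"]) (simp add: bracket_def S_minus_right closed)
  show ?thesis
    unfolding 1 2 3 S_flat[OF assms, symmetric] S_flat[OF assms(2,3,1), symmetric]
      S_flat[OF assms(1,3,2), symmetric]
    by (simp add: algebra_simps)
qed

text \<open>
  Flatness of \<open>S\<close> forces the anchor to be a morphism at the points where the fibre is nonzero; at the
  other points the anchor vanishes.
\<close>

lemma D_bracket:
  assumes X: "X \<in> \<Gamma>" and Y: "Y \<in> \<Gamma>" and f: "f \<in> C"
  shows "D (Br X Y) f = D X (D Y f) - D Y (D X f)"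
proof
  fix x
  show "D (Br X Y) f x = (D X (D Y f) - D Y (D X f)) x"
  proof (cases "\<exists>u\<in>fibre A x. u \<noteq> 0")
    case True
    then obtain u where u: "u \<in> fibre A x" "u \<noteq> 0" by blast
    obtain Z where Z: "Z \<in> \<Gamma>" "Z x = u" using u(1) by (rule section_through)
    \<comment> \<open>The terms with one derivative of \<open>f\<close> are together symmetric in
      \<open>X\<close> and \<open>Y\<close>, so the commutator retains only the second
      derivatives.\<close>
    have "S X (S Y (smul f Z)) = smul f (S X (S Y Z)) + smul (D X f) (S Y Z) +
        (smul (D Y f) (S X Z) + smul (D X (D Y f)) Z)"
      if "X \<in> \<Gamma>" "Y \<in> \<Gamma>" for X Y
      using that Z f by (simp add: S_smul_right S_plus_right closed)
    note ex = this[OF X Y] this[OF Y X]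
    have "S (Br X Y) (smul f Z) = smul f (S (Br X Y) Z) + smul (D (Br X Y) f) Z"
      using X Y Z f by (intro S_smul_right closed)
    then have "smul f (S X (S Y Z) - S Y (S X Z)) + smul (D X (D Y f)) Z - smul (D Y (D X f)) Z =
        smul f (S (Br X Y) Z) + smul (D (Br X Y) f) Z"
      using S_flat[OF X Y sections_smul[OF f Z(1)]] unfolding ex
      by (simp add: fun_eq_iff fun_apply_simps algebra_simps)
    then have "smul (D X (D Y f) - D Y (D X f)) Z = smul (D (Br X Y) f) Z"
      unfolding S_flat[OF X Y Z(1)] by (simp add: fun_eq_iff fun_apply_simps algebra_simps)
    from fun_cong[OF this, of x] show ?thesis using Z u by (simp add: smul_def)
  next
    case False
    then have "X x = 0" "Y x = 0" "Br X Y x = 0"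
      using X Y Br_closed[OF X Y] section_fibre by blast+
    then show ?thesis by (simp add: anchor_deriv_def anchor_zero fun_apply_simps)
  qed
qed

text \<open>The derivative of \<open>f\<close> produced by \<open>D X\<close> on the pairing cancels
  the one from the Leibniz rule of \<open>S\<close>, so the right-hand side is linear over functions
  in \<open>Y\<close>.\<close>

lemma Sd_ex1:
  assumes X: "X \<in> \<Gamma>" and \<beta>: "\<beta> \<in> \<Gamma>d"
  shows "\<exists>!\<gamma>. \<gamma> \<in> \<Gamma>d \<and> (\<forall>Y\<in>\<Gamma>. pairing \<gamma> Y = D X (pairing \<beta> Y) - pairing \<beta> (S X Y))"
proof (rule dual_representation)
  fix Y assume Y: "Y \<in> \<Gamma>"
  show "D X (pairing \<beta> Y) - pairing \<beta> (S X Y) \<in> C"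
    by (intro closed X Y \<beta>)
  fix f x assume f: "f \<in> C"
  have "D X (pairing \<beta> (smul f Y)) - pairing \<beta> (S X (smul f Y)) =
      f * (D X (pairing \<beta> Y) - pairing \<beta> (S X Y))"
    using X Y \<beta> f
    by (simp add: pairing_smul S_smul_right pairing_plus closed D_times algebra_simps)
  then show "(D X (pairing \<beta> (\<lambda>x. f x *\<^sub>R Y x)) - pairing \<beta> (S X (\<lambda>x. f x *\<^sub>R Y x))) x =
      f x * (D X (pairing \<beta> Y) - pairing \<beta> (S X Y)) x"
    by (simp add: smul_def fun_eq_iff times_fun_apply)
next
  fix Y Z x assume "Y \<in> \<Gamma>" "Z \<in> \<Gamma>"
  then have "D X (pairing \<beta> (Y + Z)) - pairing \<beta> (S X (Y + Z)) =
      (D X (pairing \<beta> Y) - pairing \<beta> (S X Y)) + (D X (pairing \<beta> Z) - pairing \<beta> (S X Z))"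
    using X \<beta> by (simp add: pairing_plus S_plus_right closed D_plus algebra_simps)
  then show "(D X (pairing \<beta> (Y + Z)) - pairing \<beta> (S X (Y + Z))) x =
      (D X (pairing \<beta> Y) - pairing \<beta> (S X Y)) x + (D X (pairing \<beta> Z) - pairing \<beta> (S X Z)) x"
    by (simp add: plus_fun_apply)
qed

lemma
  assumes "X \<in> \<Gamma>" "\<beta> \<in> \<Gamma>d"
  shows Sd_closed: "Sd X \<beta> \<in> \<Gamma>d"
    and pairing_Sd: "Y \<in> \<Gamma> \<Longrightarrow> pairing (Sd X \<beta>) Y = D X (pairing \<beta> Y) - pairing \<beta> (S X Y)"
  using theI'[OF Sd_ex1[OF assms]] unfolding dual_product_def by blast+

lemma Sd_plus_left: "X \<in> \<Gamma> \<Longrightarrow> Y \<in> \<Gamma> \<Longrightarrow> \<beta> \<in> \<Gamma>d \<Longrightarrow> Sd (X + Y) \<beta> = Sd X \<beta> + Sd Y \<beta>"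
  by (rule dual_section_eqI)
    (simp_all add: Sd_closed closed pairing_Sd pairing_plus_left D_plus_left S_plus_left pairing_plus algebra_simps)

lemma Sd_plus_right: "X \<in> \<Gamma> \<Longrightarrow> \<beta> \<in> \<Gamma>d \<Longrightarrow> \<gamma> \<in> \<Gamma>d \<Longrightarrow> Sd X (\<beta> + \<gamma>) = Sd X \<beta> + Sd X \<gamma>"
  by (rule dual_section_eqI)
    (simp_all add: Sd_closed closed pairing_Sd pairing_plus_left D_plus algebra_simps)

lemma Sd_minus_right: "X \<in> \<Gamma> \<Longrightarrow> \<beta> \<in> \<Gamma>d \<Longrightarrow> \<gamma> \<in> \<Gamma>d \<Longrightarrow> Sd X (\<beta> - \<gamma>) = Sd X \<beta> - Sd X \<gamma>"
  by (rule dual_section_eqI)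
    (simp_all add: Sd_closed closed pairing_Sd pairing_minus_left D_minus algebra_simps)

lemma Sd_0_right: "X \<in> \<Gamma> \<Longrightarrow> Sd X 0 = 0"
  using Sd_plus_right[of X 0 0] dual.sections_0 by simp

lemma Sd_0_left: "\<beta> \<in> \<Gamma>d \<Longrightarrow> Sd 0 \<beta> = 0"
  using Sd_plus_left[of 0 0 \<beta>] sections_0 by simp

lemma Sd_smul_left: "f \<in> C \<Longrightarrow> X \<in> \<Gamma> \<Longrightarrow> \<beta> \<in> \<Gamma>d \<Longrightarrow> Sd (smul f X) \<beta> = smul f (Sd X \<beta>)"
  by (rule dual_section_eqI)
    (simp_all add: Sd_closed closed pairing_Sd pairing_smul_left D_smul_left S_smul_left pairing_smul algebra_simps)

lemma Sd_smul_right: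
  "f \<in> C \<Longrightarrow> X \<in> \<Gamma> \<Longrightarrow> \<beta> \<in> \<Gamma>d \<Longrightarrow> Sd X (smul f \<beta>) = smul f (Sd X \<beta>) + smul (D X f) \<beta>"
  by (rule dual_section_eqI)
    (simp_all add: Sd_closed closed pairing_Sd pairing_smul_left pairing_plus_left D_times algebra_simps)

text \<open>After pairing with a section, two facts remain: \<open>D_bracket\<close> for the
  derivatives of the pairing and \<open>S_flat\<close> for the terms inside it.\<close>

lemma Sd_flat:
  "X \<in> \<Gamma> \<Longrightarrow> Y \<in> \<Gamma> \<Longrightarrow> \<beta> \<in> \<Gamma>d \<Longrightarrow> Sd X (Sd Y \<beta>) - Sd Y (Sd X \<beta>) = Sd (Br X Y) \<beta>"
  by (rule dual_section_eqI)
    (simp_all add: Sd_closed closed pairing_Sd pairing_minus_left D_minus D_bracket pairing_minus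
      S_flat[symmetric] algebra_simps)

end


section \<open>The product defined by a tensor\<close>

locale lsa_tensor = lsa M A \<rho> S
  for M :: "('m::{t2_space, second_countable_topology}, 'e::real_inner) atlas"
    and A :: "('m, 'v::real_vector, 'f::real_inner) vbundle"
    and \<rho> :: "'m \<Rightarrow> 'v \<Rightarrow> ('m \<Rightarrow> real) \<Rightarrow> real"
    and S :: "('m \<Rightarrow> 'v) \<Rightarrow> ('m \<Rightarrow> 'v) \<Rightarrow> ('m \<Rightarrow> 'v)" +
  fixes r :: "'m \<Rightarrow> ('v \<Rightarrow> real) \<Rightarrow> ('v \<Rightarrow> real) \<Rightarrow> real"
  assumes tensor: "r \<in> tensor_sections M A"
begin

abbreviation (input) "R \<equiv> sharp_section A r"
abbreviation (input) "T \<equiv> tensor_product M A \<rho> S r"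
abbreviation (input) "Dl \<equiv> tensor_Delta M A \<rho> S r"
abbreviation (input) "Tbr \<equiv> bracket (tensor_product M A \<rho> S r)"

lemmas R_closed = sharp_section[OF tensor]

lemma R_plus: "\<alpha> \<in> \<Gamma>d \<Longrightarrow> \<beta> \<in> \<Gamma>d \<Longrightarrow> R (\<alpha> + \<beta>) = R \<alpha> + R \<beta>"
  by (rule ext)
    (simp add: sharp_section_def plus_fun_apply[of "\<lambda>x. sharp A r x (\<alpha> x)"] plus_fun_apply[of \<alpha>]
      sharp_add[OF tensor] dual_section_fibre)

lemma R_minus: "\<alpha> \<in> \<Gamma>d \<Longrightarrow> \<beta> \<in> \<Gamma>d \<Longrightarrow> R (\<alpha> - \<beta>) = R \<alpha> - R \<beta>"
  using R_plus[of "\<alpha> - \<beta>" \<beta>] dual.sections_diff[of \<alpha> \<beta>] by (simp add: algebra_simps)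

lemma R_smul: "\<alpha> \<in> \<Gamma>d \<Longrightarrow> R (smul f \<alpha>) = smul f (R \<alpha>)"
  by (rule ext) (simp add: sharp_section_def smul_def sharp_scaleR[OF tensor] dual_section_fibre)

lemma R_0: "R 0 = 0"
  using R_plus[of 0 0] dual.sections_0 by simp

text \<open>A closed formula for \<open>T\<^sup>*\<^sub>\<alpha> X\<close>.\<close>

definition "Tp \<alpha> X = Br (R \<alpha>) X + R (Sd X \<alpha>)"

lemma Tp_closed: "\<alpha> \<in> \<Gamma>d \<Longrightarrow> X \<in> \<Gamma> \<Longrightarrow> Tp \<alpha> X \<in> \<Gamma>"
  unfolding Tp_def by (intro closed R_closed Sd_closed)

lemma Tp_plus_left: "\<alpha> \<in> \<Gamma>d \<Longrightarrow> \<beta> \<in> \<Gamma>d \<Longrightarrow> X \<in> \<Gamma> \<Longrightarrow> Tp (\<alpha> + \<beta>) X = Tp \<alpha> X + Tp \<beta> X"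
  by (simp add: Tp_def R_plus Br_plus_left Sd_plus_right R_closed Sd_closed)

lemma Tp_plus_right: "\<alpha> \<in> \<Gamma>d \<Longrightarrow> X \<in> \<Gamma> \<Longrightarrow> Y \<in> \<Gamma> \<Longrightarrow> Tp \<alpha> (X + Y) = Tp \<alpha> X + Tp \<alpha> Y"
  by (simp add: Tp_def R_plus Br_plus_right Sd_plus_left R_closed Sd_closed)

text \<open>The bracket contributes \<open>R \<alpha>\<close> times minus the derivative of
  \<open>f\<close> along \<open>X\<close>, and the Leibniz rule of \<open>Sd X\<close> contributes
  its opposite.\<close>

lemma Tp_smul_left:
  "f \<in> C \<Longrightarrow> \<alpha> \<in> \<Gamma>d \<Longrightarrow> X \<in> \<Gamma> \<Longrightarrow> Tp (smul f \<alpha>) X = smul f (Tp \<alpha> X)"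
  by (simp add: Tp_def R_smul Sd_smul_right R_plus R_closed Sd_closed closed bracket_def
      S_smul_left S_smul_right)
    (simp add: fun_eq_iff fun_apply_simps algebra_simps)

lemma Tp_smul_right:
  assumes "f \<in> C" "\<alpha> \<in> \<Gamma>d" "X \<in> \<Gamma>"
  shows "Tp \<alpha> (smul f X) = smul f (Tp \<alpha> X) + smul (D (R \<alpha>) f) X"
  using assms
  by (simp add: Tp_def R_smul Sd_smul_left R_closed Sd_closed closed bracket_def S_smul_left S_smul_right)
    (simp add: fun_eq_iff fun_apply_simps algebra_simps)

lemma Tp_0_left: "X \<in> \<Gamma> \<Longrightarrow> Tp 0 X = 0"
  using Tp_plus_left[of 0 0 X] dual.sections_0 by simp

lemma Tp_0_right: "\<alpha> \<in> \<Gamma>d \<Longrightarrow> Tp \<alpha> 0 = 0"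
  using Tp_plus_right[of \<alpha> 0 0] sections_0 by simp

text \<open>The derivative of the tensor, seen as a map from the dual bundle to the bundle, is the
  commutator of r_# with differentiation along \<open>X\<close>.\<close>

lemma S_tensor_eq:
  assumes "X \<in> \<Gamma>" "\<alpha> \<in> \<Gamma>d" "\<beta> \<in> \<Gamma>d"
  shows "S_tensor M A \<rho> S X (on_sections r) \<alpha> \<beta> = pairing \<beta> (S X (R \<alpha>) - R (Sd X \<alpha>))"
  using assms
  by (simp add: S_tensor_def pairing_sharp_section[OF tensor, symmetric] Sd_closed R_closed closed
      pairing_Sd pairing_minus)

text \<open>The origin of the formula for \<open>Tp\<close>: the term
  \<open>S X (R \<alpha>)\<close> from the derivative of \<open>r\<close> and the term
  \<open>S (R \<alpha>) X\<close> from the dual product combine to a bracket.\<close>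

lemma tensor_product_rhs:
  assumes "X \<in> \<Gamma>" "\<alpha> \<in> \<Gamma>d" "\<beta> \<in> \<Gamma>d"
  shows "S_tensor M A \<rho> S X (on_sections r) \<alpha> \<beta> + pairing (Sd (R \<alpha>) \<beta>) X =
    D (R \<alpha>) (pairing \<beta> X) - pairing \<beta> (Tp \<alpha> X)"
  using assms
  by (simp add: S_tensor_eq Tp_def bracket_def pairing_Sd R_closed Sd_closed closed pairing_minus
      pairing_plus algebra_simps)

lemma T_ex1:
  assumes \<alpha>: "\<alpha> \<in> \<Gamma>d" and \<beta>: "\<beta> \<in> \<Gamma>d"
  shows "\<exists>!\<gamma>. \<gamma> \<in> \<Gamma>d \<and> (\<forall>X\<in>\<Gamma>. pairing \<gamma> X =
    S_tensor M A \<rho> S X (on_sections r) \<alpha> \<beta> + pairing (Sd (R \<alpha>) \<beta>) X)"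
proof -
  \<comment> \<open>Existence is shown for the version with \<open>Tp\<close>, where both Leibniz
    terms run along \<open>R \<alpha>\<close> and cancel; \<open>tensor_product_rhs\<close>
    transfers it to the definition.\<close>
  have "\<exists>!\<gamma>. \<gamma> \<in> \<Gamma>d \<and> (\<forall>X\<in>\<Gamma>. pairing \<gamma> X = D (R \<alpha>) (pairing \<beta> X) - pairing \<beta> (Tp \<alpha> X))"
  proof (rule dual_representation)
    fix X assume X: "X \<in> \<Gamma>"
    show "D (R \<alpha>) (pairing \<beta> X) - pairing \<beta> (Tp \<alpha> X) \<in> C"
      by (intro closed X \<alpha> \<beta> R_closed Tp_closed)
    fix f x assume f: "f \<in> C"
    have "D (R \<alpha>) (pairing \<beta> (smul f X)) - pairing \<beta> (Tp \<alpha> (smul f X)) =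
        f * (D (R \<alpha>) (pairing \<beta> X) - pairing \<beta> (Tp \<alpha> X))"
      using X \<alpha> \<beta> f
      by (simp add: pairing_smul Tp_smul_right pairing_plus closed R_closed Tp_closed D_times algebra_simps)
    then show "(D (R \<alpha>) (pairing \<beta> (\<lambda>x. f x *\<^sub>R X x)) - pairing \<beta> (Tp \<alpha> (\<lambda>x. f x *\<^sub>R X x))) x =
        f x * (D (R \<alpha>) (pairing \<beta> X) - pairing \<beta> (Tp \<alpha> X)) x"
      by (simp add: smul_def fun_eq_iff times_fun_apply)
  next
    fix X Y x assume "X \<in> \<Gamma>" "Y \<in> \<Gamma>"
    then have "D (R \<alpha>) (pairing \<beta> (X + Y)) - pairing \<beta> (Tp \<alpha> (X + Y)) =
        (D (R \<alpha>) (pairing \<beta> X) - pairing \<beta> (Tp \<alpha> X)) + (D (R \<alpha>) (pairing \<beta> Y) - pairing \<beta> (Tp \<alpha> Y))"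
      using \<alpha> \<beta> by (simp add: pairing_plus Tp_plus_right Tp_closed R_closed closed D_plus algebra_simps)
    then show "(D (R \<alpha>) (pairing \<beta> (X + Y)) - pairing \<beta> (Tp \<alpha> (X + Y))) x =
        (D (R \<alpha>) (pairing \<beta> X) - pairing \<beta> (Tp \<alpha> X)) x + (D (R \<alpha>) (pairing \<beta> Y) - pairing \<beta> (Tp \<alpha> Y)) x"
      by (simp add: plus_fun_apply)
  qed
  then show ?thesis using assms by (simp add: tensor_product_rhs cong: conj_cong)
qed

lemma
  assumes "\<alpha> \<in> \<Gamma>d" "\<beta> \<in> \<Gamma>d"
  shows T_closed: "T \<alpha> \<beta> \<in> \<Gamma>d"
    and pairing_T: "X \<in> \<Gamma> \<Longrightarrow> pairing (T \<alpha> \<beta>) X = D (R \<alpha>) (pairing \<beta> X) - pairing \<beta> (Tp \<alpha> X)"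
  using theI'[OF T_ex1[OF assms]] tensor_product_rhs[OF _ assms] unfolding tensor_product_def by auto

lemma T_plus_left: "\<alpha> \<in> \<Gamma>d \<Longrightarrow> \<beta> \<in> \<Gamma>d \<Longrightarrow> \<gamma> \<in> \<Gamma>d \<Longrightarrow> T (\<alpha> + \<beta>) \<gamma> = T \<alpha> \<gamma> + T \<beta> \<gamma>"
  by (rule dual_section_eqI)
    (simp_all add: T_closed R_closed Tp_closed closed pairing_T pairing_plus_left R_plus Tp_plus_left
      pairing_plus D_plus_left algebra_simps)

lemma T_plus_right: "\<alpha> \<in> \<Gamma>d \<Longrightarrow> \<beta> \<in> \<Gamma>d \<Longrightarrow> \<gamma> \<in> \<Gamma>d \<Longrightarrow> T \<alpha> (\<beta> + \<gamma>) = T \<alpha> \<beta> + T \<alpha> \<gamma>"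
  by (rule dual_section_eqI)
    (simp_all add: T_closed R_closed Tp_closed closed pairing_T pairing_plus_left D_plus algebra_simps)

lemma T_minus_left: "\<alpha> \<in> \<Gamma>d \<Longrightarrow> \<beta> \<in> \<Gamma>d \<Longrightarrow> \<gamma> \<in> \<Gamma>d \<Longrightarrow> T (\<alpha> - \<beta>) \<gamma> = T \<alpha> \<gamma> - T \<beta> \<gamma>"
  using T_plus_left[of "\<alpha> - \<beta>" \<beta> \<gamma>] dual.sections_diff[of \<alpha> \<beta>] by (simp add: algebra_simps)

lemma T_0_left: "\<alpha> \<in> \<Gamma>d \<Longrightarrow> T 0 \<alpha> = 0"
  using T_plus_left[of 0 0 \<alpha>] dual.sections_0 by simp

lemma T_0_right: "\<alpha> \<in> \<Gamma>d \<Longrightarrow> T \<alpha> 0 = 0"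
  using T_plus_right[of \<alpha> 0 0] dual.sections_0 by simp

lemma T_uminus_left: "\<alpha> \<in> \<Gamma>d \<Longrightarrow> \<beta> \<in> \<Gamma>d \<Longrightarrow> T (- \<alpha>) \<beta> = - T \<alpha> \<beta>"
  using T_minus_left[of 0 \<alpha> \<beta>] dual.sections_0 by (simp add: T_0_left)

lemma T_smul_left: "f \<in> C \<Longrightarrow> \<alpha> \<in> \<Gamma>d \<Longrightarrow> \<beta> \<in> \<Gamma>d \<Longrightarrow> T (smul f \<alpha>) \<beta> = smul f (T \<alpha> \<beta>)"
  by (rule dual_section_eqI)
    (simp_all add: T_closed R_closed Tp_closed closed pairing_T pairing_smul_left R_smul D_smul_left
      Tp_smul_left pairing_smul algebra_simps)

lemma T_smul_right:
  "f \<in> C \<Longrightarrow> \<alpha> \<in> \<Gamma>d \<Longrightarrow> \<beta> \<in> \<Gamma>d \<Longrightarrow> T \<alpha> (smul f \<beta>) = smul f (T \<alpha> \<beta>) + smul (D (R \<alpha>) f) \<beta>"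
  by (rule dual_section_eqI)
    (simp_all add: T_closed R_closed Tp_closed closed pairing_T pairing_smul_left pairing_plus_left
      D_times algebra_simps)

section \<open>\<open>T\<close> as a right-anchored product and the identification of its
  dual\<close>

lemma tensor_anchor_deriv: "anchor_deriv (tensor_anchor A \<rho> r) \<alpha> = D (R \<alpha>)"
  by (intro ext) (simp add: anchor_deriv_def tensor_anchor_def sharp_section_def)

lemma right_anchored_T: "right_anchored_product M (dual_bundle A) (tensor_anchor A \<rho> r) T"
proof -
  have const: "T (k *\<^sub>R \<alpha>) \<beta> = k *\<^sub>R T \<alpha> \<beta>" "T \<alpha> (k *\<^sub>R \<beta>) = k *\<^sub>R T \<alpha> \<beta>"
    if "\<alpha> \<in> \<Gamma>d" "\<beta> \<in> \<Gamma>d" for \<alpha> \<beta> k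
  proof -
    \<comment> \<open>Real scalars are treated as constant functions, which tangent vectors
      annihilate.\<close>
    have smul: "k *\<^sub>R \<gamma> = smul (\<lambda>x. k) \<gamma>" for \<gamma> :: "'m \<Rightarrow> 'v \<Rightarrow> real"
      by (simp add: smul_def scaleR_fun_def)
    show "T (k *\<^sub>R \<alpha>) \<beta> = k *\<^sub>R T \<alpha> \<beta>"
      unfolding smul using that by (intro T_smul_left smooth_functions_const)
    have "D (R \<alpha>) (\<lambda>x. k) = 0"
      using tangent_const[OF anchor_tangent[OF section_fibre[OF R_closed[OF that(1)]]]]
      by (auto simp: anchor_deriv_def zero_fun_apply)
    moreover have "smul 0 \<beta> = 0" by (auto simp: smul_def zero_fun_apply)
    ultimately show "T \<alpha> (k *\<^sub>R \<beta>) = k *\<^sub>R T \<alpha> \<beta>"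
      unfolding smul using T_smul_right[OF smooth_functions_const that, of k] by simp
  qed
  have "T (\<lambda>x. f x *\<^sub>R \<alpha> x) \<beta> = (\<lambda>x. f x *\<^sub>R T \<alpha> \<beta> x)"
    "T \<alpha> (\<lambda>x. f x *\<^sub>R \<beta> x) = (\<lambda>x. f x *\<^sub>R T \<alpha> \<beta> x + D (R \<alpha>) f x *\<^sub>R \<beta> x)"
    if "\<alpha> \<in> \<Gamma>d" "\<beta> \<in> \<Gamma>d" "f \<in> C" for \<alpha> \<beta> f
    using T_smul_left[OF that(3,1,2)] T_smul_right[OF that(3,1,2)] by (simp_all add: smul_def plus_fun_def)
  then show ?thesis
    unfolding right_anchored_product_def tensor_anchor_deriv
    by (simp add: T_closed T_plus_left T_plus_right const)
qed

lemma anchored_dual: "anchored_vector_bundle M (dual_bundle A) (tensor_anchor A \<rho> r)"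
  unfolding anchored_vector_bundle_def
  by (intro conjI smooth_manifold vector_bundle_dual bundle_map_tensor_anchor[OF tensor])

text \<open>Solving \<open>pairing_T\<close> for the pairing with \<open>Tp \<alpha> X\<close> gives
  the condition under \<open>THE\<close>, and dual sections separate sections.\<close>

lemma predual_eq:
  assumes "\<alpha> \<in> \<Gamma>d" "X \<in> \<Gamma>"
  shows "predual_product M A (tensor_anchor A \<rho> r) T \<alpha> X = Tp \<alpha> X"
  unfolding predual_product_def tensor_anchor_deriv
proof (rule the_equality)
  show *: "Tp \<alpha> X \<in> \<Gamma> \<and>
      (\<forall>\<beta>\<in>\<Gamma>d. pairing \<beta> (Tp \<alpha> X) = D (R \<alpha>) (pairing \<beta> X) - pairing (T \<alpha> \<beta>) X)"
    using assms by (simp add: Tp_closed pairing_T)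
  show "Z = Tp \<alpha> X" if "Z \<in> \<Gamma> \<and>
      (\<forall>\<beta>\<in>\<Gamma>d. pairing \<beta> Z = D (R \<alpha>) (pairing \<beta> X) - pairing (T \<alpha> \<beta>) X)" for Z
    using that * by (intro section_eqI) auto
qed

subsection \<open>Compatibility\<close>

abbreviation (input) "N \<equiv> double_product M A \<rho> S (tensor_anchor A \<rho> r) T"

lemma N_sum_section:
  "X \<in> \<Gamma> \<Longrightarrow> \<alpha> \<in> \<Gamma>d \<Longrightarrow> Y \<in> \<Gamma> \<Longrightarrow> \<beta> \<in> \<Gamma>d \<Longrightarrow>
    N (sum_section X \<alpha>) (sum_section Y \<beta>) = sum_section (S X Y + Tp \<alpha> Y) (Sd X \<beta> + T \<alpha> \<beta>)"
  by (simp add: double_product_def sum_section_def o_def predual_eq)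

lemma sum_section_minus: "sum_section X \<alpha> - sum_section Y \<beta> = sum_section (X - Y) (\<alpha> - \<beta>)"
  by (auto simp: sum_section_def minus_apply)

lemma sum_section_eq_iff: "sum_section X \<alpha> = sum_section Y \<beta> \<longleftrightarrow> X = Y \<and> \<alpha> = \<beta>"
  by (auto simp: sum_section_def fun_eq_iff)

lemmas product_simps = S_closed Tp_closed Sd_closed T_closed closed R_closed
  S_0_left S_0_right Tp_0_left Tp_0_right Sd_0_left Sd_0_right T_0_left T_0_right

lemma N_section_left:
  assumes "X \<in> \<Gamma>" "\<alpha> \<in> \<Gamma>d" "Y \<in> \<Gamma>"
  shows "N (sum_section X \<alpha>) (sum_section Y 0) = sum_section (S X Y + Tp \<alpha> Y) 0"
  by (simp add: N_sum_section[OF assms dual.sections_0] Sd_0_right[OF assms(1)] T_0_right[OF assms(2)])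

lemma N_section_right:
  assumes "X \<in> \<Gamma>" "\<alpha> \<in> \<Gamma>d" "\<beta> \<in> \<Gamma>d"
  shows "N (sum_section X \<alpha>) (sum_section 0 \<beta>) = sum_section 0 (Sd X \<beta> + T \<alpha> \<beta>)"
  by (simp add: N_sum_section[OF assms(1,2) sections_0 assms(3)] S_0_right[OF assms(1)]
      Tp_0_right[OF assms(2)])

text \<open>\<open>N\<close> preserves both summands in its second argument, so each mixed curvature
  has a single component. The bracket of \<open>X\<close> and \<open>\<alpha>\<close> has components
  in both, whence the last two terms.\<close>

lemma curvature_N_mixed:
  assumes X: "X \<in> \<Gamma>" and Y: "Y \<in> \<Gamma>" and \<alpha>: "\<alpha> \<in> \<Gamma>d" and \<beta>: "\<beta> \<in> \<Gamma>d"
  shows "curvature N (sum_section X 0) (sum_section 0 \<alpha>) (sum_section Y 0) =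
      sum_section (S X (Tp \<alpha> Y) - Tp \<alpha> (S X Y) + S (Tp \<alpha> X) Y - Tp (Sd X \<alpha>) Y) 0"
    and "curvature N (sum_section 0 \<alpha>) (sum_section X 0) (sum_section 0 \<beta>) =
      sum_section 0 (T \<alpha> (Sd X \<beta>) - Sd X (T \<alpha> \<beta>) - Sd (Tp \<alpha> X) \<beta> + T (Sd X \<alpha>) \<beta>)"
proof -
  note zero = sections_0 dual.sections_0
  have i: "N (sum_section Z 0) (sum_section W 0) = sum_section (S Z W) 0"
    if "Z \<in> \<Gamma>" "W \<in> \<Gamma>" for Z W
    using N_section_left[OF that(1) zero(2) that(2)] Tp_0_left[OF that(2)] by simp
  have j: "N (sum_section 0 \<gamma>) (sum_section 0 \<delta>) = sum_section 0 (T \<gamma> \<delta>)"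
    if "\<gamma> \<in> \<Gamma>d" "\<delta> \<in> \<Gamma>d" for \<gamma> \<delta>
    using N_section_right[OF zero(1) that] Sd_0_left[OF that(2)] by simp
  have ij: "N (sum_section Z 0) (sum_section 0 \<gamma>) = sum_section 0 (Sd Z \<gamma>)"
    and ji: "N (sum_section 0 \<gamma>) (sum_section Z 0) = sum_section (Tp \<gamma> Z) 0"
    if "Z \<in> \<Gamma>" "\<gamma> \<in> \<Gamma>d" for Z \<gamma>
    using N_section_right[OF that(1) zero(2) that(2)] N_section_left[OF zero(1) that(2,1)]
      T_0_left[OF that(2)] S_0_left[OF that(1)] by simp_all
  note closed' = Tp_closed[OF \<alpha> X] Sd_closed[OF X \<alpha>]
  have ij_bracket: "bracket N (sum_section X 0) (sum_section 0 \<alpha>) = sum_section (- Tp \<alpha> X) (Sd X \<alpha>)"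
    and ji_bracket: "bracket N (sum_section 0 \<alpha>) (sum_section X 0) = sum_section (Tp \<alpha> X) (- Sd X \<alpha>)"
    by (simp_all add: bracket_def ij[OF X \<alpha>] ji[OF X \<alpha>] sum_section_minus)
  show "curvature N (sum_section X 0) (sum_section 0 \<alpha>) (sum_section Y 0) =
      sum_section (S X (Tp \<alpha> Y) - Tp \<alpha> (S X Y) + S (Tp \<alpha> X) Y - Tp (Sd X \<alpha>) Y) 0"
    unfolding curvature_def ij_bracket ji[OF Y \<alpha>] i[OF X Y] i[OF X Tp_closed[OF \<alpha> Y]]
      ji[OF S_closed[OF X Y] \<alpha>] N_section_left[OF sections_uminus[OF closed'(1)] closed'(2) Y]
      sum_section_minus S_uminus_left[OF closed'(1) Y]
    by (simp add: algebra_simps)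
  show "curvature N (sum_section 0 \<alpha>) (sum_section X 0) (sum_section 0 \<beta>) =
      sum_section 0 (T \<alpha> (Sd X \<beta>) - Sd X (T \<alpha> \<beta>) - Sd (Tp \<alpha> X) \<beta> + T (Sd X \<alpha>) \<beta>)"
    unfolding curvature_def ji_bracket ij[OF X \<beta>] j[OF \<alpha> \<beta>] j[OF \<alpha> Sd_closed[OF X \<beta>]]
      ij[OF X T_closed[OF \<alpha> \<beta>]] N_section_right[OF closed'(1) dual.sections_uminus[OF closed'(2)] \<beta>]
      sum_section_minus T_uminus_left[OF closed'(2) \<beta>]
    by (simp add: algebra_simps)
qed

text \<open>In the difference of the two sides each \<open>S\<close> meets its transpose, so that
  only brackets survive; expanded, it is an identity about the bracket and the dual product
  alone.\<close>

lemma first_compatibility: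
  assumes X: "X \<in> \<Gamma>" and Y: "Y \<in> \<Gamma>" and \<alpha>: "\<alpha> \<in> \<Gamma>d"
  shows "S X (Tp \<alpha> Y) - Tp \<alpha> (S X Y) + S (Tp \<alpha> X) Y - Tp (Sd X \<alpha>) Y =
    S Y (Tp \<alpha> X) - Tp \<alpha> (S Y X) + S (Tp \<alpha> Y) X - Tp (Sd Y \<alpha>) X"
proof -
  note R = R_closed[OF \<alpha>]
  have Tp_Br: "Tp \<alpha> (Br X Y) = Tp \<alpha> (S X Y) - Tp \<alpha> (S Y X)"
    using Tp_plus_right[OF \<alpha> Br_closed[OF X Y] S_closed[OF Y X]] by (simp add: bracket_def)
  \<comment> \<open>The groups are a Jacobi expression in \<open>R \<alpha>\<close>,
    \<open>X\<close>, \<open>Y\<close>, then \<open>R\<close> applied to the curvature of the dual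
    product, then two pairs of opposite brackets.\<close>
  have expand: "Br X (Tp \<alpha> Y) - Br Y (Tp \<alpha> X) - Tp \<alpha> (Br X Y) - Tp (Sd X \<alpha>) Y + Tp (Sd Y \<alpha>) X =
      (Br X (Br (R \<alpha>) Y) - Br Y (Br (R \<alpha>) X) - Br (R \<alpha>) (Br X Y)) +
      R (Sd X (Sd Y \<alpha>) - Sd Y (Sd X \<alpha>) - Sd (Br X Y) \<alpha>) +
      (Br X (R (Sd Y \<alpha>)) + Br (R (Sd Y \<alpha>)) X) - (Br Y (R (Sd X \<alpha>)) + Br (R (Sd X \<alpha>)) Y)"
    using X Y \<alpha> R by (simp add: Tp_def Br_plus_right R_minus R_plus product_simps algebra_simps)
  have jacobi: "Br X (Br (R \<alpha>) Y) - Br Y (Br (R \<alpha>) X) - Br (R \<alpha>) (Br X Y) = 0"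
    using Jacobi[OF R X Y] Br_skew[of Y "Br (R \<alpha>) X"] by (simp add: algebra_simps)
  have flat: "Sd X (Sd Y \<alpha>) - Sd Y (Sd X \<alpha>) - Sd (Br X Y) \<alpha> = 0"
    using Sd_flat[OF X Y \<alpha>] by simp
  have "Br X (Tp \<alpha> Y) - Br Y (Tp \<alpha> X) - Tp \<alpha> (Br X Y) - Tp (Sd X \<alpha>) Y + Tp (Sd Y \<alpha>) X = 0"
    unfolding expand jacobi flat
    using Br_skew[of X "R (Sd Y \<alpha>)"] Br_skew[of Y "R (Sd X \<alpha>)"] by (simp add: R_0)
  then show ?thesis unfolding Tp_Br unfolding bracket_def by (simp add: algebra_simps)
qed

text \<open>The K of the overview: the dual component of the second compatibility condition, left
  side minus right side.\<close>

definition "compat_defect \<alpha> \<beta> X =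
  (T \<alpha> (Sd X \<beta>) - Sd X (T \<alpha> \<beta>) - Sd (Tp \<alpha> X) \<beta> + T (Sd X \<alpha>) \<beta>) -
  (T \<beta> (Sd X \<alpha>) - Sd X (T \<beta> \<alpha>) - Sd (Tp \<beta> X) \<alpha> + T (Sd X \<beta>) \<alpha>)"

lemma compatible_iff:
  "compatible M A \<rho> S (tensor_anchor A \<rho> r) T \<longleftrightarrow>
    (\<forall>X\<in>\<Gamma>. \<forall>\<alpha>\<in>\<Gamma>d. \<forall>\<beta>\<in>\<Gamma>d. compat_defect \<alpha> \<beta> X = 0)"
proof -
  have "curvature N (sum_section X 0) (sum_section 0 \<alpha>) (sum_section Y 0) =
      curvature N (sum_section Y 0) (sum_section 0 \<alpha>) (sum_section X 0)"
    if "X \<in> \<Gamma>" "Y \<in> \<Gamma>" "\<alpha> \<in> \<Gamma>d" for X Y \<alpha>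
    using curvature_N_mixed(1)[OF that(1,2,3,3)] curvature_N_mixed(1)[OF that(2,1,3,3)]
      first_compatibility[OF that] by simp
  moreover have "curvature N (sum_section 0 \<alpha>) (sum_section X 0) (sum_section 0 \<beta>) =
      curvature N (sum_section 0 \<beta>) (sum_section X 0) (sum_section 0 \<alpha>) \<longleftrightarrow> compat_defect \<alpha> \<beta> X = 0"
    if "X \<in> \<Gamma>" "\<alpha> \<in> \<Gamma>d" "\<beta> \<in> \<Gamma>d" for X \<alpha> \<beta>
    using curvature_N_mixed(2)[OF that(1,1,2,3)] curvature_N_mixed(2)[OF that(1,1,3,2)]
    by (simp add: sum_section_eq_iff compat_defect_def)
  ultimately show ?thesis unfolding compatible_def Let_def by auto
qed

text \<open>\<open>\<prec>skew_bracket \<alpha> \<beta>, X\<succ> = 2 (S\<^sub>X \<aa>)(\<alpha>, \<beta>)\<close>, where \<open>\<aa>\<close> is the skew part of the tensor.\<close>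

definition "skew_bracket \<alpha> \<beta> = Tbr \<alpha> \<beta> - Sd (R \<alpha>) \<beta> + Sd (R \<beta>) \<alpha>"

lemma Tbr_closed: "\<alpha> \<in> \<Gamma>d \<Longrightarrow> \<beta> \<in> \<Gamma>d \<Longrightarrow> Tbr \<alpha> \<beta> \<in> \<Gamma>d"
  by (simp add: bracket_def T_closed closed)

lemma skew_bracket_closed: "\<alpha> \<in> \<Gamma>d \<Longrightarrow> \<beta> \<in> \<Gamma>d \<Longrightarrow> skew_bracket \<alpha> \<beta> \<in> \<Gamma>d"
  by (simp add: skew_bracket_def Tbr_closed product_simps)

lemma pairing_skew_bracket:
  assumes "\<alpha> \<in> \<Gamma>d" "\<beta> \<in> \<Gamma>d" "X \<in> \<Gamma>"
  shows "pairing (skew_bracket \<alpha> \<beta>) X =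
    S_tensor M A \<rho> S X (on_sections r) \<alpha> \<beta> - S_tensor M A \<rho> S X (on_sections r) \<beta> \<alpha>"
  using assms
  by (simp add: skew_bracket_def bracket_def[of T] pairing_plus_left pairing_minus_left S_tensor_eq pairing_T
      pairing_Sd Tp_def bracket_def[of S] pairing_minus pairing_plus product_simps algebra_simps)

text \<open>Flatness of the dual product resolves the bracket inside \<open>Tp\<close>, and the
  terms regroup as minus the derivative along \<open>X\<close> of \<open>skew_bracket\<close>,
  viewed as a bilinear map with values in the dual bundle.\<close>

lemma compat_defect_eq_skew_bracket:
  assumes X: "X \<in> \<Gamma>" and \<alpha>: "\<alpha> \<in> \<Gamma>d" and \<beta>: "\<beta> \<in> \<Gamma>d"
  shows "compat_defect \<alpha> \<beta> X = skew_bracket \<alpha> (Sd X \<beta>) + skew_bracket (Sd X \<alpha>) \<beta> - Sd X (skew_bracket \<alpha> \<beta>)"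
proof -
  note R = R_closed[OF \<alpha>] R_closed[OF \<beta>]
  have 1: "Sd X (skew_bracket \<alpha> \<beta>) = Sd X (T \<alpha> \<beta>) - Sd X (T \<beta> \<alpha>) - Sd X (Sd (R \<alpha>) \<beta>) + Sd X (Sd (R \<beta>) \<alpha>)"
    using X \<alpha> \<beta> by (simp add: skew_bracket_def bracket_def Sd_plus_right Sd_minus_right product_simps)
  have 2: "Sd (Tp \<alpha> X) \<beta> = Sd (R \<alpha>) (Sd X \<beta>) - Sd X (Sd (R \<alpha>) \<beta>) + Sd (R (Sd X \<alpha>)) \<beta>"
    using X \<alpha> \<beta> R by (simp add: Tp_def Sd_plus_left Sd_flat product_simps)
  have 3: "Sd (Tp \<beta> X) \<alpha> = Sd (R \<beta>) (Sd X \<alpha>) - Sd X (Sd (R \<beta>) \<alpha>) + Sd (R (Sd X \<beta>)) \<alpha>"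
    using X \<alpha> \<beta> R by (simp add: Tp_def Sd_plus_left Sd_flat product_simps)
  show ?thesis unfolding compat_defect_def 1 2 3 unfolding skew_bracket_def bracket_def by (simp add: algebra_simps)
qed

text \<open>Only the antisymmetrised tensor enters \<open>skew_bracket\<close>, so the symmetric
  part cancels. Pairing with \<open>Y\<close> differentiates the tensor along \<open>Y\<close>; the
  outer derivative along \<open>X\<close> also acts on that \<open>Y\<close>, and this produces the
  correction along \<open>S X Y\<close> in \<open>S2_tensor\<close>.\<close>

lemma compat_defect_eq_S2:
  assumes a: "\<aa> \<in> tensor_sections M A" and skew: "skew_tensor A \<aa>"
    and s: "symmetric_tensor A \<ss>" and r: "r = \<aa> + \<ss>"
    and X: "X \<in> \<Gamma>" and Y: "Y \<in> \<Gamma>" and \<alpha>: "\<alpha> \<in> \<Gamma>d" and \<beta>: "\<beta> \<in> \<Gamma>d"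
  shows "pairing (compat_defect \<alpha> \<beta> X) Y = - (2 * S2_tensor M A \<rho> S X Y (on_sections \<aa>) \<alpha> \<beta>)"
proof -
  let ?q = "\<lambda>X. S_tensor M A \<rho> S X (on_sections \<aa>)"
  \<comment> \<open>The doubled tensor is written as a sum, so that \<open>D_plus\<close> and
    \<open>D_minus\<close> differentiate everything.\<close>
  have skew_part: "on_sections r \<alpha> \<beta> - on_sections r \<beta> \<alpha> = on_sections \<aa> \<alpha> \<beta> + on_sections \<aa> \<alpha> \<beta>"
    if "\<alpha> \<in> \<Gamma>d" "\<beta> \<in> \<Gamma>d" for \<alpha> \<beta>
  proof
    fix x
    have "\<aa> x (\<alpha> x) (\<beta> x) = - \<aa> x (\<beta> x) (\<alpha> x)" "\<ss> x (\<alpha> x) (\<beta> x) = \<ss> x (\<beta> x) (\<alpha> x)"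
      using skew s that dual_section_fibre unfolding skew_tensor_def symmetric_tensor_def by blast+
    then show "(on_sections r \<alpha> \<beta> - on_sections r \<beta> \<alpha>) x = (on_sections \<aa> \<alpha> \<beta> + on_sections \<aa> \<alpha> \<beta>) x"
      by (simp add: on_sections_def r fun_apply_simps)
  qed
  have q: "S_tensor M A \<rho> S Y (on_sections r) \<alpha> \<beta> - S_tensor M A \<rho> S Y (on_sections r) \<beta> \<alpha> =
      ?q Y \<alpha> \<beta> + ?q Y \<alpha> \<beta>" if "Y \<in> \<Gamma>" "\<alpha> \<in> \<Gamma>d" "\<beta> \<in> \<Gamma>d" for Y \<alpha> \<beta>
  proof -
    have "D Y (on_sections r \<alpha> \<beta>) - D Y (on_sections r \<beta> \<alpha>) =
        D Y (on_sections \<aa> \<alpha> \<beta>) + D Y (on_sections \<aa> \<alpha> \<beta>)"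
      using that on_sections_smooth[OF tensor] on_sections_smooth[OF a]
      by (simp add: D_plus[symmetric] D_minus[symmetric] skew_part)
    with skew_part[OF Sd_closed[OF that(1,2)] that(3)] skew_part[OF that(2) Sd_closed[OF that(1,3)]]
    show ?thesis unfolding S_tensor_def by (simp add: algebra_simps)
  qed
  have smooth: "?q Y \<alpha> \<beta> \<in> C" if "Y \<in> \<Gamma>" "\<alpha> \<in> \<Gamma>d" "\<beta> \<in> \<Gamma>d" for Y \<alpha> \<beta>
    unfolding S_tensor_def using that by (intro closed on_sections_smooth[OF a] Sd_closed)
  have "pairing (compat_defect \<alpha> \<beta> X) Y =
      (?q Y \<alpha> (Sd X \<beta>) + ?q Y \<alpha> (Sd X \<beta>)) + (?q Y (Sd X \<alpha>) \<beta> + ?q Y (Sd X \<alpha>) \<beta>) -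
      (D X (?q Y \<alpha> \<beta> + ?q Y \<alpha> \<beta>) - (?q (S X Y) \<alpha> \<beta> + ?q (S X Y) \<alpha> \<beta>))"
    using X Y \<alpha> \<beta>
    by (simp add: compat_defect_eq_skew_bracket pairing_plus_left pairing_minus_left pairing_Sd pairing_skew_bracket skew_bracket_closed q product_simps)
  also have "\<dots> = - (2 * S2_tensor M A \<rho> S X Y (on_sections \<aa>) \<alpha> \<beta>)"
    unfolding S2_tensor_def S_tensor_def[of _ _ _ _ X] D_plus[OF X smooth[OF Y \<alpha> \<beta>] smooth[OF Y \<alpha> \<beta>]]
    by (simp add: algebra_simps)
  finally show ?thesis .
qed

subsection \<open>Flatness\<close>

lemma Dl_eq: "Dl \<alpha> \<beta> = R (Tbr \<alpha> \<beta>) - Br (R \<alpha>) (R \<beta>)"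
  by (simp add: tensor_Delta_def)

lemma Dl_closed: "\<alpha> \<in> \<Gamma>d \<Longrightarrow> \<beta> \<in> \<Gamma>d \<Longrightarrow> Dl \<alpha> \<beta> \<in> \<Gamma>"
  by (simp add: Dl_eq Tbr_closed product_simps)

definition "Delta_defect \<alpha> \<beta> X = Br X (Dl \<alpha> \<beta>) - Dl (Sd X \<alpha>) \<beta> - Dl \<alpha> (Sd X \<beta>)"

lemma Delta_defect_closed: "\<alpha> \<in> \<Gamma>d \<Longrightarrow> \<beta> \<in> \<Gamma>d \<Longrightarrow> X \<in> \<Gamma> \<Longrightarrow> Delta_defect \<alpha> \<beta> X \<in> \<Gamma>"
  by (simp add: Delta_defect_def Dl_closed product_simps)

lemma compat_defect_closed: "\<alpha> \<in> \<Gamma>d \<Longrightarrow> \<beta> \<in> \<Gamma>d \<Longrightarrow> X \<in> \<Gamma> \<Longrightarrow> compat_defect \<alpha> \<beta> X \<in> \<Gamma>d"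
  by (simp add: compat_defect_def product_simps)

text \<open>Splitting \<open>R (Tbr \<alpha> \<beta>)\<close> into
  \<open>Dl \<alpha> \<beta>\<close> and the bracket of \<open>R \<alpha>\<close> and
  \<open>R \<beta>\<close> lets Jacobi remove the double brackets. The same splitting of the
  brackets with \<open>R (Sd X \<alpha>)\<close> and \<open>R (Sd X \<beta>)\<close> supplies the
  images of \<open>T\<close>-brackets that complete the terms under \<open>R\<close> to
  \<open>compat_defect\<close>.\<close>

lemma curvature_Tp:
  assumes \<alpha>: "\<alpha> \<in> \<Gamma>d" and \<beta>: "\<beta> \<in> \<Gamma>d" and X: "X \<in> \<Gamma>"
  shows "Tp \<alpha> (Tp \<beta> X) - Tp \<beta> (Tp \<alpha> X) - Tp (Tbr \<alpha> \<beta>) X = Delta_defect \<alpha> \<beta> X + R (compat_defect \<alpha> \<beta> X)"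
proof -
  note R = R_closed[OF \<alpha>] R_closed[OF \<beta>]
  have 1: "Tp \<alpha> (Tp \<beta> X) = Br (R \<alpha>) (Br (R \<beta>) X) + Br (R \<alpha>) (R (Sd X \<beta>)) + R (Sd (Tp \<beta> X) \<alpha>)"
    using \<alpha> \<beta> X R by (simp add: Tp_def[of \<alpha>] Tp_closed) (simp add: Tp_def Br_plus_right product_simps)
  have 2: "Tp \<beta> (Tp \<alpha> X) = Br (R \<beta>) (Br (R \<alpha>) X) + Br (R \<beta>) (R (Sd X \<alpha>)) + R (Sd (Tp \<alpha> X) \<beta>)"
    using \<alpha> \<beta> X R by (simp add: Tp_def[of \<beta>] Tp_closed) (simp add: Tp_def Br_plus_right product_simps)
  have 3: "Tp (Tbr \<alpha> \<beta>) X = Br (Dl \<alpha> \<beta>) X + Br (Br (R \<alpha>) (R \<beta>)) X + R (Sd X (Tbr \<alpha> \<beta>))"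
    using \<alpha> \<beta> X R by (simp add: Tp_def Dl_eq Br_minus_left Tbr_closed product_simps)
  have 4: "R (compat_defect \<alpha> \<beta> X) = R (Tbr \<alpha> (Sd X \<beta>)) + R (Tbr (Sd X \<alpha>) \<beta>) - R (Sd X (Tbr \<alpha> \<beta>)) -
      R (Sd (Tp \<alpha> X) \<beta>) + R (Sd (Tp \<beta> X) \<alpha>)"
    using \<alpha> \<beta> X by (simp add: compat_defect_def bracket_def R_plus R_minus Sd_minus_right product_simps algebra_simps)
  have 5: "Delta_defect \<alpha> \<beta> X = Br X (Dl \<alpha> \<beta>) - (R (Tbr (Sd X \<alpha>) \<beta>) - Br (R (Sd X \<alpha>)) (R \<beta>)) -
      (R (Tbr \<alpha> (Sd X \<beta>)) - Br (R \<alpha>) (R (Sd X \<beta>)))"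
    by (simp add: Delta_defect_def Dl_eq)
  show ?thesis
    unfolding 1 2 3 4 5
    using Jacobi[OF R X] Br_skew[of X "Dl \<alpha> \<beta>"] Br_skew[of "R \<beta>" "R (Sd X \<alpha>)"]
    by (simp add: algebra_simps)
qed

text \<open>Passing from \<open>Tp\<close> to its dual \<open>T\<close> flips the sign of the
  curvature. The second derivatives of the pairing cancel up to the failure of the tensor anchor to
  respect brackets, which is the derivative along \<open>Dl \<alpha> \<beta>\<close>.\<close>

lemma pairing_curvature_T:
  assumes \<alpha>: "\<alpha> \<in> \<Gamma>d" and \<beta>: "\<beta> \<in> \<Gamma>d" and \<gamma>: "\<gamma> \<in> \<Gamma>d" and X: "X \<in> \<Gamma>"
  shows "pairing (curvature T \<alpha> \<beta> \<gamma>) X =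
    - (D (Dl \<alpha> \<beta>) (pairing \<gamma> X) + pairing \<gamma> (Delta_defect \<alpha> \<beta> X + R (compat_defect \<alpha> \<beta> X)))"
proof -
  note R = R_closed[OF \<alpha>] R_closed[OF \<beta>]
  have 1: "D (Dl \<alpha> \<beta>) (pairing \<gamma> X) = D (R (Tbr \<alpha> \<beta>)) (pairing \<gamma> X) -
      (D (R \<alpha>) (D (R \<beta>) (pairing \<gamma> X)) - D (R \<beta>) (D (R \<alpha>) (pairing \<gamma> X)))"
    using assms R by (simp add: Dl_eq D_minus_left D_bracket Tbr_closed product_simps)
  show ?thesis
    unfolding curvature_Tp[OF \<alpha> \<beta> X, symmetric] 1
    using assms R
    by (simp add: curvature_def pairing_minus_left pairing_T pairing_minus D_minus Tbr_closed
        product_simps)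
qed

text \<open>Once the compatibility defect is gone, flatness says that a derivative of the pairing
  plus a pairing vanishes. The two summands separate because only the first one fails to be linear
  over functions in the dual section.\<close>

lemma flat_iff:
  assumes K: "\<And>\<alpha> \<beta> X. \<alpha> \<in> \<Gamma>d \<Longrightarrow> \<beta> \<in> \<Gamma>d \<Longrightarrow> X \<in> \<Gamma> \<Longrightarrow> compat_defect \<alpha> \<beta> X = 0"
  shows "(\<forall>\<alpha>\<in>\<Gamma>d. \<forall>\<beta>\<in>\<Gamma>d. \<forall>\<gamma>\<in>\<Gamma>d. curvature T \<alpha> \<beta> \<gamma> = 0) \<longleftrightarrow>
    (\<forall>\<alpha>\<in>\<Gamma>d. \<forall>\<beta>\<in>\<Gamma>d. \<forall>x. \<rho> x (Dl \<alpha> \<beta> x) = 0) \<and>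
    (\<forall>\<alpha>\<in>\<Gamma>d. \<forall>\<beta>\<in>\<Gamma>d. \<forall>X\<in>\<Gamma>. Delta_defect \<alpha> \<beta> X = 0)" (is "?L \<longleftrightarrow> ?R1 \<and> ?R2")
proof
  have pairing: "pairing (curvature T \<alpha> \<beta> \<gamma>) X =
      - (D (Dl \<alpha> \<beta>) (pairing \<gamma> X) + pairing \<gamma> (Delta_defect \<alpha> \<beta> X))"
    if "\<alpha> \<in> \<Gamma>d" "\<beta> \<in> \<Gamma>d" "\<gamma> \<in> \<Gamma>d" "X \<in> \<Gamma>" for \<alpha> \<beta> \<gamma> X
    using pairing_curvature_T[OF that] K that by (simp add: R_0)
  {
    assume R: "?R1 \<and> ?R2"
    show ?L
    proof (intro ballI)
      fix \<alpha> \<beta> \<gamma> assume \<alpha>: "\<alpha> \<in> \<Gamma>d" and \<beta>: "\<beta> \<in> \<Gamma>d" and \<gamma>: "\<gamma> \<in> \<Gamma>d"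
      show "curvature T \<alpha> \<beta> \<gamma> = 0"
      proof (rule dual_section_eqI)
        show "curvature T \<alpha> \<beta> \<gamma> \<in> \<Gamma>d"
          using \<alpha> \<beta> \<gamma> by (simp add: curvature_def Tbr_closed product_simps)
        show "0 \<in> \<Gamma>d" by (rule dual.sections_0)
        fix X assume X: "X \<in> \<Gamma>"
        have "D (Dl \<alpha> \<beta>) (pairing \<gamma> X) = 0"
          using R \<alpha> \<beta> by (auto simp: anchor_deriv_def zero_fun_apply)
        then show "pairing (curvature T \<alpha> \<beta> \<gamma>) X = pairing 0 X"
          using R \<alpha> \<beta> X pairing[OF \<alpha> \<beta> \<gamma> X] by (simp add: pairing_0_left pairing_0[OF \<gamma>])
      qed
    qed
  }
  {
    assume L: ?L
    have sum: "D (Dl \<alpha> \<beta>) (pairing \<gamma> X) + pairing \<gamma> (Delta_defect \<alpha> \<beta> X) = 0"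
      if "\<alpha> \<in> \<Gamma>d" "\<beta> \<in> \<Gamma>d" "\<gamma> \<in> \<Gamma>d" "X \<in> \<Gamma>" for \<alpha> \<beta> \<gamma> X
    proof -
      have "- (D (Dl \<alpha> \<beta>) (pairing \<gamma> X) + pairing \<gamma> (Delta_defect \<alpha> \<beta> X)) = 0"
        unfolding pairing[OF that, symmetric] using L that by (simp add: pairing_0_left)
      then show ?thesis by (simp only: neg_equal_0_iff_equal)
    qed
    have anchor: "\<rho> x (Dl \<alpha> \<beta> x) = 0" if \<alpha>: "\<alpha> \<in> \<Gamma>d" and \<beta>: "\<beta> \<in> \<Gamma>d" for \<alpha> \<beta> x
    proof (cases "\<exists>u\<in>fibre A x. u \<noteq> 0")
      case True
      then obtain u where u: "u \<in> fibre A x" "u \<noteq> 0" by blast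
      \<comment> \<open>A covector that does not vanish on \<open>u\<close> makes the pairing
        nonzero at \<open>x\<close>, so that it can be divided out below.\<close>
      obtain \<beta>0 where \<beta>0: "\<beta>0 \<in> fibre (dual_bundle A) x" "\<beta>0 u \<noteq> \<beta>0 0"
        using dual_fibre_separates[OF u(1) subspace_0[OF subspace_fibre]] u(2) by blast
      obtain X where X: "X \<in> \<Gamma>" "X x = u" using u(1) by (rule section_through)
      obtain \<gamma> where \<gamma>: "\<gamma> \<in> \<Gamma>d" "\<gamma> x = \<beta>0" using \<beta>0(1) by (rule dual.section_through)
      have nz: "pairing \<gamma> X x \<noteq> 0"
        using \<beta>0 X \<gamma> dual_fibre_zero[OF \<beta>0(1)] by (simp add: pairing_def)
      note Dl = Dl_closed[OF \<alpha> \<beta>]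
      show ?thesis
      proof
        fix f
        show "\<rho> x (Dl \<alpha> \<beta> x) f = 0 f"
        proof (cases "f \<in> C")
          case f: True
          \<comment> \<open>This is the identity for \<open>f\<close> times \<open>\<gamma>\<close>;
            subtracting \<open>f\<close> times the identity for \<open>\<gamma>\<close> isolates the
            derivative of \<open>f\<close>.\<close>
          have "D (Dl \<alpha> \<beta>) (f * pairing \<gamma> X) + f * pairing \<gamma> (Delta_defect \<alpha> \<beta> X) = 0"
            using sum[OF \<alpha> \<beta> dual.sections_smul[OF f \<gamma>(1)] X(1)] by (simp add: pairing_smul_left)
          then have "f * (D (Dl \<alpha> \<beta>) (pairing \<gamma> X) + pairing \<gamma> (Delta_defect \<alpha> \<beta> X)) +
              D (Dl \<alpha> \<beta>) f * pairing \<gamma> X = 0"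
            by (simp add: D_times[OF Dl f pairing_smooth[OF \<gamma>(1) X(1)]] algebra_simps)
          then have "D (Dl \<alpha> \<beta>) f * pairing \<gamma> X = 0"
            by (simp add: sum[OF \<alpha> \<beta> \<gamma>(1) X(1)])
          from fun_cong[OF this, of x] show ?thesis
            using nz by (simp add: anchor_deriv_def times_fun_apply zero_fun_apply)
        \<comment> \<open>On non-smooth functions tangent vectors are zero by convention.\<close>
        qed (use tangent_outside[OF anchor_tangent[OF section_fibre[OF Dl]]] in
            \<open>simp add: zero_fun_apply\<close>)
      qed
    next
      case False
      then have "Dl \<alpha> \<beta> x = 0" using section_fibre[OF Dl_closed[OF \<alpha> \<beta>]] by blast
      then show ?thesis by (simp add: anchor_zero)
    qed
    have "Delta_defect \<alpha> \<beta> X = 0" if \<alpha>: "\<alpha> \<in> \<Gamma>d" and \<beta>: "\<beta> \<in> \<Gamma>d" and X: "X \<in> \<Gamma>" for \<alpha> \<beta> X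
    proof (rule section_eqI[OF Delta_defect_closed[OF that] sections_0])
      fix \<gamma> assume \<gamma>: "\<gamma> \<in> \<Gamma>d"
      have "D (Dl \<alpha> \<beta>) (pairing \<gamma> X) = 0"
        using anchor[OF \<alpha> \<beta>] by (auto simp: anchor_deriv_def zero_fun_apply)
      then show "pairing \<gamma> (Delta_defect \<alpha> \<beta> X) = pairing \<gamma> 0"
        using sum[OF \<alpha> \<beta> \<gamma> X] by (simp add: pairing_0[OF \<gamma>])
    qed
    with anchor show "?R1 \<and> ?R2" by blast
  }
qed

end


theorem theorem4p1:
  fixes M :: "('m::{t2_space, second_countable_topology}, 'e::real_inner) atlas"
    and A :: "('m, 'v::real_vector, 'f::real_inner) vbundle"
    and \<rho> :: "'m \<Rightarrow> 'v \<Rightarrow> ('m \<Rightarrow> real) \<Rightarrow> real"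
    and S :: "('m \<Rightarrow> 'v) \<Rightarrow> ('m \<Rightarrow> 'v) \<Rightarrow> ('m \<Rightarrow> 'v)"
    and r \<aa> \<ss> :: "'m \<Rightarrow> ('v \<Rightarrow> real) \<Rightarrow> ('v \<Rightarrow> real) \<Rightarrow> real"
  assumes "left_symmetric_algebroid M A \<rho> S"
    and "r \<in> tensor_sections M A"
    and "r = \<aa> + \<ss>"
    and "\<aa> \<in> tensor_sections M A" and "skew_tensor A \<aa>"
    and "\<ss> \<in> tensor_sections M A" and "symmetric_tensor A \<ss>"
  shows "(left_symmetric_algebroid M (dual_bundle A) (tensor_anchor A \<rho> r) (tensor_product M A \<rho> S r) \<and>
          compatible M A \<rho> S (tensor_anchor A \<rho> r) (tensor_product M A \<rho> S r))
     \<longleftrightarrow>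
       ((\<forall>\<alpha>\<in>dual_sections M A. \<forall>\<beta>\<in>dual_sections M A. \<forall>x.
           \<rho> x (tensor_Delta M A \<rho> S r \<alpha> \<beta> x) = 0) \<and>
        (\<forall>X\<in>sections M A. \<forall>Y\<in>sections M A. \<forall>\<alpha>\<in>dual_sections M A. \<forall>\<beta>\<in>dual_sections M A.
           S2_tensor M A \<rho> S X Y (on_sections \<aa>) \<alpha> \<beta> = 0) \<and>
        (\<forall>\<alpha>\<in>dual_sections M A. \<forall>\<beta>\<in>dual_sections M A. \<forall>X\<in>sections M A.
           bracket S X (tensor_Delta M A \<rho> S r \<alpha> \<beta>)
             - tensor_Delta M A \<rho> S r (dual_product M A \<rho> S X \<alpha>) \<beta>
             - tensor_Delta M A \<rho> S r \<alpha> (dual_product M A \<rho> S X \<beta>) = 0))"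
proof -
  interpret lsa_tensor M A \<rho> S r
    using assms by unfold_locales
  have compat_defect_zero_iff: "compat_defect \<alpha> \<beta> X = 0 \<longleftrightarrow> (\<forall>Y\<in>sections M A. S2_tensor M A \<rho> S X Y (on_sections \<aa>) \<alpha> \<beta> = 0)"
    if "X \<in> sections M A" "\<alpha> \<in> dual_sections M A" "\<beta> \<in> dual_sections M A" for X \<alpha> \<beta>
  proof -
    have double: "2 * g = 0 \<longleftrightarrow> g = 0" for g :: "'m \<Rightarrow> real"
      by (auto simp: fun_eq_iff fun_apply_simps)
    \<comment> \<open>Separation by pairings turns the vanishing of a dual section into scalar
      identities in \<open>Y\<close>, the form in which \<open>S2_tensor\<close> appears.\<close>
    have "compat_defect \<alpha> \<beta> X = 0 \<longleftrightarrow> (\<forall>Y\<in>sections M A. pairing (compat_defect \<alpha> \<beta> X) Y = 0)"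
      using dual_section_eqI[OF compat_defect_closed[OF that(2,3,1)] dual.sections_0]
      by (auto simp: pairing_0_left)
    then show ?thesis
      using compat_defect_eq_S2[OF assms(4,5,7,3) that(1) _ that(2,3)] by (simp add: double)
  qed
  have compat: "compatible M A \<rho> S (tensor_anchor A \<rho> r) (tensor_product M A \<rho> S r) \<longleftrightarrow>
      (\<forall>X\<in>sections M A. \<forall>Y\<in>sections M A. \<forall>\<alpha>\<in>dual_sections M A. \<forall>\<beta>\<in>dual_sections M A.
        S2_tensor M A \<rho> S X Y (on_sections \<aa>) \<alpha> \<beta> = 0)"
    unfolding compatible_iff using compat_defect_zero_iff by blast
  have flat: "left_symmetric_algebroid M (dual_bundle A) (tensor_anchor A \<rho> r) (tensor_product M A \<rho> S r) \<longleftrightarrow>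
      (\<forall>\<alpha>\<in>dual_sections M A. \<forall>\<beta>\<in>dual_sections M A. \<forall>\<gamma>\<in>dual_sections M A.
        curvature (tensor_product M A \<rho> S r) \<alpha> \<beta> \<gamma> = 0)"
    by (simp add: left_symmetric_algebroid_def anchored_dual right_anchored_T)
  show ?thesis
  \<comment> \<open>If compatibility fails, both sides are false by \<open>compat\<close>; if it
    holds, the hypothesis of \<open>flat_iff\<close> is available.\<close>
  proof (cases "compatible M A \<rho> S (tensor_anchor A \<rho> r) (tensor_product M A \<rho> S r)")
    case True
    then have "compat_defect \<alpha> \<beta> X = 0"
      if "\<alpha> \<in> dual_sections M A" "\<beta> \<in> dual_sections M A" "X \<in> sections M A" for \<alpha> \<beta> X
      using that unfolding compatible_iff by blast
    from flat_iff[OF this] show ?thesis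
      using True compat flat unfolding Delta_defect_def by blast
  next
    case False
    then show ?thesis using compat by blast
  qed
qed

end
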